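(* Let $k$ be a finitely generated field of characteristic zero, let $G$ be an abelian group of finite rank whose torsion subgroup $t(G)$ is Chernikov, and let $P$ be a faithful prime ideal of the group algebra $kG$. Then the controller $c(P)$ of $P$ is a finitely generated subgroup of $G$.
   Context: For a group $G$, a field $k$ and an ideal $I$ of $kG$: $I$ is faithful if $G\cap(1+I)=\{1\}$; a subgroup $H\le G$ controls $I$ if $I=(I\cap kH)kG$; the controller $c(I)$ is the intersection of all subgroups of $G$ controlling $I$ (a subgroup $B$ controls $I$ iff $c(I)\le B$). A Chernikov group is a group with a normal subgroup of finite index that is a direct product of finitely many quasicyclic groups. Finite rank means finite Prüfer (special) rank. *)

theory Defs
  imports Main "HOL-Library.Poly_Mapping" "HOL-Computational_Algebra.Primes"
begin

text \<open>The abelian group G is a type 'g of class ab_group_add (written additively);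
  the group algebra kG is the ring of finitely supported functions 'g =>0 'k
  with convolution product (Poly_Mapping). The group element g corresponds
  to Poly_Mapping.single g 1.\<close>

definition is_subgroup :: "'g::ab_group_add set \<Rightarrow> bool" where
  "is_subgroup H \<longleftrightarrow> 0 \<in> H \<and> (\<forall>x\<in>H. \<forall>y\<in>H. x - y \<in> H)"

definition gen_subgroup :: "'g::ab_group_add set \<Rightarrow> 'g set" where
  "gen_subgroup S = \<Inter>{H. is_subgroup H \<and> S \<subseteq> H}"

definition fg_subgroup :: "'g::ab_group_add set \<Rightarrow> bool" where
  "fg_subgroup H \<longleftrightarrow> (\<exists>F. finite F \<and> H = gen_subgroup F)"

fun nsmul :: "nat \<Rightarrow> 'g::ab_group_add \<Rightarrow> 'g" where
  "nsmul 0 g = 0"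
| "nsmul (Suc n) g = g + nsmul n g"

text \<open>Finite Pruefer (special) rank: there is r such that every finitely
  generated subgroup can be generated by at most r elements.\<close>
definition finite_rank_group :: "'g::ab_group_add itself \<Rightarrow> bool" where
  "finite_rank_group _ \<longleftrightarrow> (\<exists>r::nat. \<forall>H::'g set. fg_subgroup H \<longrightarrow>
      (\<exists>F. finite F \<and> card F \<le> r \<and> H = gen_subgroup F))"

definition torsion_subgroup :: "'g::ab_group_add set" where
  "torsion_subgroup = {g. \<exists>n>0. nsmul n g = 0}"

text \<open>Q is a quasicyclic (Pruefer) p-subgroup: Q is generated by elements
  x 1, x 2, ... with x 0 = 0, x 1 \<noteq> 0 and p x (n+1) = x n,
  i.e. Q is isomorphic to Z(p^\<infinity>).\<close>
definition quasicyclic :: "nat \<Rightarrow> 'g::ab_group_add set \<Rightarrow> bool" where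
  "quasicyclic p Q \<longleftrightarrow> prime p \<and> (\<exists>x::nat \<Rightarrow> 'g. x 0 = 0 \<and> x 1 \<noteq> 0 \<and>
      (\<forall>n. nsmul p (x (Suc n)) = x n) \<and> Q = gen_subgroup (range x))"

definition direct_prod_quasicyclic :: "'g::ab_group_add set \<Rightarrow> bool" where
  "direct_prod_quasicyclic N \<longleftrightarrow> (\<exists>(m::nat) (Q::nat \<Rightarrow> 'g set) (p::nat \<Rightarrow> nat).
      (\<forall>i<m. quasicyclic (p i) (Q i)) \<and>
      N = {(\<Sum>i<m. q i) | q. \<forall>i<m. q i \<in> Q i} \<and>
      (\<forall>q. (\<forall>i<m. q i \<in> Q i) \<and> (\<Sum>i<m. q i) = 0 \<longrightarrow> (\<forall>i<m. q i = 0)))"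

definition chernikov :: "'g::ab_group_add set \<Rightarrow> bool" where
  "chernikov T \<longleftrightarrow> is_subgroup T \<and> (\<exists>N. is_subgroup N \<and> N \<subseteq> T \<and>
      finite ((\<lambda>t. (\<lambda>n. t + n) ` N) ` T) \<and> direct_prod_quasicyclic N)"

definition is_subfield :: "'k::field set \<Rightarrow> bool" where
  "is_subfield S \<longleftrightarrow> 0 \<in> S \<and> 1 \<in> S \<and> (\<forall>x\<in>S. \<forall>y\<in>S. x - y \<in> S \<and> x * y \<in> S) \<and>
      (\<forall>x\<in>S. inverse x \<in> S)"

definition fg_field :: "'k::field itself \<Rightarrow> bool" where
  "fg_field _ \<longleftrightarrow> (\<exists>F::'k set. finite F \<and> \<Inter>{S. is_subfield S \<and> F \<subseteq> S} = UNIV)"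

definition is_ideal :: "'r::comm_ring_1 set \<Rightarrow> bool" where
  "is_ideal I \<longleftrightarrow> 0 \<in> I \<and> (\<forall>x\<in>I. \<forall>y\<in>I. x + y \<in> I) \<and> (\<forall>x\<in>I. \<forall>r. r * x \<in> I)"

definition prime_ideal :: "'r::comm_ring_1 set \<Rightarrow> bool" where
  "prime_ideal P \<longleftrightarrow> is_ideal P \<and> P \<noteq> UNIV \<and> (\<forall>a b. a * b \<in> P \<longrightarrow> a \<in> P \<or> b \<in> P)"

definition subalg :: "'g set \<Rightarrow> ('g \<Rightarrow>\<^sub>0 'k::zero) set" where
  "subalg H = {a. Poly_Mapping.keys a \<subseteq> H}"

definition ext_ideal :: "('g::ab_group_add \<Rightarrow>\<^sub>0 'k::comm_ring_1) set \<Rightarrow> ('g \<Rightarrow>\<^sub>0 'k) set" where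
  "ext_ideal S = {(\<Sum>i\<in>F. a i * b i) | (F::nat set) a b. finite F \<and> a ` F \<subseteq> S}"

definition faithful :: "('g::ab_group_add \<Rightarrow>\<^sub>0 'k::comm_ring_1) set \<Rightarrow> bool" where
  "faithful I \<longleftrightarrow> (\<forall>g. Poly_Mapping.single g 1 \<in> {1 + x | x. x \<in> I} \<longrightarrow> g = 0)"

definition controls :: "'g::ab_group_add set \<Rightarrow> ('g \<Rightarrow>\<^sub>0 'k::comm_ring_1) set \<Rightarrow> bool" where
  "controls H I \<longleftrightarrow> I = ext_ideal (I \<inter> subalg H)"

definition controller :: "('g::ab_group_add \<Rightarrow>\<^sub>0 'k::comm_ring_1) set \<Rightarrow> 'g set" where
  "controller I = \<Inter>{H. is_subgroup H \<and> controls H I}"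

end

theory Submission
  imports Defs "HOL-Library.FuncSet" "HOL-Analysis.Continuum_Not_Denumerable" "HOL-Computational_Algebra.Fundamental_Theorem_Algebra"
begin

text \<open>It suffices to find a controlling subgroup on which finite generation can be read off. Since \<open>kG\<close> is
  countable, \<open>kG/P\<close> embeds into \<open>\<complex>\<close>, and by faithfulness \<open>G\<close> becomes a multiplicative subgroup of \<open>\<complex>\<close>.
  Let \<open>L\<close> be a finitely generated field containing \<open>k\<close>, a maximal independent family of \<open>G\<close> and a suitable root
  of unity, and let \<open>L\<^sub>\<infinity>\<close> be its maximal cyclotomic extension. Elements of \<open>G\<close> from distinct cosets modulo
  \<open>L\<^sub>\<infinity>\<close> are linearly independent over \<open>L\<^sub>\<infinity>\<close> by Kummer theory. By Schinzel's theorem on abelian binomials, the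
  part of \<open>G\<close> in \<open>L\<^sub>\<infinity>\<close> is generated by torsion and the part of \<open>G\<close> in a finitely generated field
  \<open>L\<^sub>1 \<supseteq> L\<close>; as only finitely many primes divide the orders of torsion elements, distinct cosets modulo \<open>L\<^sub>1\<close>
  are again independent. So the part \<open>H\<close> of \<open>G\<close> in \<open>L\<^sub>1\<close> controls \<open>P\<close>, and \<open>c(P) \<le> H\<close> is finitely generated
  because every multiplicative group of finite rank in a finitely generated field is: discrete valuations reduce
  this to algebraic numbers, where Northcott's argument applies.\<close>

section \<open>Subrings, algebraic elements and finitely generated fields\<close>

text \<open>The obstacle: Kummer theory wants all roots of unity in the base field, while finite
  generation of the controller wants a finitely generated base field. Hence a second separation of
  cosets, which concerns torsion only. There an embedding multiplies a torsion value
  \<open>z\<close> by \<open>z powi (t - 1)\<close>, and this factor has to lie in the base field.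
  The Chernikov hypothesis supplies one \<open>Q\<close> some power of which kills any given torsion
  element. With \<open>zeta (Q ^ 2)\<close> in the field, \<open>t\<close> is 1 modulo
  \<open>Q ^ 2\<close>, and a suitable iterate of the embedding has only \<open>Q\<close>-th roots
  of unity as factors. Finite rank makes the group countable and bounds the index of the subgroup
  that Schinzel's theorem leaves. All fields are subsets of the one type \<open>complex\<close>,
  where roots of polynomials, roots of unity and absolute values of conjugates are at hand; Galois
  automorphisms become ring homomorphisms on a set of algebraic elements. Degrees are bounded and
  never computed: a uniform degree bound for the elements of a field does the work of a finite
  extension.\<close>

definition is_subring :: "'a::comm_ring_1 set \<Rightarrow> bool" where
  "is_subring S \<longleftrightarrow> 1 \<in> S \<and> (\<forall>x\<in>S. \<forall>y\<in>S. x - y \<in> S \<and> x * y \<in> S)"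

definition poly_over :: "'a::comm_ring_1 set \<Rightarrow> 'a poly \<Rightarrow> bool" where
  "poly_over S p \<longleftrightarrow> (\<forall>i. coeff p i \<in> S)"

context
  fixes S :: "'a::comm_ring_1 set"
  assumes S: "is_subring S"
begin

lemma subring_1: "1 \<in> S" and subring_diff: "x \<in> S \<Longrightarrow> y \<in> S \<Longrightarrow> x - y \<in> S"
  and subring_mult: "x \<in> S \<Longrightarrow> y \<in> S \<Longrightarrow> x * y \<in> S"
  using S by (auto simp: is_subring_def)

lemma subring_0: "0 \<in> S"
  using subring_diff[OF subring_1 subring_1] by simp

lemma subring_uminus: "x \<in> S \<Longrightarrow> - x \<in> S"
  using subring_diff[OF subring_0] by fastforce

lemma subring_add: "x \<in> S \<Longrightarrow> y \<in> S \<Longrightarrow> x + y \<in> S"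
  using subring_diff[OF _ subring_uminus] by fastforce

lemma subring_power: "x \<in> S \<Longrightarrow> x ^ n \<in> S"
  by (induction n) (auto intro: subring_1 subring_mult)

lemma subring_sum: "(\<And>i. i \<in> I \<Longrightarrow> f i \<in> S) \<Longrightarrow> sum f I \<in> S"
  by (induction I rule: infinite_finite_induct) (auto intro: subring_0 subring_add)

lemma subring_prod: "(\<And>i. i \<in> I \<Longrightarrow> f i \<in> S) \<Longrightarrow> prod f I \<in> S"
  by (induction I rule: infinite_finite_induct) (auto intro: subring_1 subring_mult)

lemma subring_of_nat: "of_nat n \<in> S"
  by (induction n) (auto intro: subring_0 subring_1 subring_add)

lemma subring_of_int: "of_int n \<in> S"
  by (cases n rule: int_cases2) (auto intro: subring_of_nat subring_uminus)

lemma poly_over_0 [simp]: "poly_over S 0"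
  by (simp add: poly_over_def subring_0)

lemma poly_over_pCons [simp]: "poly_over S (pCons c p) \<longleftrightarrow> c \<in> S \<and> poly_over S p"
  unfolding poly_over_def by (metis coeff_pCons_0 coeff_pCons_Suc not0_implies_Suc)

lemma poly_over_1 [simp]: "poly_over S 1"
  unfolding one_pCons by (simp add: subring_1)

lemma poly_over_add: "poly_over S p \<Longrightarrow> poly_over S q \<Longrightarrow> poly_over S (p + q)"
  by (simp add: poly_over_def subring_add)

lemma poly_over_diff: "poly_over S p \<Longrightarrow> poly_over S q \<Longrightarrow> poly_over S (p - q)"
  by (simp add: poly_over_def subring_diff)

lemma poly_over_mult: "poly_over S p \<Longrightarrow> poly_over S q \<Longrightarrow> poly_over S (p * q)"
  by (auto simp: poly_over_def coeff_mult intro!: subring_sum subring_mult)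

lemma poly_over_smult: "c \<in> S \<Longrightarrow> poly_over S p \<Longrightarrow> poly_over S (smult c p)"
  by (simp add: poly_over_def subring_mult)

lemma poly_over_monom: "c \<in> S \<Longrightarrow> poly_over S (monom c n)"
  by (simp add: poly_over_def subring_0)

lemma poly_over_sum: "(\<And>i. i \<in> I \<Longrightarrow> poly_over S (f i)) \<Longrightarrow> poly_over S (sum f I)"
  by (induction I rule: infinite_finite_induct) (auto intro: poly_over_add)

lemma poly_over_prod: "(\<And>i. i \<in> I \<Longrightarrow> poly_over S (f i)) \<Longrightarrow> poly_over S (prod f I)"
  by (induction I rule: infinite_finite_induct) (auto intro: poly_over_mult)

lemma poly_over_poly: "poly_over S p \<Longrightarrow> x \<in> S \<Longrightarrow> poly p x \<in> S"
  by (induction p) (auto intro: subring_0 subring_add subring_mult)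

lemma subring_adjoin: "is_subring {poly p x | p. poly_over S p}"
  unfolding is_subring_def
proof (intro conjI ballI)
  show "1 \<in> {poly p x |p. poly_over S p}" 
    by (rule CollectI, rule exI[of _ 1]) simp
next
  fix a b assume "a \<in> {poly p x |p. poly_over S p}" "b \<in> {poly p x |p. poly_over S p}"
  then obtain p q where "a = poly p x" "b = poly q x" "poly_over S p" "poly_over S q" by auto
  then have "a - b = poly (p - q) x \<and> poly_over S (p - q)" "a * b = poly (p * q) x \<and> poly_over S (p * q)"
    by (auto intro: poly_over_mult poly_over_diff)
  then show "a - b \<in> {poly p x |p. poly_over S p}" "a * b \<in> {poly p x |p. poly_over S p}" by blast+
qed

lemma adjoin_superset: "S \<subseteq> {poly p x | p. poly_over S p}"
proof
  fix s assume "s \<in> S"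
  then have "poly_over S [:s:]" "poly [:s:] x = s" by (auto simp: subring_0)
  then show "s \<in> {poly p x | p. poly_over S p}" by (intro CollectI exI[of _ "[:s:]"]) simp
qed

lemma adjoin_self: "x \<in> {poly p x | p. poly_over S p}"
proof -
  have "poly_over S [:0, 1:]" "poly [:0, 1:] x = x" by (auto simp: subring_0 subring_1)
  then show ?thesis by (intro CollectI exI[of _ "[:0, 1:]"]) simp
qed

text \<open>Scaling by the leading coefficient of \<open>m\<close> cancels the top term of
  \<open>p\<close> without any division, so this works over a subring of an arbitrary commutative
  ring, as \<open>hom_root_exists\<close> requires. The bound on \<open>degree q\<close> serves
  there to bound the degree of a cofactor.\<close>

lemma pseudo_division:
  assumes "poly_over S p" "poly_over S m" "m \<noteq> 0"
  shows "\<exists>k q r. poly_over S q \<and> poly_over S r \<and> smult (lead_coeff m ^ k) p = q * m + r \<and>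
    (r = 0 \<or> degree r < degree m) \<and> degree q \<le> degree p - degree m"
  using assms(1)
proof (induction "degree p" arbitrary: p rule: less_induct)
  case less
  show ?case
  proof (cases "p = 0 \<or> degree p < degree m")
    case True
    with less show ?thesis by (intro exI[of _ "0::nat"] exI[of _ 0] exI[of _ p]) auto
  next
    case False
    define b where "b = lead_coeff m"
    define t where "t = monom (lead_coeff p) (degree p - degree m)"
    define p' where "p' = smult b p - t * m"
    have bS: "b \<in> S" using assms(2) by (auto simp: b_def poly_over_def)
    have tS: "poly_over S t" unfolding t_def using less.prems by (intro poly_over_monom) (auto simp: poly_over_def)
    have p'S: "poly_over S p'" unfolding p'_def
      by (intro poly_over_diff poly_over_smult poly_over_mult bS tS less.prems assms)
    have degt: "degree t \<le> degree p - degree m" unfolding t_def by (rule degree_monom_le)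
    have dt: "degree (t * m) \<le> degree p"
      using degree_mult_le[of t m] degt False by linarith
    have "coeff (t * m) (degree p) = lead_coeff p * b"
      using False by (simp add: t_def b_def coeff_monom_mult)
    then have c0: "coeff p' (degree p) = 0" by (simp add: p'_def)
    have dp': "degree p' \<le> degree p" unfolding p'_def
      using dt degree_smult_le[of b p] by (meson degree_diff_le order_trans)
    have p'_small: "p' = 0 \<or> degree p' < degree p"
      by (metis c0 dp' leading_coeff_0_iff order_less_le)
    obtain k q r where kqr: "poly_over S q" "poly_over S r" "smult (b ^ k) p' = q * m + r"
      "r = 0 \<or> degree r < degree m" "degree q \<le> degree p - degree m"
    proof (cases "p' = 0")
      case True
      show ?thesis by (rule that[of 0 0 0]) (use True in auto)
    next
      case False
      then have "degree p' < degree p" using p'_small by auto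
      from less.hyps[OF this p'S] obtain k q r where *: "poly_over S q" "poly_over S r" "smult (b ^ k) p' = q * m + r"
      "r = 0 \<or> degree r < degree m" "degree q \<le> degree p' - degree m" unfolding b_def by blast
      show ?thesis by (rule that[OF *(1-4)]) (use *(5) dp' in linarith)
    qed
    have "smult (b ^ Suc k) p = (q + smult (b ^ k) t) * m + r"
    proof -
      have "smult (b ^ Suc k) p = smult (b ^ k) (p' + t * m)" by (simp add: p'_def mult.commute)
      also have "\<dots> = (q + smult (b ^ k) t) * m + r" using kqr(3) by (simp add: smult_add_right algebra_simps)
      finally show ?thesis .
    qed
    moreover have "degree (q + smult (b ^ k) t) \<le> degree p - degree m"
      using kqr(5) degt degree_smult_le[of "b^k" t] by (meson degree_add_le order_trans)
    moreover have "poly_over S (q + smult (b ^ k) t)"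
      by (intro poly_over_add poly_over_smult subring_power kqr bS tS)
    ultimately show ?thesis using kqr unfolding b_def by blast
  qed
qed

end

lemma poly_over_pderiv: "is_subring S \<Longrightarrow> poly_over S p \<Longrightarrow> poly_over S (pderiv p)"
  unfolding poly_over_def coeff_pderiv using subring_of_nat subring_mult by blast

lemma poly_over_mono: "S \<subseteq> T \<Longrightarrow> poly_over S p \<Longrightarrow> poly_over T p"
  by (auto simp: poly_over_def)

lemma subfield_subring: "is_subfield E \<Longrightarrow> is_subring E"
  by (auto simp: is_subfield_def is_subring_def)

lemma subfield_inverse: "is_subfield E \<Longrightarrow> x \<in> E \<Longrightarrow> inverse x \<in> E"
  by (auto simp: is_subfield_def)

lemma subfield_divide: "is_subfield E \<Longrightarrow> x \<in> E \<Longrightarrow> y \<in> E \<Longrightarrow> x / y \<in> E"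
  by (auto simp: is_subfield_def divide_inverse)

lemma subfield_powi: "is_subfield E \<Longrightarrow> x \<in> E \<Longrightarrow> x powi n \<in> E"
  by (auto simp: power_int_def subfield_inverse subfield_subring subring_power)

lemma is_subfieldI: "is_subring E \<Longrightarrow> (\<And>x. x \<in> E \<Longrightarrow> x \<noteq> 0 \<Longrightarrow> inverse x \<in> E) \<Longrightarrow> is_subfield E"
  unfolding is_subfield_def using subring_0 subring_1 subring_diff subring_mult
  by (metis inverse_zero)

definition gen_field :: "'a::field set \<Rightarrow> 'a set" where
  "gen_field F = \<Inter>{E. is_subfield E \<and> F \<subseteq> E}"

lemma subfield_fld: "is_subfield (gen_field F)"
  by (auto simp: gen_field_def is_subfield_def)

lemma gen_field_superset: "F \<subseteq> gen_field F"
  by (auto simp: gen_field_def)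

lemma gen_field_least: "is_subfield E \<Longrightarrow> F \<subseteq> E \<Longrightarrow> gen_field F \<subseteq> E"
  by (auto simp: gen_field_def)

lemma gen_field_mono: "F \<subseteq> G \<Longrightarrow> gen_field F \<subseteq> gen_field G"
  by (auto simp: gen_field_def)

lemma division_over:
  assumes E: "is_subfield E" and "poly_over E p" "poly_over E m" "m \<noteq> 0"
  obtains q r where "poly_over E q" "poly_over E r" "p = q * m + r" "r = 0 \<or> degree r < degree m"
proof -
  note S = subfield_subring[OF E]
  obtain k q r where *: "poly_over E q" "poly_over E r" "smult (lead_coeff m ^ k) p = q * m + r"
    "r = 0 \<or> degree r < degree m"
    using pseudo_division[OF S assms(2-4)] by blast
  define c where "c = inverse (lead_coeff m ^ k)"
  have "c \<in> E" unfolding c_def using assms(3) by (intro subfield_inverse[OF E] subring_power[OF S]) (auto simp: poly_over_def)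
  moreover have "p = smult c q * m + smult c r"
  proof -
    have "p = smult c (smult (lead_coeff m ^ k) p)" using assms(4) by (simp add: c_def)
    also have "\<dots> = smult c (q * m + r)" by (simp only: *)
    finally show ?thesis by (simp add: smult_add_right)
  qed
  moreover have "smult c r = 0 \<or> degree (smult c r) < degree m" using *(4) by auto
  ultimately show ?thesis using that * poly_over_smult[OF S] by blast
qed

section \<open>Algebraic elements and finite-dimensional extensions\<close>

definition algebraic_deg_le :: "'a::field set \<Rightarrow> nat \<Rightarrow> 'a \<Rightarrow> bool" where
  "algebraic_deg_le E d z \<longleftrightarrow> (\<exists>p. p \<noteq> 0 \<and> poly_over E p \<and> degree p \<le> d \<and> poly p z = 0)"

definition algebraic_over :: "'a::field set \<Rightarrow> 'a \<Rightarrow> bool" where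
  "algebraic_over E z \<longleftrightarrow> (\<exists>d. algebraic_deg_le E d z)"

lemma algebraic_over_altdef: "algebraic_over E z \<longleftrightarrow> (\<exists>p. p \<noteq> 0 \<and> poly_over E p \<and> poly p z = 0)"
  by (auto simp: algebraic_over_def algebraic_deg_le_def)

lemma algebraic_deg_le_mono: "E \<subseteq> E' \<Longrightarrow> algebraic_deg_le E d z \<Longrightarrow> algebraic_deg_le E' d z"
  unfolding algebraic_deg_le_def using poly_over_mono by metis

lemma algebraic_over_mono: "E \<subseteq> E' \<Longrightarrow> algebraic_over E z \<Longrightarrow> algebraic_over E' z"
  unfolding algebraic_over_def using algebraic_deg_le_mono by blast

lemma algebraic_over_self: "is_subfield E \<Longrightarrow> z \<in> E \<Longrightarrow> algebraic_over E z"
proof -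
  assume E: "is_subfield E" and z: "z \<in> E"
  note S = subfield_subring[OF E]
  have "poly_over E [:-z, 1:]" using z by (simp add: S subring_uminus[OF S] subring_1[OF S])
  then show ?thesis unfolding algebraic_over_altdef by (intro exI[of _ "[:-z, 1:]"]) auto
qed

lemma minimal_poly:
  assumes E: "is_subfield E" and z: "algebraic_over E z"
  obtains m where "lead_coeff m = 1" "poly_over E m" "poly m z = 0" "degree m \<ge> 1"
    "\<And>p. poly_over E p \<Longrightarrow> poly p z = 0 \<Longrightarrow> \<exists>q. poly_over E q \<and> p = q * m"
proof -
  note S = subfield_subring[OF E]
  define Q where "Q = (\<lambda>p. p \<noteq> 0 \<and> poly_over E p \<and> poly p z = 0)"
  have "\<exists>p. Q p" using z by (auto simp: algebraic_over_altdef Q_def)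
  then obtain n where n: "Q n" "\<And>p. Q p \<Longrightarrow> degree n \<le> degree p"
    using ex_has_least_nat[of Q _ degree] by auto
  define m where "m = smult (inverse (lead_coeff n)) n"
  have n0: "n \<noteq> 0" using n by (auto simp: Q_def)
  have lc: "lead_coeff m = 1" using n0 by (simp add: m_def)
  have mE: "poly_over E m" unfolding m_def
    using n by (intro poly_over_smult[OF S] subfield_inverse[OF E]) (auto simp: Q_def poly_over_def)
  have mz: "poly m z = 0" using n by (simp add: m_def Q_def)
  have dm: "degree m = degree n" using n0 by (simp add: m_def)
  have "m \<noteq> 0" using lc by auto
  have "degree m \<ge> 1"
  proof (rule ccontr)
    assume "\<not> ?thesis"
    then have "degree m = 0" by simp
    then obtain c where "m = [:c:]" by (rule degree_eq_zeroE)
    with mz \<open>m \<noteq> 0\<close> show False by simp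
  qed
  moreover have "\<exists>q. poly_over E q \<and> p = q * m" if p: "poly_over E p" "poly p z = 0" for p
  proof -
    obtain q r where qr: "poly_over E q" "poly_over E r" "p = q * m + r" "r = 0 \<or> degree r < degree m"
      using division_over[OF E p(1) mE \<open>m \<noteq> 0\<close>] by blast
    have "poly r z = 0" using qr(3) p(2) mz by simp
    then have "r = 0" using n(2)[of r] qr(2,4) dm unfolding Q_def by (metis linorder_not_less)
    then show ?thesis using qr by auto
  qed
  ultimately show ?thesis using that lc mE mz by blast
qed

text \<open>The scalars form a subset of the field and not a type of their own. Adding one scaled
  generator at a time turns facts about spans into inductions.\<close>

inductive_set span_over :: "'a::field set \<Rightarrow> 'a set \<Rightarrow> 'a set" for E B where
  zero: "0 \<in> span_over E B"
| step: "v \<in> span_over E B \<Longrightarrow> c \<in> E \<Longrightarrow> b \<in> B \<Longrightarrow> v + c * b \<in> span_over E B"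

lemma span_over_add:
  assumes "w \<in> span_over E B" "v \<in> span_over E B" shows "v + w \<in> span_over E B"
  using assms by (induction rule: span_over.induct) (auto simp: add.assoc[symmetric] intro: span_over.intros)

lemma span_over_scale:
  assumes E: "is_subfield E" and "v \<in> span_over E B" "c \<in> E" shows "c * v \<in> span_over E B"
  using assms(2)
proof (induction rule: span_over.induct)
  case (step v a b)
  have "c * v + (c * a) * b \<in> span_over E B"
    using step assms subring_mult[OF subfield_subring[OF E]] by (intro span_over.step) auto
  then show ?case by (simp add: algebra_simps)
qed (simp add: span_over.zero)

lemma span_over_sum: "(\<And>i. i \<in> I \<Longrightarrow> f i \<in> span_over E B) \<Longrightarrow> sum f I \<in> span_over E B"
  by (induction I rule: infinite_finite_induct) (auto intro: span_over.zero span_over_add)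

lemma span_over_insertD:
  assumes E: "is_subfield E" and "v \<in> span_over E (insert b B)"
  shows "\<exists>a\<in>E. \<exists>w\<in>span_over E B. v = a * b + w"
  using assms(2)
proof (induction rule: span_over.induct)
  case zero
  show ?case by (rule bexI[of _ 0], rule bexI[of _ 0]) (auto intro: span_over.zero subring_0 subfield_subring E)
next
  case (step v c b')
  then obtain a w where aw: "a \<in> E" "w \<in> span_over E B" "v = a * b + w" by blast
  show ?case
  proof (cases "b' = b")
    case True
    have "v + c * b' = (a + c) * b + w" by (simp add: True aw algebra_simps)
    moreover have "a + c \<in> E" using aw step E by (simp add: subring_add subfield_subring)
    ultimately show ?thesis using aw by blast
  next
    case False
    then have "w + c * b' \<in> span_over E B" using step aw by (intro span_over.step) auto
    moreover have "v + c * b' = a * b + (w + c * b')" by (simp add: aw)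
    ultimately show ?thesis using aw by blast
  qed
qed

text \<open>Gaussian elimination, one generator at a time: a vector with non-zero coefficient at
  \<open>b\<close> clears \<open>b\<close> from the others, which leaves one vector and one
  generator fewer.\<close>

lemma span_over_dependent:
  assumes E: "is_subfield E" and "finite B" "finite I" "card B < card I" "\<And>i. i \<in> I \<Longrightarrow> v i \<in> span_over E B"
  shows "\<exists>c. (\<forall>i\<in>I. c i \<in> E) \<and> (\<exists>i\<in>I. c i \<noteq> 0) \<and> (\<Sum>i\<in>I. c i * v i) = 0"
  using assms(2-)
proof (induction B arbitrary: I v rule: finite_induct)
  case empty
  have "v i = 0" if "i \<in> I" for i using empty(3)[OF that] by (cases rule: span_over.cases) auto
  moreover have "I \<noteq> {}" using empty by auto
  ultimately show ?case by (intro exI[of _ "\<lambda>_. 1"]) (use E in \<open>auto simp: subring_1 subfield_subring\<close>)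
next
  case (insert b B)
  note S = subfield_subring[OF E]
  have "\<forall>i. i \<in> I \<longrightarrow> (\<exists>a w. a \<in> E \<and> w \<in> span_over E B \<and> v i = a * b + w)"
    using span_over_insertD[OF E] insert(6) by blast
  then obtain a w where aw: "\<And>i. i \<in> I \<Longrightarrow> a i \<in> E" "\<And>i. i \<in> I \<Longrightarrow> w i \<in> span_over E B"
    "\<And>i. i \<in> I \<Longrightarrow> v i = a i * b + w i" by metis
  show ?case
  proof (cases "\<forall>i\<in>I. a i = 0")
    case True
    have "v i \<in> span_over E B" if "i \<in> I" for i using aw[OF that] True that by simp
    then show ?thesis using insert.IH[of I v] insert.prems insert.hyps by auto
  next
    case False
    then obtain j where j: "j \<in> I" "a j \<noteq> 0" by blast
    define u where "u = (\<lambda>i. v i - (a i / a j) * v j)"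
    have u: "u i \<in> span_over E B" if "i \<in> I - {j}" for i
    proof -
      have u: "u i = (- (a i / a j)) * w j + w i" using j that aw by (simp add: u_def field_simps)
      have "- (a i / a j) \<in> E" using aw j that by (intro subring_uminus[OF S] subfield_divide[OF E]) auto
      then show ?thesis unfolding u
        using aw j that by (intro span_over_add[OF _ span_over_scale[OF E]]) auto
    qed
    have "card B < card (I - {j})" using insert.prems insert.hyps j by (simp add: card_Diff_singleton)
    moreover have "finite (I - {j})" using insert.prems by simp
    ultimately obtain c where c: "\<forall>i\<in>I - {j}. c i \<in> E" "\<exists>i\<in>I-{j}. c i \<noteq> 0"
      "(\<Sum>i\<in>I - {j}. c i * u i) = 0" using insert.IH[of "I - {j}" u] u by blast
    \<comment> \<open>The multiples of the pivot \<open>v j\<close> that were subtracted from the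
      other vectors are collected as its coefficient.\<close>
    define d where "d = c(j := - (\<Sum>i\<in>I-{j}. c i * (a i / a j)))"
    have "(\<Sum>i\<in>I. d i * v i) = d j * v j + (\<Sum>i\<in>I-{j}. d i * v i)"
      using insert.prems j by (simp add: sum.remove)
    also have "(\<Sum>i\<in>I-{j}. d i * v i) = (\<Sum>i\<in>I-{j}. c i * v i)" by (intro sum.cong) (auto simp: d_def)
    also have "d j * v j + (\<Sum>i\<in>I-{j}. c i * v i) = (\<Sum>i\<in>I - {j}. c i * u i)"
      by (simp add: d_def u_def algebra_simps sum_distrib_left sum_subtractf)
    finally have "(\<Sum>i\<in>I. d i * v i) = 0" using c by simp
    moreover have "\<forall>i\<in>I. d i \<in> E"
    proof
      fix i assume i: "i \<in> I"
      have "- (\<Sum>i\<in>I-{j}. c i * (a i / a j)) \<in> E" 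
        using c aw j by (intro subring_uminus[OF S] subring_sum[OF S] subring_mult[OF S] subfield_divide[OF E]) auto
      then show "d i \<in> E" using c i by (auto simp: d_def)
    qed
    moreover have "\<exists>i\<in>I. d i \<noteq> 0" using c by (auto simp: d_def)
    ultimately show ?thesis by blast
  qed
qed

text \<open>\<open>A\<close> is only asked to be a subring; that it is a field is derived in
  \<open>fin_dim_subfield\<close>. The finite spanning set may lie outside \<open>A\<close>, so only
  an upper bound on the dimension is recorded.\<close>

definition fin_dim :: "'a::field set \<Rightarrow> 'a set \<Rightarrow> bool" where
  "fin_dim E A \<longleftrightarrow> is_subring A \<and> E \<subseteq> A \<and> (\<exists>B. finite B \<and> A \<subseteq> span_over E B)"

lemma fin_dim_refl: "is_subfield E \<Longrightarrow> fin_dim E E"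
proof -
  assume E: "is_subfield E"
  have "E \<subseteq> span_over E {1}" using span_over.step[OF span_over.zero, of _ E 1 "{1}"] by auto
  then show ?thesis by (auto simp: fin_dim_def subfield_subring E)
qed

text \<open>The powers of \<open>a\<close> with exponents 0 to \<open>card B\<close> are one more
  than the spanning elements, hence linearly dependent. The bound is the same for all
  \<open>a\<close>.\<close>

lemma fin_dim_algd:
  assumes E: "is_subfield E" and "fin_dim E A"
  shows "\<exists>d. \<forall>a\<in>A. algebraic_deg_le E d a"
proof -
  from assms obtain B where B: "is_subring A" "finite B" "A \<subseteq> span_over E B" by (auto simp: fin_dim_def)
  have "algebraic_deg_le E (card B) a" if a: "a \<in> A" for a
  proof -
    have "\<exists>c. (\<forall>i\<in>{..card B}. c i \<in> E) \<and> (\<exists>i\<in>{..card B}. c i \<noteq> 0) \<and> (\<Sum>i\<in>{..card B}. c i * a ^ i) = 0"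
      by (rule span_over_dependent[OF E B(2)]) (use B subring_power[OF B(1) a] in auto)
    then obtain c where c: "\<forall>i\<in>{..card B}. c i \<in> E" "\<exists>i\<in>{..card B}. c i \<noteq> 0" "(\<Sum>i\<le>card B. c i * a ^ i) = 0"
      by auto
    define p where "p = (\<Sum>i\<le>card B. monom (c i) i)"
    have cp: "coeff p i = (if i \<le> card B then c i else 0)" for i
      by (auto simp: p_def coeff_sum if_distrib sum.delta cong: if_cong)
    have "p \<noteq> 0" using c(2) cp by (metis atMost_iff coeff_0)
    moreover have "poly_over E p" unfolding poly_over_def using c cp subring_0[OF subfield_subring[OF E]] by auto
    moreover have "degree p \<le> card B" by (rule degree_le) (simp add: cp)
    moreover have "poly p a = 0" using c(3) by (simp add: p_def poly_sum poly_monom)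
    ultimately show ?thesis by (auto simp: algebraic_deg_le_def)
  qed
  then show ?thesis by blast
qed

lemma algebraic_over_inverse_poly:
  assumes E: "is_subfield E" and "p \<noteq> 0" "poly_over E p" "poly p a = 0" "a \<noteq> 0"
  shows "\<exists>q. poly_over E q \<and> inverse a = poly q a"
  using assms(2-4)
proof (induction p)
  case (pCons c q)
  note S = subfield_subring[OF E]
  show ?case
  proof (cases "c = 0")
    case True
    with pCons assms show ?thesis by (auto simp: S)
  next
    case False
    have "inverse a = poly (smult (- inverse c) q) a" using pCons.prems False \<open>a \<noteq> 0\<close> 
      by (simp add: field_simps) (metis add_eq_0_iff add.commute)
    moreover have "poly_over E (smult (- inverse c) q)"
      using pCons.prems by (intro poly_over_smult[OF S] subring_uminus[OF S] subfield_inverse[OF E]) (auto simp: S)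
    ultimately show ?thesis by blast
  qed
qed auto

lemma fin_dim_subfield:
  assumes E: "is_subfield E" and A: "fin_dim E A" shows "is_subfield A"
proof (rule is_subfieldI)
  show S: "is_subring A" using A by (simp add: fin_dim_def)
  fix a assume a: "a \<in> A" "a \<noteq> 0"
  obtain p where "p \<noteq> 0" "poly_over E p" "poly p a = 0"
    using fin_dim_algd[OF E A] a by (auto simp: algebraic_deg_le_def)
  from algebraic_over_inverse_poly[OF E this a(2)] obtain q where "poly_over E q" "inverse a = poly q a" by blast
  moreover have "poly_over A q" using \<open>poly_over E q\<close> A poly_over_mono by (auto simp: fin_dim_def)
  ultimately show "inverse a \<in> A" using poly_over_poly[OF S] a by auto
qed

text \<open>Modulo the minimal polynomial of \<open>x\<close> over \<open>A\<close>, every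
  polynomial in \<open>x\<close> reduces to degree below that of \<open>m\<close>, so the products
  \<open>b * x ^ j\<close> with such \<open>j\<close> span.\<close>

lemma fin_dim_adjoin:
  assumes E: "is_subfield E" and A: "fin_dim E A" and x: "algebraic_over A x"
  shows "\<exists>A'. fin_dim E A' \<and> A \<subseteq> A' \<and> x \<in> A'"
proof -
  note fA = fin_dim_subfield[OF E A]
  note S = subfield_subring[OF fA]
  from A obtain B where B: "finite B" "A \<subseteq> span_over E B" "E \<subseteq> A" by (auto simp: fin_dim_def)
  obtain m where m: "lead_coeff m = 1" "poly_over A m" "poly m x = 0" 
    by (rule minimal_poly[OF fA x]) blast
  define A' where "A' = {poly p x | p. poly_over A p}"
  define B' where "B' = (\<lambda>(b,j). b * x ^ j) ` (B \<times> {..<degree m})"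
  have "A' \<subseteq> span_over E B'"
  proof
    fix z assume "z \<in> A'"
    then obtain p where p: "poly_over A p" "z = poly p x" by (auto simp: A'_def)
    have "m \<noteq> 0" using m by auto
    obtain q r where qr: "poly_over A q" "poly_over A r" "p = q * m + r" "r = 0 \<or> degree r < degree m"
      by (rule division_over[OF fA p(1) m(2) \<open>m \<noteq> 0\<close>])
    have rz: "z = poly r x" using p qr m by simp
    have *: "v * x ^ j \<in> span_over E B'" if "v \<in> span_over E B" "j < degree m" for v j
      using that(1)
    proof (induction rule: span_over.induct)
      case (step v c b)
      have "v * x ^ j + c * (b * x ^ j) \<in> span_over E B'" 
        by (rule span_over.step) (use step that in \<open>auto simp: B'_def\<close>)
      then show ?case by (simp add: algebra_simps)
    qed (simp add: span_over.zero)
    show "z \<in> span_over E B'"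
    proof (cases "r = 0")
      case True then show ?thesis by (simp add: rz span_over.zero)
    next
      case False
      then have d: "degree r < degree m" using qr by simp
      have "z = (\<Sum>i\<le>degree r. coeff r i * x ^ i)" by (simp add: rz poly_altdef)
      also have "\<dots> \<in> span_over E B'"
        by (intro span_over_sum *) (use d qr B in \<open>auto simp: poly_over_def\<close>)
      finally show ?thesis .
    qed
  qed
  moreover have "finite B'" using B by (simp add: B'_def)
  ultimately have "fin_dim E A'" unfolding fin_dim_def 
    using subring_adjoin[OF S] adjoin_superset[OF S] B(3) unfolding A'_def by blast
  then show ?thesis using adjoin_superset[OF S] adjoin_self[OF S] unfolding A'_def by blast
qed

lemma fin_dim_finite:
  assumes E: "is_subfield E" and "finite F" "\<forall>x\<in>F. algebraic_over E x"
  shows "\<exists>A. fin_dim E A \<and> F \<subseteq> A"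
  using assms(2,3)
proof (induction F rule: finite_induct)
  case empty then show ?case using fin_dim_refl[OF E] by auto
next
  case (insert x F)
  then obtain A where A: "fin_dim E A" "F \<subseteq> A" by auto
  have "algebraic_over A x" using insert A algebraic_over_mono by (auto simp: fin_dim_def)
  from fin_dim_adjoin[OF E A(1) this] A show ?case by blast
qed

lemma gen_field_finite_algd:
  assumes E: "is_subfield E" and "finite F" "\<forall>x\<in>F. algebraic_over E x"
  shows "\<exists>d. \<forall>x\<in>gen_field (E \<union> F). algebraic_deg_le E d x"
proof -
  obtain A where A: "fin_dim E A" "F \<subseteq> A" using fin_dim_finite[OF assms] by blast
  have "gen_field (E \<union> F) \<subseteq> A" using A fin_dim_subfield[OF E A(1)] by (intro gen_field_least) (auto simp: fin_dim_def)
  then show ?thesis using fin_dim_algd[OF E A(1)] by blast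
qed

text \<open>Difference, product and inverse stay in the field generated by the two elements, in
  which all degrees are bounded; no annihilating polynomial has to be written down.\<close>

lemma subfield_alg: "is_subfield E \<Longrightarrow> is_subfield {z. algebraic_over E z}"
proof -
  assume E: "is_subfield E"
  have *: "algebraic_over E z" if "z \<in> gen_field (E \<union> {x, y})" "algebraic_over E x" "algebraic_over E y" for x y z
    using gen_field_finite_algd[OF E, of "{x,y}"] that by (auto simp: algebraic_over_def)
  have xy: "x \<in> gen_field (E \<union> {x, y}) \<and> y \<in> gen_field (E \<union> {x, y})" for x y
    by (intro conjI; rule gen_field_superset[THEN subsetD]; simp)
  note F = subfield_fld
  show ?thesis unfolding is_subfield_def
  proof (intro conjI ballI)
    show "0 \<in> {z. algebraic_over E z}" "1 \<in> {z. algebraic_over E z}" using algebraic_over_self[OF E] E by (auto simp: is_subfield_def)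
    fix x y assume "x \<in> {z. algebraic_over E z}" "y \<in> {z. algebraic_over E z}"
    then have a: "algebraic_over E x" "algebraic_over E y" by auto
    show "x - y \<in> {z. algebraic_over E z}" "x * y \<in> {z. algebraic_over E z}" "inverse x \<in> {z. algebraic_over E z}"
      
      using *[OF _ a] xy[of x y] F[of "E \<union> {x,y}"] unfolding is_subfield_def by blast+
  qed
qed

text \<open>Only the finitely many coefficients of one polynomial for \<open>z\<close> matter. They
  lie in a finite-dimensional extension, and adjoining \<open>z\<close> keeps it
  finite-dimensional.\<close>

lemma algebraic_over_trans:
  assumes E: "is_subfield E" and z: "algebraic_over K z" and K: "\<And>x. x \<in> K \<Longrightarrow> algebraic_over E x"
  shows "algebraic_over E z"
proof -
  obtain p where p: "p \<noteq> 0" "poly_over K p" "poly p z = 0" using z by (auto simp: algebraic_over_altdef)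
  have "finite (coeff p ` {..degree p})" by simp
  moreover have "\<forall>x\<in>coeff p ` {..degree p}. algebraic_over E x" using p K by (auto simp: poly_over_def)
  ultimately obtain A where A: "fin_dim E A" "coeff p ` {..degree p} \<subseteq> A" using fin_dim_finite[OF E] by blast
  have "poly_over A p" unfolding poly_over_def
  proof
    fix i show "coeff p i \<in> A"
      using A subring_0[of A] by (cases "i \<le> degree p") (auto simp: fin_dim_def coeff_eq_0)
  qed
  then have "algebraic_over A z" using p by (auto simp: algebraic_over_altdef)
  then show ?thesis using fin_dim_adjoin[OF E A(1)] fin_dim_algd[OF E] by (metis algebraic_over_def)
qed

lemma algebraic_over_fld_trans:
  assumes E: "is_subfield E" and "algebraic_over (gen_field (E \<union> F)) z" "\<And>x. x \<in> F \<Longrightarrow> algebraic_over E x"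
  shows "algebraic_over E z"
proof -
  have "gen_field (E \<union> F) \<subseteq> {z. algebraic_over E z}"
    using assms algebraic_over_self[OF E] by (intro gen_field_least subfield_alg) auto
  then show ?thesis using algebraic_over_trans[OF E assms(2)] by blast
qed

section \<open>Transcendental elements and the descent of degree bounds\<close>

lemma gen_field_adjoin_quotient:
  assumes E: "is_subfield E" and "z \<in> gen_field (insert s E)"
  shows "\<exists>p q. poly_over E p \<and> poly_over E q \<and> poly q s \<noteq> 0 \<and> z = poly p s / poly q s"
proof -
  note S = subfield_subring[OF E]
  define K where "K = {poly p s / poly q s | p q. poly_over E p \<and> poly_over E q \<and> poly q s \<noteq> 0}"
  have KI: "poly p s / poly q s \<in> K" if "poly_over E p" "poly_over E q" "poly q s \<noteq> 0" for p q
    using that unfolding K_def by blast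
  have "is_subfield K" unfolding is_subfield_def
  proof (intro conjI ballI)
    show "0 \<in> K" "1 \<in> K" using KI[of 0 1] KI[of 1 1] by (auto simp: S)
    fix x y assume "x \<in> K" "y \<in> K"
    then obtain p q p' q' where *: "poly_over E p" "poly_over E q" "poly q s \<noteq> 0" "x = poly p s / poly q s"
      "poly_over E p'" "poly_over E q'" "poly q' s \<noteq> 0" "y = poly p' s / poly q' s" unfolding K_def by blast
    have "x - y = poly (p * q' - p' * q) s / poly (q * q') s"
      unfolding *(4) *(8) using *(3,7) by (simp add: field_simps)
    also have "\<dots> \<in> K" using * by (intro KI poly_over_diff poly_over_mult S) auto
    finally show "x - y \<in> K" .
    have "x * y = poly (p * p') s / poly (q * q') s" unfolding *(4) *(8) by simp
    also have "\<dots> \<in> K" using * by (intro KI poly_over_diff poly_over_mult S) auto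
    finally show "x * y \<in> K" .
    show "inverse x \<in> K"
    proof (cases "poly p s = 0")
      case True then show ?thesis using * KI[of 0 1] by (simp add: S)
    next
      case False then show ?thesis using * KI[of q p] by simp
    qed
  qed
  moreover have "insert s E \<subseteq> K"
  proof
    fix x assume "x \<in> insert s E"
    then have "x \<in> {poly p s |p. poly_over E p}" using adjoin_superset[OF S] adjoin_self[OF S] by blast
    then obtain p where "poly_over E p" "x = poly p s" by blast
    then show "x \<in> K" using KI[of p 1] by (simp add: S)
  qed
  ultimately have "gen_field (insert s E) \<subseteq> K" by (rule gen_field_least)
  then show ?thesis using assms(2) unfolding K_def by blast
qed

text \<open>The polynomial relation between \<open>s\<close> and \<open>y\<close> is first read as a polynomial in \<open>y\<close> and then as a polynomial
  in \<open>s\<close>, whose coefficients must vanish.\<close>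
lemma algebraic_deg_le_descend:
  assumes E: "is_subfield E" and y: "algebraic_deg_le (gen_field (insert s E)) d y" and s: "\<not> algebraic_over (gen_field (insert y E)) s"
  shows "algebraic_deg_le E d y"
proof -
  note S = subfield_subring[OF E]
  obtain f where f: "f \<noteq> 0" "poly_over (gen_field (insert s E)) f" "degree f \<le> d" "poly f y = 0"
    using y by (auto simp: algebraic_deg_le_def)
  have "\<forall>i. \<exists>p q. poly_over E p \<and> poly_over E q \<and> poly q s \<noteq> 0 \<and> coeff f i = poly p s / poly q s"
    using gen_field_adjoin_quotient[OF E] f(2) by (auto simp: poly_over_def)
  then obtain p q where pq: "\<And>i. poly_over E (p i)" "\<And>i. poly_over E (q i)" "\<And>i. poly (q i) s \<noteq> 0"
    "\<And>i. coeff f i = poly (p i) s / poly (q i) s" by metis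
  \<comment> \<open>Denominators are cleared: for \<open>i\<close> up to \<open>d\<close>, the value
    of \<open>P i\<close> at \<open>s\<close> is \<open>c\<close> times the coefficient
    \<open>i\<close> of \<open>f\<close>. The relation becomes a double sum in \<open>s\<close> and
    \<open>y\<close>, and \<open>R j\<close> below is its coefficient of
    \<open>s ^ j\<close>.\<close>
  define P where "P = (\<lambda>i. p i * (\<Prod>j\<in>{..d}-{i}. q j))"
  define c where "c = (\<Prod>j\<le>d. poly (q j) s)"
  have c0: "c \<noteq> 0" by (simp add: c_def pq)
  have PE: "poly_over E (P i)" for i unfolding P_def by (intro poly_over_mult poly_over_prod S pq)
  have Ps: "poly (P i) s = c * coeff f i" if "i \<le> d" for i
  proof -
    have "c = poly (q i) s * (\<Prod>j\<in>{..d}-{i}. poly (q j) s)" unfolding c_def using that by (subst prod.remove) auto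
    then show ?thesis using pq(3)[of i] by (simp add: P_def pq(4) poly_prod)
  qed
  define R where "R = (\<lambda>j. \<Sum>i\<le>d. monom (coeff (P i) j) i)"
  have RE: "poly_over E (R j)" for j unfolding R_def
    using PE by (intro poly_over_sum poly_over_monom S) (auto simp: poly_over_def)
  have cR: "coeff (R j) i = (if i \<le> d then coeff (P i) j else 0)" for i j
    by (auto simp: R_def coeff_sum if_distrib sum.delta cong: if_cong)
  have degR: "degree (R j) \<le> d" for j by (rule degree_le) (simp add: cR)
  define N where "N = (MAX i\<in>{..d}. degree (P i))"
  have N: "degree (P i) \<le> N" if "i \<le> d" for i unfolding N_def using that by (intro Max_ge) auto
  define g where "g = (\<Sum>j\<le>N. monom (poly (R j) y) j)"
  have cg: "coeff g j = (if j \<le> N then poly (R j) y else 0)" for j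
    by (auto simp: g_def coeff_sum if_distrib sum.delta cong: if_cong)
  have "poly g s = (\<Sum>j\<le>N. (\<Sum>i\<le>d. coeff (P i) j * y ^ i) * s ^ j)"
    by (simp add: g_def poly_sum poly_monom R_def)
  also have "\<dots> = (\<Sum>i\<le>d. (\<Sum>j\<le>N. coeff (P i) j * s ^ j) * y ^ i)"
    by (subst sum_distrib_right, subst sum.swap) (simp add: sum_distrib_left sum_distrib_right mult_ac)
  also have "\<dots> = (\<Sum>i\<le>d. (c * coeff f i) * y ^ i)"
  proof (intro sum.cong refl)
    fix i assume "i \<in> {..d}"
    then have "(\<Sum>j\<le>N. coeff (P i) j * s ^ j) = poly (P i) s"
      using N[of i] by (subst poly_altdef) (rule sum.mono_neutral_right, auto simp: coeff_eq_0)
    then show "(\<Sum>j\<le>N. coeff (P i) j * s ^ j) * y ^ i = (c * coeff f i) * y ^ i" using Ps \<open>i \<in> {..d}\<close> by simp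
  qed
  also have "\<dots> = c * (\<Sum>i\<le>d. coeff f i * y ^ i)" by (simp add: sum_distrib_left mult_ac)
  also have "(\<Sum>i\<le>d. coeff f i * y ^ i) = poly f y"
    using f(3) by (subst poly_altdef) (rule sum.mono_neutral_right, auto simp: coeff_eq_0)
  finally have "poly g s = 0" using f by simp
  moreover have "poly_over (gen_field (insert y E)) g"
  proof -
    have "poly (R j) y \<in> gen_field (insert y E)" for j
      using RE gen_field_superset[of "insert y E"] 
      by (intro poly_over_poly subfield_subring subfield_fld) (auto intro: poly_over_mono)
    then show ?thesis unfolding poly_over_def cg using subring_0[OF subfield_subring[OF subfield_fld]] by auto
  qed
  ultimately have "g = 0" using s by (auto simp: algebraic_over_altdef)
  have "\<exists>i. coeff f i \<noteq> 0" using f(1) by (meson leading_coeff_0_iff)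
  then obtain i where i: "coeff f i \<noteq> 0" by blast
  then have "i \<le> d" using f(3) le_degree order_trans by blast
  with i have "P i \<noteq> 0" using Ps c0 by fastforce
  then obtain j where j: "coeff (P i) j \<noteq> 0" by (meson leading_coeff_0_iff)
  then have "j \<le> N" using N[OF \<open>i \<le> d\<close>] le_degree order_trans by blast
  then have "poly (R j) y = 0" using \<open>g = 0\<close> cg by (metis coeff_0)
  moreover have "R j \<noteq> 0" using cR[of j i] j \<open>i \<le> d\<close> by auto
  ultimately show ?thesis using RE degR by (auto simp: algebraic_deg_le_def)
qed

text \<open>If \<open>x\<close> were transcendental over \<open>E(u)\<close>, then
  \<open>algebraic_deg_le_descend\<close> would drop \<open>x\<close> from the base field and make
  \<open>u\<close> algebraic over \<open>E\<close>.\<close>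

lemma algebraic_over_exchange:
  assumes E: "is_subfield E" and "\<not> algebraic_over E u" "algebraic_over (gen_field (insert x E)) u"
  shows "algebraic_over (gen_field (insert u E)) x"
  using algebraic_deg_le_descend[OF E, of x _ u] assms unfolding algebraic_over_def by blast

text \<open>\<open>E\<close> is generated by a maximal set of generators over which \<open>u\<close>
  stays transcendental; by exchange, each remaining generator is algebraic over \<open>E(u)\<close>.
  The field thus has bounded degree over the rational functions in \<open>u\<close>, which carry the
  \<open>u\<close>-adic valuation.\<close>

lemma fg_field_over_transcendental:
  assumes F: "finite F" and u: "\<not> algebraic_over (gen_field {}) u" "u \<in> gen_field F"
  shows "\<exists>E d. is_subfield E \<and> \<not> algebraic_over E u \<and> (\<forall>a\<in>gen_field F. algebraic_deg_le (gen_field (insert u E)) d a)"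
proof -
  define Q where "Q = (\<lambda>S. S \<subseteq> F \<and> \<not> algebraic_over (gen_field S) u)"
  have "finite {S. Q S}" by (rule finite_subset[of _ "Pow F"]) (use F in \<open>auto simp: Q_def\<close>)
  moreover have "{} \<in> {S. Q S}" using u by (auto simp: Q_def)
  ultimately obtain S where S: "Q S" "\<And>T. Q T \<Longrightarrow> S \<subseteq> T \<Longrightarrow> S = T"
    using finite_has_maximal[of "{S. Q S}"] by blast
  define E where "E = gen_field S"
  have E: "is_subfield E" and uE: "\<not> algebraic_over E u" using S by (auto simp: E_def Q_def subfield_fld)
  have algebraic_over: "algebraic_over (gen_field (insert u E)) x" if "x \<in> F" for x
  proof (cases "x \<in> S")
    case True
    then have "x \<in> gen_field (insert u E)" using gen_field_superset[of S] gen_field_superset[of "insert u E"] by (auto simp: E_def)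
    then show ?thesis by (rule algebraic_over_self[OF subfield_fld])
  next
    case False
    then have "\<not> Q (insert x S)" using S(2)[of "insert x S"] by auto
    then have "algebraic_over (gen_field (insert x S)) u" using that S(1) by (auto simp: Q_def)
    moreover have "gen_field (insert x S) \<subseteq> gen_field (insert x E)" by (rule gen_field_mono) (use gen_field_superset[of S] in \<open>auto simp: E_def\<close>)
    ultimately have "algebraic_over (gen_field (insert x E)) u" using algebraic_over_mono by blast
    then show ?thesis by (rule algebraic_over_exchange[OF E uE])
  qed
  obtain d where d: "\<forall>x\<in>gen_field (gen_field (insert u E) \<union> F). algebraic_deg_le (gen_field (insert u E)) d x"
    using gen_field_finite_algd[OF subfield_fld F] algebraic_over by blast
  have "gen_field F \<subseteq> gen_field (gen_field (insert u E) \<union> F)" by (rule gen_field_mono) auto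
  then show ?thesis using E uE d by blast
qed

text \<open>The independent elements of \<open>S\<close> are removed one at a time. As
  \<open>a\<close> is algebraic over the prime field, adjoining it cannot make \<open>s\<close>
  algebraic, so each removal keeps the degree bound.\<close>

lemma algebraic_deg_le_descend_finite:
  assumes "finite S" "\<And>s. s \<in> S \<Longrightarrow> \<not> algebraic_over (gen_field (S - {s})) s" "algebraic_over (gen_field {}) a" "algebraic_deg_le (gen_field S) d a"
  shows "algebraic_deg_le (gen_field {}) d a"
  using assms
proof (induction S rule: finite_induct)
  case (insert s S)
  have ns: "\<not> algebraic_over (gen_field S) s" using insert.prems(1)[of s] insert.hyps by simp
  have aS: "algebraic_over (gen_field S) a" using insert.prems(2) algebraic_over_mono[of "gen_field {}" "gen_field S"] gen_field_mono by blast
  have "\<not> algebraic_over (gen_field (insert a (gen_field S))) s"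
    using algebraic_over_fld_trans[OF subfield_fld, of S "{a}" s] aS ns by auto
  moreover have "algebraic_deg_le (gen_field (insert s (gen_field S))) d a"
    using insert.prems(3) algebraic_deg_le_mono[OF gen_field_mono, of "insert s S" "insert s (gen_field S)"] gen_field_superset[of S] by blast
  ultimately have "algebraic_deg_le (gen_field S) d a" using algebraic_deg_le_descend[OF subfield_fld] by blast
  moreover have "\<not> algebraic_over (gen_field (S - {t})) t" if "t \<in> S" for t
    using insert.prems(1)[of t] that algebraic_over_mono[OF gen_field_mono, of "S - {t}" "insert s S - {t}"] by blast
  ultimately show ?case using insert by blast
qed

text \<open>A minimal set of generators over which all of \<open>F\<close> is algebraic is a
  transcendence basis; the degree bound over the field that it generates descends unchanged. This
  takes the place of the fact that the algebraic elements of a finitely generated field form a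
  finite extension of the prime field.\<close>

lemma fg_field_algebraic_elements:
  assumes F: "finite F"
  shows "\<exists>d. \<forall>a\<in>gen_field F. algebraic_over (gen_field {}) a \<longrightarrow> algebraic_deg_le (gen_field {}) d a"
proof -
  define Q where "Q = (\<lambda>S. S \<subseteq> F \<and> (\<forall>x\<in>F. algebraic_over (gen_field S) x))"
  have "Q F" using algebraic_over_self[OF subfield_fld] gen_field_superset by (auto simp: Q_def)
  moreover have "finite {S. Q S}" by (rule finite_subset[of _ "Pow F"]) (use F in \<open>auto simp: Q_def\<close>)
  ultimately obtain S where S: "Q S" "\<And>T. Q T \<Longrightarrow> T \<subseteq> S \<Longrightarrow> S = T"
    using finite_has_minimal[of "{S. Q S}"] by blast
  have "\<not> algebraic_over (gen_field (S - {s})) s" if s: "s \<in> S" for s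
  proof
    assume a: "algebraic_over (gen_field (S - {s})) s"
    have "Q (S - {s})" unfolding Q_def
    proof (intro conjI ballI)
      show "S - {s} \<subseteq> F" using S by (auto simp: Q_def)
      fix x assume "x \<in> F"
      then have "algebraic_over (gen_field S) x" using S by (auto simp: Q_def)
      moreover have "gen_field S \<subseteq> gen_field (gen_field (S - {s}) \<union> {s})" by (rule gen_field_mono) (use gen_field_superset[of "S - {s}"] in auto)
      ultimately have "algebraic_over (gen_field (gen_field (S - {s}) \<union> {s})) x" using algebraic_over_mono by blast
      then show "algebraic_over (gen_field (S - {s})) x" using algebraic_over_fld_trans[OF subfield_fld] a by blast
    qed
    then show False using S(2)[of "S - {s}"] s by blast
  qed
  moreover have "finite S" using S F finite_subset by (auto simp: Q_def)
  moreover obtain d where d: "\<forall>x\<in>gen_field (gen_field S \<union> F). algebraic_deg_le (gen_field S) d x"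
    using gen_field_finite_algd[OF subfield_fld F, of S] S(1) unfolding Q_def by blast
  moreover have "gen_field F \<subseteq> gen_field (gen_field S \<union> F)" by (rule gen_field_mono) auto
  ultimately show ?thesis using algebraic_deg_le_descend_finite[of S] by blast
qed

section \<open>Extension of homomorphisms into the complex numbers\<close>

text \<open>A homomorphism on a carrier: the values of \<open>\<phi>\<close> outside
  \<open>S\<close> are arbitrary. Differences and products match the closure conditions of
  \<open>is_subring\<close>.\<close>

definition hom_on :: "'a::comm_ring_1 set \<Rightarrow> ('a \<Rightarrow> 'b::comm_ring_1) \<Rightarrow> bool" where
  "hom_on S \<phi> \<longleftrightarrow> \<phi> 1 = 1 \<and> (\<forall>x\<in>S. \<forall>y\<in>S. \<phi> (x - y) = \<phi> x - \<phi> y \<and> \<phi> (x * y) = \<phi> x * \<phi> y)"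

context
  fixes S :: "'a::comm_ring_1 set" and \<phi> :: "'a \<Rightarrow> 'b::comm_ring_1"
  assumes S: "is_subring S" and hom: "hom_on S \<phi>"
begin

lemma hom_1: "\<phi> 1 = 1" and hom_diff: "x \<in> S \<Longrightarrow> y \<in> S \<Longrightarrow> \<phi> (x - y) = \<phi> x - \<phi> y"
  and hom_mult: "x \<in> S \<Longrightarrow> y \<in> S \<Longrightarrow> \<phi> (x * y) = \<phi> x * \<phi> y"
  using hom by (auto simp: hom_on_def)

lemma hom_0: "\<phi> 0 = 0"
  using hom_diff[OF subring_1[OF S] subring_1[OF S]] by simp

lemma hom_uminus: "x \<in> S \<Longrightarrow> \<phi> (- x) = - \<phi> x"
  using hom_diff[OF subring_0[OF S]] hom_0 by fastforce

lemma hom_add: "x \<in> S \<Longrightarrow> y \<in> S \<Longrightarrow> \<phi> (x + y) = \<phi> x + \<phi> y"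
  using hom_diff[of x "- y"] hom_uminus subring_uminus[OF S] by simp

lemma hom_power: "x \<in> S \<Longrightarrow> \<phi> (x ^ n) = \<phi> x ^ n"
  by (induction n) (auto simp: hom_1 hom_mult subring_power[OF S])

lemma hom_sum: "(\<And>i. i \<in> I \<Longrightarrow> f i \<in> S) \<Longrightarrow> \<phi> (sum f I) = (\<Sum>i\<in>I. \<phi> (f i))"
  by (induction I rule: infinite_finite_induct) (auto simp: hom_0 hom_add subring_sum[OF S])

lemma hom_prod: "(\<And>i. i \<in> I \<Longrightarrow> f i \<in> S) \<Longrightarrow> \<phi> (prod f I) = (\<Prod>i\<in>I. \<phi> (f i))"
  by (induction I rule: infinite_finite_induct) (auto simp: hom_1 hom_mult subring_prod[OF S])

lemma hom_of_nat: "\<phi> (of_nat n) = of_nat n"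
  by (induction n) (auto simp: hom_0 hom_1 hom_add subring_of_nat[OF S] subring_1[OF S])

lemma coeff_hom: "coeff (map_poly \<phi> p) i = \<phi> (coeff p i)"
  by (simp add: coeff_map_poly hom_0)

lemma map_poly_diff_hom:
  "poly_over S p \<Longrightarrow> poly_over S q \<Longrightarrow> map_poly \<phi> (p - q) = map_poly \<phi> p - map_poly \<phi> q"
  by (rule poly_eqI) (auto simp: coeff_hom hom_diff poly_over_def)

lemma map_poly_add_hom:
  "poly_over S p \<Longrightarrow> poly_over S q \<Longrightarrow> map_poly \<phi> (p + q) = map_poly \<phi> p + map_poly \<phi> q"
  by (rule poly_eqI) (auto simp: coeff_hom hom_add poly_over_def)

lemma map_poly_mult_hom:
  "poly_over S p \<Longrightarrow> poly_over S q \<Longrightarrow> map_poly \<phi> (p * q) = map_poly \<phi> p * map_poly \<phi> q"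
  by (rule poly_eqI)
    (auto simp: coeff_hom coeff_mult hom_sum hom_mult poly_over_def subring_mult[OF S])

lemma map_poly_smult_hom:
  "c \<in> S \<Longrightarrow> poly_over S p \<Longrightarrow> map_poly \<phi> (smult c p) = smult (\<phi> c) (map_poly \<phi> p)"
  by (rule poly_eqI) (auto simp: coeff_hom hom_mult poly_over_def)

lemma hom_poly: "poly_over S p \<Longrightarrow> x \<in> S \<Longrightarrow> \<phi> (poly p x) = poly (map_poly \<phi> p) (\<phi> x)"
proof (induction p)
  case (pCons c p)
  then have "c \<in> S" "poly_over S p" by (auto simp: S)
  with pCons show ?case
    by (simp add: map_poly_pCons hom_0 hom_add hom_mult subring_mult[OF S] poly_over_poly[OF S])
qed (simp add: hom_0)

end

lemma ideal_add: "is_ideal P \<Longrightarrow> x \<in> P \<Longrightarrow> y \<in> P \<Longrightarrow> x + y \<in> P"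
  and ideal_mult: "is_ideal P \<Longrightarrow> x \<in> P \<Longrightarrow> r * x \<in> P"
  and ideal_0: "is_ideal P \<Longrightarrow> 0 \<in> P"
  by (auto simp: is_ideal_def)

lemma ideal_mult2: "is_ideal P \<Longrightarrow> x \<in> P \<Longrightarrow> x * r \<in> P"
  using ideal_mult[of P x r] by (simp add: mult.commute)

lemma ideal_uminus: "is_ideal P \<Longrightarrow> x \<in> P \<Longrightarrow> - x \<in> P"
  using ideal_mult[of P x "-1"] by simp

lemma ideal_diff: "is_ideal P \<Longrightarrow> x \<in> P \<Longrightarrow> y \<in> P \<Longrightarrow> x - y \<in> P"
  using ideal_add[of P x "- y"] ideal_uminus by auto

lemma ideal_sum: "is_ideal P \<Longrightarrow> (\<And>i. i \<in> I \<Longrightarrow> f i \<in> P) \<Longrightarrow> sum f I \<in> P"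
  by (induction I rule: infinite_finite_induct) (auto intro: ideal_0 ideal_add)

lemma ideal_poly: "is_ideal P \<Longrightarrow> (\<And>i. coeff p i \<in> P) \<Longrightarrow> poly p x \<in> P"
  unfolding poly_altdef by (intro ideal_sum ideal_mult2) auto

lemma prime_ideal_power: "prime_ideal P \<Longrightarrow> b \<notin> P \<Longrightarrow> b ^ k \<notin> P"
proof (induction k)
  case 0
  show ?case
  proof
    assume "b ^ 0 \<in> P"
    then have "r \<in> P" for r using ideal_mult[of P 1 r] 0 by (auto simp: prime_ideal_def)
    then show False using 0 by blast
  qed
qed (auto simp: prime_ideal_def)

text \<open>By \<open>xy\<close>, the element \<open>x\<close> modulo \<open>P\<close> and the
  number \<open>y\<close> satisfy the same polynomial relations over \<open>S\<close>. So evaluating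
  any representing polynomial at \<open>y\<close> is well defined, and the kernel is again given by
  \<open>P\<close>.\<close>

lemma hom_adjoin:
  fixes \<phi> :: "'a::comm_ring_1 \<Rightarrow> 'b::comm_ring_1"
  assumes S: "is_subring S" and hom: "hom_on S \<phi>" and P: "is_ideal P"
    and xy: "\<And>p. poly_over S p \<Longrightarrow> poly p x \<in> P \<longleftrightarrow> poly (map_poly \<phi> p) y = 0"
  shows "\<exists>\<psi>. hom_on {poly p x | p. poly_over S p} \<psi> \<and> (\<forall>s\<in>S. \<psi> s = \<phi> s) \<and> \<psi> x = y \<and>
    (\<forall>z\<in>{poly p x | p. poly_over S p}. \<psi> z = 0 \<longleftrightarrow> z \<in> P)"
proof -
  define \<psi> where "\<psi> = (\<lambda>z. poly (map_poly \<phi> (SOME p. poly_over S p \<and> poly p x = z)) y)"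
  have \<psi>: "\<psi> (poly p x) = poly (map_poly \<phi> p) y" if p: "poly_over S p" for p
  proof -
    define q where "q = (SOME q. poly_over S q \<and> poly q x = poly p x)"
    have q: "poly_over S q \<and> poly q x = poly p x" unfolding q_def by (rule someI[of _ p]) (use p in auto)
    then have "poly (p - q) x \<in> P" using ideal_0[OF P] by simp
    then have "poly (map_poly \<phi> (p - q)) y = 0" using xy poly_over_diff[OF S] p q by blast
    then show ?thesis using map_poly_diff_hom[OF S hom p] q by (simp add: \<psi>_def q_def[symmetric])
  qed
  have "hom_on {poly p x | p. poly_over S p} \<psi>" unfolding hom_on_def
  proof (intro conjI ballI)
    show "\<psi> 1 = 1" using \<psi>[of 1] S by (simp add: map_poly_1' hom_1[OF S hom])
    fix a b assume "a \<in> {poly p x |p. poly_over S p}" "b \<in> {poly p x |p. poly_over S p}"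
    then obtain p q where pq: "a = poly p x" "b = poly q x" "poly_over S p" "poly_over S q" by auto
    show "\<psi> (a - b) = \<psi> a - \<psi> b"
      using \<psi>[OF poly_over_diff[OF S pq(3,4)]] pq \<psi> by (simp add: map_poly_diff_hom[OF S hom])
    show "\<psi> (a * b) = \<psi> a * \<psi> b"
      using \<psi>[OF poly_over_mult[OF S pq(3,4)]] pq \<psi> by (simp add: map_poly_mult_hom[OF S hom])
  qed
  moreover have "\<psi> s = \<phi> s" if "s \<in> S" for s
    using \<psi>[of "[:s:]"] that by (simp add: S map_poly_pCons hom_0[OF S hom] subring_0[OF S])
  moreover have "\<psi> x = y"
    using \<psi>[of "[:0, 1:]"] by (simp add: S map_poly_pCons hom_0[OF S hom] hom_1[OF S hom] subring_0[OF S] subring_1[OF S])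
  ultimately show ?thesis using \<psi> xy by (intro exI[of _ \<psi>]) auto
qed

text \<open>Everything is read modulo \<open>P\<close>. Among the polynomials that vanish at
  \<open>x\<close> and have a coefficient outside \<open>P\<close>, one of least degree plays the
  minimal polynomial, and \<open>y\<close> is a complex root of its image. All divisions are
  pseudo-divisions, and primeness of \<open>P\<close> cancels the powers of leading coefficients
  that they introduce.\<close>

lemma hom_root_exists:
  fixes \<phi> :: "'a::comm_ring_1 \<Rightarrow> complex"
  assumes S: "is_subring S" and hom: "hom_on S \<phi>" and P: "prime_ideal P"
    and ker: "\<And>s. s \<in> S \<Longrightarrow> \<phi> s = 0 \<longleftrightarrow> s \<in> P"
    and f: "poly_over S f" "coeff f i0 \<notin> P" "poly f x \<in> P"
  shows "\<exists>y. \<forall>p. poly_over S p \<longrightarrow> (poly p x \<in> P \<longleftrightarrow> poly (map_poly \<phi> p) y = 0)"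
proof -
  have I: "is_ideal P" using P by (simp add: prime_ideal_def)
  have pr: "a \<in> P \<or> b \<in> P" if "a * b \<in> P" for a b using P that by (auto simp: prime_ideal_def)
  have coS: "coeff p i \<in> S" if "poly_over S p" for p i using that by (simp add: poly_over_def)
  define Q where "Q = (\<lambda>p. poly_over S p \<and> (\<exists>i. coeff p i \<notin> P) \<and> poly p x \<in> P)"
  have "Q f" using f by (auto simp: Q_def)
  then obtain p where p: "Q p" "\<And>q. Q q \<Longrightarrow> degree p \<le> degree q"
    using ex_has_least_nat[of Q _ degree] by auto
  define n where "n = degree p"
  define b where "b = lead_coeff p"
  have pS: "poly_over S p" and px: "poly p x \<in> P" using p by (auto simp: Q_def)
  have bS: "b \<in> S" using coS[OF pS] by (simp add: b_def)
  have drop_lead: "degree (q - monom (lead_coeff q) (degree q)) < degree q"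
    if "degree q \<noteq> 0" for q :: "'a poly"
  proof -
    let ?r = "q - monom (lead_coeff q) (degree q)"
    have "degree ?r \<le> degree q" by (intro degree_diff_le degree_monom_le) auto
    moreover have "coeff ?r (degree q) = 0" by simp
    ultimately show ?thesis using that by (metis degree_0 leading_coeff_0_iff order_less_le neq0_conv)
  qed
  have const: "q = [:lead_coeff q:]" if "degree q = 0" for q :: "'a poly"
    using that by (metis degree_eq_zeroE coeff_pCons_0)
  have n1: "n \<noteq> 0"
  proof
    assume "n = 0"
    then have c: "p = [:b:]" using const by (simp add: n_def b_def)
    then have "b \<in> P" using px by (metis poly_pCons poly_0 mult_zero_right add_0_right)
    moreover obtain i where "coeff p i \<notin> P" using p by (auto simp: Q_def)
    ultimately show False using c ideal_0[OF I] by (metis coeff_pCons_0 coeff_pCons_Suc coeff_0 not0_implies_Suc)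
  qed
  have bP: "b \<notin> P"
  proof
    assume bP: "b \<in> P"
    let ?r = "p - monom b n"
    have "poly_over S ?r" by (intro poly_over_diff poly_over_monom S pS bS)
    moreover obtain i where i: "coeff p i \<notin> P" using p by (auto simp: Q_def)
    then have "i \<noteq> n" using bP by (auto simp: b_def n_def)
    then have "coeff ?r i \<notin> P" using i by simp
    moreover have "poly ?r x \<in> P" using px bP by (simp add: poly_monom ideal_diff[OF I] ideal_mult2[OF I])
    ultimately have "Q ?r" unfolding Q_def by blast
    then show False using p(2)[of ?r] drop_lead[of p] n1 by (simp add: n_def b_def)
  qed
  have small: "coeff r i \<in> P" if "poly_over S r" "poly r x \<in> P" "r = 0 \<or> degree r < n" for r i
  proof (rule ccontr)
    assume i: "coeff r i \<notin> P"
    then have "r \<noteq> 0" using ideal_0[OF I] by auto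
    moreover have "Q r" using that i by (auto simp: Q_def)
    ultimately show False using p(2)[of r] that by (auto simp: n_def)
  qed
  have p0: "p \<noteq> 0" using n1 by (auto simp: n_def)
  have \<phi>0: "\<phi> 0 = 0" by (rule hom_0[OF S hom])
  have \<phi>zero: "map_poly \<phi> r = 0" if "poly_over S r" "\<And>i. coeff r i \<in> P" for r
    by (rule poly_eqI) (use that ker coS in \<open>simp add: coeff_hom[OF S hom]\<close>)
  have "degree (map_poly \<phi> p) \<noteq> 0"
  proof -
    have "coeff (map_poly \<phi> p) n \<noteq> 0" using ker[OF bS] bP by (simp add: coeff_hom[OF S hom] b_def n_def)
    then show ?thesis using le_degree n1 by fastforce
  qed
  then obtain y where y: "poly (map_poly \<phi> p) y = 0"
    using fundamental_theorem_of_algebra[of "map_poly \<phi> p"] by (auto simp: constant_degree)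
  \<comment> \<open>Pseudo-division by \<open>g\<close>, evaluated at \<open>x\<close> and, through
    \<open>\<phi>\<close>, at \<open>y\<close>.\<close>
  have rem: "\<exists>k h r. poly_over S h \<and> poly_over S r \<and> smult (lead_coeff g ^ k) q = h * g + r \<and> (r = 0 \<or> degree r < degree g)
    \<and> degree h \<le> degree q - degree g \<and> lead_coeff g ^ k * poly q x = poly h x * poly g x + poly r x \<and>
     \<phi> (lead_coeff g) ^ k * poly (map_poly \<phi> q) y = poly (map_poly \<phi> h) y * poly (map_poly \<phi> g) y + poly (map_poly \<phi> r) y"
    if g: "poly_over S g" "g \<noteq> 0" and q: "poly_over S q" for g q
  proof -
    obtain k h r where *: "poly_over S h" "poly_over S r" "smult (lead_coeff g ^ k) q = h * g + r"
      "r = 0 \<or> degree r < degree g" "degree h \<le> degree q - degree g"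
      using pseudo_division[OF S q g] by blast
    have "lead_coeff g ^ k \<in> S" using g by (intro subring_power[OF S] coS)
    have "map_poly \<phi> (smult (lead_coeff g ^ k) q) = map_poly \<phi> (h * g + r)" using * by simp
    moreover have "map_poly \<phi> (smult (lead_coeff g ^ k) q) = smult (\<phi> (lead_coeff g) ^ k) (map_poly \<phi> q)"
      using map_poly_smult_hom[OF S hom \<open>lead_coeff g ^ k \<in> S\<close> q] hom_power[OF S hom coS[OF g(1)]] by simp
    moreover have "map_poly \<phi> (h * g + r) = map_poly \<phi> h * map_poly \<phi> g + map_poly \<phi> r"
      using map_poly_add_hom[OF S hom poly_over_mult[OF S *(1) g(1)] *(2)] map_poly_mult_hom[OF S hom *(1) g(1)] by simp
    ultimately have "smult (\<phi> (lead_coeff g) ^ k) (map_poly \<phi> q) = map_poly \<phi> h * map_poly \<phi> g + map_poly \<phi> r"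
      by (simp only:)
    then have "poly (smult (\<phi> (lead_coeff g) ^ k) (map_poly \<phi> q)) y = poly (map_poly \<phi> h * map_poly \<phi> g + map_poly \<phi> r) y"
      by (rule arg_cong)
    moreover have "poly (smult (lead_coeff g ^ k) q) x = poly (h * g + r) x" by (simp only: *(3))
    then have "lead_coeff g ^ k * poly q x = poly h x * poly g x + poly r x" by simp
    ultimately show ?thesis using *
      by - (rule exI[of _ k], rule exI[of _ h], rule exI[of _ r], simp)
  qed
  have fwd: "poly (map_poly \<phi> q) y = 0" if q: "poly_over S q" "poly q x \<in> P" for q
  proof -
    obtain k h r where *: "poly_over S h" "poly_over S r" "r = 0 \<or> degree r < n"
      "b ^ k * poly q x = poly h x * poly p x + poly r x"
      "\<phi> b ^ k * poly (map_poly \<phi> q) y = poly (map_poly \<phi> h) y * poly (map_poly \<phi> p) y + poly (map_poly \<phi> r) y"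
      using rem[OF pS p0 q(1)] unfolding n_def b_def by blast
    have "poly r x = b ^ k * poly q x - poly h x * poly p x" using * by simp
    then have "poly r x \<in> P" using q px by (simp add: ideal_diff[OF I] ideal_mult[OF I])
    then have "map_poly \<phi> r = 0" using small * \<phi>zero by blast
    then have "\<phi> b ^ k * poly (map_poly \<phi> q) y = 0" using * y by simp
    then show ?thesis using ker[OF bS] bP by simp
  qed
  \<comment> \<open>Irreducibility of \<open>p\<close>: let \<open>g\<close> have least degree among
    polynomials vanishing at \<open>y\<close> but not at \<open>x\<close>. Pseudo-division of
    \<open>p\<close> by \<open>g\<close> leaves a remainder that vanishes at both, so the cofactor
    \<open>h\<close> vanishes at \<open>x\<close>, in degree below \<open>n\<close>.\<close>
  have bwd: "poly q x \<in> P" if q: "poly_over S q" "poly (map_poly \<phi> q) y = 0" for q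
  proof (rule ccontr)
    assume contr: "poly q x \<notin> P"
    define R where "R = (\<lambda>q. poly_over S q \<and> poly (map_poly \<phi> q) y = 0 \<and> poly q x \<notin> P)"
    have "R q" using q contr by (simp add: R_def)
    then obtain g where g: "R g" "\<And>q. R q \<Longrightarrow> degree g \<le> degree q"
      using ex_has_least_nat[of R _ degree] by auto
    have gS: "poly_over S g" and gy: "poly (map_poly \<phi> g) y = 0" and gx: "poly g x \<notin> P" using g by (auto simp: R_def)
    define c where "c = lead_coeff g"
    have cS: "c \<in> S" using coS[OF gS] by (simp add: c_def)
    have g0: "g \<noteq> 0" using gx ideal_0[OF I] by auto
    have dg: "degree g \<noteq> 0"
    proof
      assume "degree g = 0"
      then have "g = [:c:]" using const by (simp add: c_def)
      then have "\<phi> c = 0" "c \<notin> P" using gy gx by (simp_all add: map_poly_pCons \<phi>0)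
      then show False using ker cS by simp
    qed
    have cP: "c \<notin> P"
    proof
      assume cP: "c \<in> P"
      let ?m = "monom c (degree g)"
      have mS: "poly_over S ?m" by (intro poly_over_monom S cS)
      have "map_poly \<phi> ?m = 0" by (rule \<phi>zero[OF mS]) (simp add: cP ideal_0[OF I])
      then have "poly (map_poly \<phi> (g - ?m)) y = 0" using gy by (simp add: map_poly_diff_hom[OF S hom gS mS])
      moreover have "poly (g - ?m) x \<notin> P"
      proof
        assume "poly (g - ?m) x \<in> P"
        moreover have "poly ?m x \<in> P" using cP by (simp add: poly_monom ideal_mult2[OF I])
        ultimately have "poly (g - ?m) x + poly ?m x \<in> P" by (rule ideal_add[OF I])
        then show False using gx by simp
      qed
      ultimately have "R (g - ?m)" using poly_over_diff[OF S gS mS] by (simp add: R_def)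
      then show False using g(2) drop_lead[OF dg] by (fastforce simp: c_def)
    qed
    have "degree g < n"
    proof -
      obtain k h r where *: "poly_over S h" "poly_over S r" "r = 0 \<or> degree r < n"
        "b ^ k * poly g x = poly h x * poly p x + poly r x"
        "\<phi> b ^ k * poly (map_poly \<phi> g) y = poly (map_poly \<phi> h) y * poly (map_poly \<phi> p) y + poly (map_poly \<phi> r) y"
        using rem[OF pS p0 gS] unfolding n_def b_def by blast
      have "poly r x \<notin> P"
      proof
        assume "poly r x \<in> P"
        then have "b ^ k * poly g x \<in> P" using * px by (simp add: ideal_add[OF I] ideal_mult[OF I])
        then show False using pr prime_ideal_power[OF P bP] gx by blast
      qed
      moreover have "poly (map_poly \<phi> r) y = 0" using * y gy by simp
      ultimately have "R r" using * by (simp add: R_def)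
      moreover have "r \<noteq> 0" using \<open>poly r x \<notin> P\<close> ideal_0[OF I] by auto
      ultimately show ?thesis using g(2)[of r] * by simp
    qed
    obtain k h r where *: "poly_over S h" "poly_over S r" "smult (c ^ k) p = h * g + r" "r = 0 \<or> degree r < degree g"
      "degree h \<le> n - degree g" "c ^ k * poly p x = poly h x * poly g x + poly r x"
      "\<phi> c ^ k * poly (map_poly \<phi> p) y = poly (map_poly \<phi> h) y * poly (map_poly \<phi> g) y + poly (map_poly \<phi> r) y"
      using rem[OF gS g0 pS] unfolding n_def c_def by blast
    have "poly (map_poly \<phi> r) y = 0" using * y gy by simp
    have rP: "poly r x \<in> P"
    proof (cases "r = 0")
      case True then show ?thesis using ideal_0[OF I] by simp
    next
      case False
      then show ?thesis using g(2)[of r] * \<open>poly (map_poly \<phi> r) y = 0\<close> by (auto simp: R_def)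
    qed
    have "poly h x * poly g x = c ^ k * poly p x - poly r x" using * by simp
    then have "poly h x * poly g x \<in> P" using px rP by (simp add: ideal_diff[OF I] ideal_mult[OF I])
    then have "poly h x \<in> P" using gx pr by blast
    moreover have "degree h < n" using * dg \<open>degree g < n\<close> by linarith
    ultimately have hP: "coeff h i \<in> P" for i using small[OF *(1)] by blast
    \<comment> \<open>All coefficients of \<open>h\<close> lie in \<open>P\<close>, so the
      coefficients at degree \<open>n\<close> put \<open>c ^ k * b\<close> into the prime ideal
      \<open>P\<close>, although \<open>b\<close> and \<open>c\<close> are outside.\<close>
    have "coeff (h * g) n \<in> P" unfolding coeff_mult by (intro ideal_sum[OF I] ideal_mult2[OF I] hP)
    moreover have "coeff r n = 0" using * \<open>degree g < n\<close> by (auto simp: coeff_eq_0)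
    moreover have "coeff (smult (c ^ k) p) n = coeff (h * g + r) n" using * by simp
    ultimately have "c ^ k * b \<in> P" by (simp add: b_def n_def)
    then show False using pr prime_ideal_power[OF P cP] bP by blast
  qed
  show ?thesis using fwd bwd by blast
qed

lemma countable_algebraic:
  assumes "countable (C :: complex set)"
  shows "countable {y. \<exists>p. p \<noteq> 0 \<and> (\<forall>i. coeff p i \<in> C) \<and> poly p y = 0}"
proof -
  have "countable {p. p \<noteq> 0 \<and> (\<forall>i. coeff p i \<in> C)}"
  proof (rule countable_subset)
    show "{p. p \<noteq> 0 \<and> (\<forall>i. coeff p i \<in> C)} \<subseteq> Poly ` lists C"
    proof
      fix p assume "p \<in> {p. p \<noteq> 0 \<and> (\<forall>i. coeff p i \<in> C)}"
      then have "p = Poly (coeffs p)" "set (coeffs p) \<subseteq> C" by (simp, auto simp: coeffs_def)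
      then show "p \<in> Poly ` lists C" by (metis imageI in_lists_conv_set subsetD)
    qed
    show "countable (Poly ` lists C)" using assms by (intro countable_image countable_lists)
  qed
  then have "countable (\<Union>p\<in>{p. p \<noteq> 0 \<and> (\<forall>i. coeff p i \<in> C)}. {y. poly p y = 0})"
    by (intro countable_UN) (auto intro: countable_finite poly_roots_finite)
  then show ?thesis by (rule countable_subset[rotated]) auto
qed

text \<open>An algebraic \<open>x\<close> goes to a root. A transcendental \<open>x\<close> can go
  to any number transcendental over the image of \<open>S\<close>, and a countable image leaves such
  numbers in \<open>\<complex>\<close>.\<close>

lemma hom_extension_point:
  fixes \<phi> :: "'a::comm_ring_1 \<Rightarrow> complex"
  assumes S: "is_subring S" and hom: "hom_on S \<phi>" and P: "prime_ideal P"
    and ker: "\<And>s. s \<in> S \<Longrightarrow> \<phi> s = 0 \<longleftrightarrow> s \<in> P"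
    and x: "countable S \<or> (\<exists>f i. poly_over S f \<and> coeff f i \<notin> P \<and> poly f x \<in> P)"
  shows "\<exists>y. \<forall>p. poly_over S p \<longrightarrow> (poly p x \<in> P \<longleftrightarrow> poly (map_poly \<phi> p) y = 0)"
proof (cases "\<exists>f i. poly_over S f \<and> coeff f i \<notin> P \<and> poly f x \<in> P")
  case True
  then show ?thesis using hom_root_exists[OF S hom P ker] by blast
next
  case False
  then have "countable (\<phi> ` S)" using x by blast
  from countable_algebraic[OF this] have "{y. \<exists>p. p \<noteq> 0 \<and> (\<forall>i. coeff p i \<in> \<phi> ` S) \<and> poly p y = 0} \<noteq> UNIV" (is "?Y \<noteq> _")
    using uncountable_UNIV_complex by (metis (no_types))
  moreover have "\<exists>y. y \<notin> Y" if "Y \<noteq> UNIV" for Y :: "complex set" using that by blast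
  ultimately have "\<exists>y. y \<notin> ?Y" by blast
  then obtain y where y: "\<And>p. p \<noteq> 0 \<Longrightarrow> (\<forall>i. coeff p i \<in> \<phi> ` S) \<Longrightarrow> poly p y \<noteq> 0" by blast
  have "poly p x \<in> P \<longleftrightarrow> poly (map_poly \<phi> p) y = 0" if p: "poly_over S p" for p
  proof -
    have co: "coeff p i \<in> S" for i using p by (simp add: poly_over_def)
    have "poly p x \<in> P \<longleftrightarrow> (\<forall>i. coeff p i \<in> P)"
      using False p ideal_poly[of P p x] P by (auto simp: prime_ideal_def)
    also have "\<dots> \<longleftrightarrow> map_poly \<phi> p = 0"
      using ker co by (auto simp: poly_eq_iff coeff_hom[OF S hom])
    also have "\<dots> \<longleftrightarrow> poly (map_poly \<phi> p) y = 0"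
      using y[of "map_poly \<phi> p"] co by (auto simp: coeff_hom[OF S hom])
    finally show ?thesis .
  qed
  then show ?thesis by blast
qed

text \<open>Zorn's lemma, for two purposes: a countable ring, which yields the embedding of
  \<open>kG/P\<close>, and the algebraic elements over a field, which yields the embeddings
  replacing Galois automorphisms.\<close>

theorem hom_extension:
  fixes \<phi> :: "'a::comm_ring_1 \<Rightarrow> complex"
  assumes S: "is_subring S" and hom: "hom_on S \<phi>" and P: "prime_ideal P"
    and ker: "\<And>s. s \<in> S \<Longrightarrow> \<phi> s = 0 \<longleftrightarrow> s \<in> P"
    and A: "is_subring A" "S \<subseteq> A"
    and algebraic_over: "countable A \<or> (\<forall>x\<in>A. \<exists>f i. poly_over S f \<and> coeff f i \<notin> P \<and> poly f x \<in> P)"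
  shows "\<exists>\<psi>. hom_on A \<psi> \<and> (\<forall>s\<in>S. \<psi> s = \<phi> s) \<and> (\<forall>z\<in>A. \<psi> z = 0 \<longleftrightarrow> z \<in> P)"
proof -
  have I: "is_ideal P" using P by (simp add: prime_ideal_def)
  \<comment> \<open>Graphs of partial homomorphisms, so that the union of a chain is again a
    candidate. Closure under componentwise differences, with \<open>b = 0\<close> exactly for
    \<open>a \<in> P\<close>, already makes \<open>g\<close> single-valued: the pair
    \<open>(0, b - c)\<close> in \<open>g\<close> forces \<open>b = c\<close>.\<close>
  define good :: "('a \<times> complex) set \<Rightarrow> bool" where "good = (\<lambda>g. (\<lambda>s. (s, \<phi> s)) ` S \<subseteq> g \<and> fst ` g \<subseteq> A \<and>
     (\<forall>(a,b)\<in>g. b = 0 \<longleftrightarrow> a \<in> P) \<and> (\<forall>u\<in>g. \<forall>v\<in>g. (fst u - fst v, snd u - snd v) \<in> g \<and> (fst u * fst v, snd u * snd v) \<in> g))"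
  have good_graph: "good ((\<lambda>s. (s, \<psi> s)) ` T)" if "is_subring T" "hom_on T \<psi>" "S \<subseteq> T" "T \<subseteq> A"
    "\<And>s. s \<in> S \<Longrightarrow> \<psi> s = \<phi> s" "\<And>s. s \<in> T \<Longrightarrow> \<psi> s = 0 \<longleftrightarrow> s \<in> P" for T \<psi>
    unfolding good_def
  proof (intro conjI ballI)
    show "(\<lambda>s. (s, \<phi> s)) ` S \<subseteq> (\<lambda>s. (s, \<psi> s)) ` T" using that by auto
    show "fst ` (\<lambda>s. (s, \<psi> s)) ` T \<subseteq> A" using that by auto
    show "case x of (a, b) \<Rightarrow> (b = 0) = (a \<in> P)" if "x \<in> (\<lambda>s. (s, \<psi> s)) ` T" for x
      using that \<open>\<And>s. s \<in> T \<Longrightarrow> \<psi> s = 0 \<longleftrightarrow> s \<in> P\<close> by auto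
    show "(fst u - fst v, snd u - snd v) \<in> (\<lambda>s. (s, \<psi> s)) ` T" "(fst u * fst v, snd u * snd v) \<in> (\<lambda>s. (s, \<psi> s)) ` T"
      if "u \<in> (\<lambda>s. (s, \<psi> s)) ` T" "v \<in> (\<lambda>s. (s, \<psi> s)) ` T" for u v
      using that \<open>is_subring T\<close> \<open>hom_on T \<psi>\<close> by (auto simp: hom_diff hom_mult subring_diff subring_mult)
  qed
  have g0: "good ((\<lambda>s. (s, \<phi> s)) ` S)" using good_graph[OF S hom] A ker by blast
  have "\<exists>M\<in>{g. good g}. \<forall>X\<in>{g. good g}. M \<subseteq> X \<longrightarrow> X = M"
  proof (rule subset_Zorn_nonempty)
    show "{g. good g} \<noteq> {}" using g0 by blast
    fix \<C> assume C: "\<C> \<noteq> {}" "subset.chain {g. good g} \<C>"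
    then have gd: "\<And>g. g \<in> \<C> \<Longrightarrow> good g" by (auto simp: subset.chain_def)
    have ch: "\<exists>g\<in>\<C>. u \<in> g \<and> v \<in> g" if "u \<in> \<Union>\<C>" "v \<in> \<Union>\<C>" for u v
      using that C(2) unfolding subset.chain_def by blast
    show "\<Union>\<C> \<in> {g. good g}" unfolding mem_Collect_eq good_def
    proof (intro conjI ballI)
      show "(\<lambda>s. (s, \<phi> s)) ` S \<subseteq> \<Union>\<C>" using C(1) gd unfolding good_def by blast
      show "fst ` \<Union>\<C> \<subseteq> A" using gd unfolding good_def by blast
      show "case x of (a, b) \<Rightarrow> (b = 0) = (a \<in> P)" if "x \<in> \<Union>\<C>" for x
        using that gd unfolding good_def by fast
      fix u v assume "u \<in> \<Union>\<C>" "v \<in> \<Union>\<C>"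
      then obtain g where "g \<in> \<C>" "u \<in> g" "v \<in> g" using ch by blast
      then show "(fst u - fst v, snd u - snd v) \<in> \<Union>\<C>" "(fst u * fst v, snd u * snd v) \<in> \<Union>\<C>"
        using gd unfolding good_def by blast+
    qed
  qed
  then obtain M where M: "good M" "\<And>X. good X \<Longrightarrow> M \<subseteq> X \<Longrightarrow> X = M" by auto
  define T where "T = fst ` M"
  have closed: "(a - c, b - d) \<in> M" "(a * c, b * d) \<in> M" if "(a, b) \<in> M" "(c, d) \<in> M" for a b c d
  proof -
    have *: "\<forall>u\<in>M. \<forall>v\<in>M. (fst u - fst v, snd u - snd v) \<in> M \<and> (fst u * fst v, snd u * snd v) \<in> M"
      using M(1) unfolding good_def by simp
    show "(a - c, b - d) \<in> M" "(a * c, b * d) \<in> M" using *[rule_format, OF that] by simp_all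
  qed
  have kerM: "b = 0 \<longleftrightarrow> a \<in> P" if "(a, b) \<in> M" for a b using M(1) that unfolding good_def by blast
  have uniq: "b = c" if "(a, b) \<in> M" "(a, c) \<in> M" for a b c
    using closed(1)[OF that] kerM[of 0 "b - c"] ideal_0[OF I] by simp
  define \<psi> where "\<psi> = (\<lambda>a. THE b. (a, b) \<in> M)"
  have \<psi>eq: "\<psi> a = b" if "(a, b) \<in> M" for a b unfolding \<psi>_def using that uniq by blast
  have \<psi>M: "(a, \<psi> a) \<in> M" if "a \<in> T" for a using that \<psi>eq unfolding T_def by force
  have SM: "(s, \<phi> s) \<in> M" if "s \<in> S" for s using M(1) that unfolding good_def by blast
  have ST: "S \<subseteq> T" using SM unfolding T_def by force
  have TA: "T \<subseteq> A" using M(1) unfolding good_def T_def by blast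
  have MT: "M = (\<lambda>s. (s, \<psi> s)) ` T" using \<psi>eq unfolding T_def by force
  have T: "is_subring T" unfolding is_subring_def
  proof (intro conjI ballI)
    show "1 \<in> T" using ST subring_1[OF S] by blast
    fix x y assume "x \<in> T" "y \<in> T"
    then have "(x, \<psi> x) \<in> M" "(y, \<psi> y) \<in> M" using \<psi>M by auto
    from closed[OF this] show "x - y \<in> T" "x * y \<in> T" unfolding T_def by force+
  qed
  have homT: "hom_on T \<psi>" unfolding hom_on_def
  proof (intro conjI ballI)
    show "\<psi> 1 = 1" using \<psi>eq[OF SM[OF subring_1[OF S]]] hom_1[OF S hom] by simp
    fix x y assume "x \<in> T" "y \<in> T"
    then have "(x, \<psi> x) \<in> M" "(y, \<psi> y) \<in> M" using \<psi>M by auto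
    from closed[OF this] show "\<psi> (x - y) = \<psi> x - \<psi> y" "\<psi> (x * y) = \<psi> x * \<psi> y" using \<psi>eq by blast+
  qed
  have \<psi>S: "\<psi> s = \<phi> s" if "s \<in> S" for s using \<psi>eq[OF SM[OF that]] .
  have kerT: "\<psi> s = 0 \<longleftrightarrow> s \<in> P" if "s \<in> T" for s using kerM \<psi>M[OF that] by blast
  have "A \<subseteq> T"
  proof
    fix x assume x: "x \<in> A"
    have "countable T \<or> (\<exists>f i. poly_over T f \<and> coeff f i \<notin> P \<and> poly f x \<in> P)"
    proof (cases "countable A")
      case True
      then show ?thesis using countable_subset[OF TA] by simp
    next
      case False
      then obtain f i where "poly_over S f" "coeff f i \<notin> P" "poly f x \<in> P" using algebraic_over x by metis
      then show ?thesis using poly_over_mono[OF ST] by metis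
    qed
    from hom_extension_point[OF T homT P kerT this] obtain y where
      y: "\<And>p. poly_over T p \<Longrightarrow> poly p x \<in> P \<longleftrightarrow> poly (map_poly \<psi> p) y = 0" by blast
    from hom_adjoin[OF T homT I y] obtain \<theta> where \<theta>: "hom_on {poly p x | p. poly_over T p} \<theta>"
      "\<forall>s\<in>T. \<theta> s = \<psi> s" "\<forall>z\<in>{poly p x | p. poly_over T p}. \<theta> z = 0 \<longleftrightarrow> z \<in> P" by blast
    let ?T = "{poly p x | p. poly_over T p}"
    have TT: "T \<subseteq> ?T" by (rule adjoin_superset[OF T])
    have "?T \<subseteq> A" using poly_over_poly[OF A(1) poly_over_mono[OF TA] x] by auto
    then have "good ((\<lambda>s. (s, \<theta> s)) ` ?T)"
      using \<theta> ST TT \<psi>S by (intro good_graph subring_adjoin[OF T]) auto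
    moreover have "M \<subseteq> (\<lambda>s. (s, \<theta> s)) ` ?T" 
    proof
      fix u assume "u \<in> M"
      then obtain s where s: "s \<in> T" "u = (s, \<psi> s)" unfolding MT by blast
      then have "u = (s, \<theta> s)" "s \<in> ?T" using \<theta>(2) TT by (simp, blast)
      then show "u \<in> (\<lambda>s. (s, \<theta> s)) ` ?T" by (rule image_eqI)
    qed
    ultimately have MT': "(\<lambda>s. (s, \<theta> s)) ` ?T = M" by (rule M(2))
    have "fst ` (\<lambda>s. (s, \<theta> s)) ` X = X" for X by (simp add: image_image)
    from this[of ?T] have "fst ` M = ?T" unfolding MT' .
    then show "x \<in> T" unfolding T_def[symmetric] using adjoin_self[OF T, of x] by (rule ssubst)
  qed
  then show ?thesis using homT \<psi>S kerT TA by (intro exI[of _ \<psi>]) auto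
qed

section \<open>Embeddings of algebraic elements over a base field\<close>

lemma prime_ideal_zero: "prime_ideal {0 :: 'a::idom}"
proof -
  have "{0 :: 'a} \<noteq> UNIV" using one_neq_zero by blast
  then show ?thesis by (simp add: prime_ideal_def is_ideal_def)
qed

lemma map_poly_id_on: "map_poly (\<lambda>x. x) p = p"
  by (rule poly_eqI) (simp add: coeff_map_poly)

text \<open>The counterpart of an element of the absolute Galois group of \<open>E\<close>: an
  \<open>E\<close>-homomorphism on the numbers algebraic over \<open>E\<close>, with arbitrary
  values elsewhere.\<close>

definition embedding :: "complex set \<Rightarrow> (complex \<Rightarrow> complex) \<Rightarrow> bool" where
  "embedding E \<sigma> \<longleftrightarrow> hom_on {z. algebraic_over E z} \<sigma> \<and> (\<forall>x\<in>E. \<sigma> x = x)"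

lemma embedding_conjugate:
  assumes E: "is_subfield E" and x: "algebraic_over E x"
    and xy: "\<And>p. poly_over E p \<Longrightarrow> poly p x = 0 \<longleftrightarrow> poly p y = 0"
  shows "\<exists>\<sigma>. embedding E \<sigma> \<and> \<sigma> x = y"
proof -
  note S = subfield_subring[OF E]
  have id: "hom_on E (\<lambda>x. x)" by (simp add: hom_on_def)
  have "is_ideal {0::complex}" by (simp add: is_ideal_def)
  from hom_adjoin[OF S id this, of x y] obtain \<phi> where \<phi>: "hom_on {poly p x | p. poly_over E p} \<phi>"
    "\<forall>s\<in>E. \<phi> s = s" "\<phi> x = y" "\<forall>z\<in>{poly p x | p. poly_over E p}. \<phi> z = 0 \<longleftrightarrow> z \<in> {0}" 
    using xy by (auto simp: map_poly_id_on)
  let ?T = "{poly p x | p. poly_over E p}"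
  have "?T \<subseteq> {z. algebraic_over E z}"
  proof
    fix z assume "z \<in> ?T"
    then obtain p where p: "poly_over E p" "z = poly p x" by auto
    have "poly_over {z. algebraic_over E z} p" using p algebraic_over_self[OF E] by (auto simp: poly_over_def)
    then show "z \<in> {z. algebraic_over E z}" using poly_over_poly[OF subfield_subring[OF subfield_alg[OF E]]] x p by auto
  qed
  moreover have "\<exists>f i. poly_over ?T f \<and> coeff f i \<notin> {0} \<and> poly f z \<in> {0}" if "algebraic_over E z" for z
  proof -
    obtain p where "p \<noteq> 0" "poly_over E p" "poly p z = 0" using \<open>algebraic_over E z\<close> by (auto simp: algebraic_over_altdef)
    then show ?thesis using poly_over_mono[OF adjoin_superset[OF S]]
      by (intro exI[of _ p] exI[of _ "degree p"]) simp
  qed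
  ultimately have "\<exists>\<psi>. hom_on {z. algebraic_over E z} \<psi> \<and> (\<forall>s\<in>?T. \<psi> s = \<phi> s) \<and>
      (\<forall>z\<in>{z. algebraic_over E z}. \<psi> z = 0 \<longleftrightarrow> z \<in> {0})"
    using \<phi>(4) by (intro hom_extension[OF subring_adjoin[OF S] \<phi>(1) prime_ideal_zero _
      subfield_subring[OF subfield_alg[OF E]]]) auto
  then obtain \<psi> where "hom_on {z. algebraic_over E z} \<psi>" "\<forall>s\<in>?T. \<psi> s = \<phi> s" by (elim exE conjE)
  have "E \<subseteq> ?T" "x \<in> ?T" using adjoin_superset[OF S] adjoin_self[OF S] by auto
  have "\<psi> z = z" if "z \<in> E" for z
    using bspec[OF \<phi>(2) that] bspec[OF \<open>\<forall>s\<in>?T. \<psi> s = \<phi> s\<close> subsetD[OF \<open>E \<subseteq> ?T\<close> that]] by simp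
  moreover have "\<psi> x = y" using \<phi>(3) \<open>x \<in> ?T\<close> \<open>\<forall>s\<in>?T. \<psi> s = \<phi> s\<close> by simp
  ultimately have "\<forall>z\<in>E. \<psi> z = z" "\<psi> x = y" by auto
  then show ?thesis using \<open>hom_on {z. algebraic_over E z} \<psi>\<close> by (auto simp: embedding_def)
qed

text \<open>The minimal polynomial \<open>m'\<close> of \<open>y\<close> divides \<open>m\<close>.
  If \<open>x\<close> were not a root of \<open>m'\<close>, it would be a root of the cofactor,
  which \<open>m\<close> would then divide, against the degrees. Hence \<open>x\<close> and
  \<open>y\<close> satisfy the same relations over \<open>E\<close>.\<close>

lemma minimal_poly_root_conjugate:
  assumes E: "is_subfield E" and m: "poly_over E m" "m \<noteq> 0" "poly m x = 0"
    "\<And>p. poly_over E p \<Longrightarrow> poly p x = 0 \<Longrightarrow> \<exists>q. poly_over E q \<and> p = q * m"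
    and y: "poly m (y::complex) = 0"
  shows "\<exists>\<sigma>. embedding E \<sigma> \<and> \<sigma> x = y"
proof (rule embedding_conjugate[OF E])
  show "algebraic_over E x" using m by (auto simp: algebraic_over_altdef)
  fix p assume p: "poly_over E p"
  show "poly p x = 0 \<longleftrightarrow> poly p y = 0"
  proof
    assume "poly p x = 0"
    then show "poly p y = 0" using m(4)[OF p] y by auto
  next
    assume py: "poly p y = 0"
    have "algebraic_over E y" using m y by (auto simp: algebraic_over_altdef)
    then obtain m' where m': "lead_coeff m' = 1" "poly_over E m'" "poly m' y = 0" "degree m' \<ge> 1"
      "\<And>p. poly_over E p \<Longrightarrow> poly p y = 0 \<Longrightarrow> \<exists>q. poly_over E q \<and> p = q * m'"
      by (rule minimal_poly[OF E]) blast
    obtain q where q: "poly_over E q" "m = q * m'" using m'(5) m(1) y by blast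
    have "poly m' x = 0"
    proof (rule ccontr)
      assume "poly m' x \<noteq> 0"
      then have "poly q x = 0" using q m by simp
      then obtain q' where "q = q' * m" using m(4)[OF q(1)] by blast
      then have "q = (q' * q) * m'" using q by simp
      moreover have "q \<noteq> 0" using q m by auto
      ultimately have "degree q = degree (q' * m') + degree q" and "q' \<noteq> 0"
        by (metis degree_mult_eq mult_eq_0_iff mult.assoc mult.commute)+
      moreover have "m' \<noteq> 0" using m' by auto
      ultimately show False using m'(4) by (simp add: degree_mult_eq)
    qed
    then show "poly p x = 0" using m'(5)[OF p py] by auto
  qed
qed

text \<open>Separability in characteristic zero: the derivative of the minimal polynomial is
  non-zero of smaller degree and cannot vanish at \<open>x\<close>. So the cofactor of
  \<open>[:- x, 1:]\<close> has a root different from \<open>x\<close>, to which \<open>x\<close>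
  can be sent.\<close>

lemma embedding_moves:
  assumes E: "is_subfield E" and x: "algebraic_over E x" "x \<notin> E"
  shows "\<exists>\<sigma>. embedding E \<sigma> \<and> \<sigma> x \<noteq> x"
proof -
  note S = subfield_subring[OF E]
  obtain m where m: "lead_coeff m = 1" "poly_over E m" "poly m x = 0" "degree m \<ge> 1"
      "\<And>p. poly_over E p \<Longrightarrow> poly p x = 0 \<Longrightarrow> \<exists>q. poly_over E q \<and> p = q * m"
    by (rule minimal_poly[OF E x(1)]) blast
  obtain f where f: "m = [:- x, 1:] * f" using m(3) by (metis poly_eq_0_iff_dvd dvdE)
  have "m \<noteq> 0" "f \<noteq> 0" using m f by auto
  have df: "degree m = Suc (degree f)" using \<open>f \<noteq> 0\<close> unfolding f by (subst degree_mult_eq) auto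
  have "degree f \<noteq> 0"
  proof
    assume "degree f = 0"
    then obtain c where "f = [:c:]" by (rule degree_eq_zeroE)
    with f m(1) df have "c = 1" by simp
    then have "coeff m 0 = - x" using f \<open>f = [:c:]\<close> by simp
    then have "- x \<in> E" using m(2) unfolding poly_over_def by metis
    then have "x \<in> E" using subring_uminus[OF S] by fastforce
    then show False using x by simp
  qed
  then obtain y where y: "poly f y = 0" using fundamental_theorem_of_algebra[of f] by (auto simp: constant_degree)
  have "y \<noteq> x"
  proof
    assume "y = x"
    have "poly (pderiv m) x = poly f x" unfolding f by (subst pderiv_mult) (simp add: pderiv_pCons)
    then have "poly (pderiv m) x = 0" using y \<open>y = x\<close> by simp
    then obtain q where q: "pderiv m = q * m" using m(5) poly_over_pderiv[OF S m(2)] by blast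
    have d: "degree (pderiv m) = degree m - 1" by (rule degree_pderiv)
    then have "pderiv m \<noteq> 0" using m(4) by (auto simp: pderiv_eq_0_iff)
    then have "q \<noteq> 0" using q by auto
    then have "degree (pderiv m) = degree q + degree m" using q \<open>m \<noteq> 0\<close> by (simp add: degree_mult_eq)
    then show False using d m(4) by linarith
  qed
  moreover have "poly m y = 0" using f y by simp
  ultimately show ?thesis using minimal_poly_root_conjugate[OF E m(2) \<open>m \<noteq> 0\<close> m(3,5)] by blast
qed

lemma embedding_subring: "is_subfield E \<Longrightarrow> is_subring {z. algebraic_over E z}"
  by (simp add: subfield_alg subfield_subring)

lemma embedding_alg:
  assumes E: "is_subfield E" and \<sigma>: "embedding E \<sigma>" and p: "poly_over E p" "poly p x = 0" "algebraic_over E x"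
  shows "poly p (\<sigma> x) = 0"
proof -
  have h: "hom_on {z. algebraic_over E z} \<sigma>" using \<sigma> by (simp add: embedding_def)
  note A = embedding_subring[OF E]
  have "poly_over {z. algebraic_over E z} p" using p algebraic_over_self[OF E] by (auto simp: poly_over_def)
  from hom_poly[OF A h this] have "\<sigma> (poly p x) = poly (map_poly \<sigma> p) (\<sigma> x)" using p by blast
  moreover have "map_poly \<sigma> p = p"
    by (rule poly_eqI) (use \<sigma> p in \<open>simp add: coeff_hom[OF A h] embedding_def poly_over_def\<close>)
  ultimately show ?thesis using p hom_0[OF A h] by simp
qed

lemma embedding_into_alg:
  assumes E: "is_subfield E" and \<sigma>: "embedding E \<sigma>" and x: "algebraic_over E x"
  shows "algebraic_over E (\<sigma> x)"
  using embedding_alg[OF E \<sigma> _ _ x] x unfolding algebraic_over_altdef by blast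

section \<open>Valuation rings and bounded radicals\<close>

definition valring :: "'a::field set \<Rightarrow> bool" where
  "valring V \<longleftrightarrow> is_subring V \<and> (\<forall>z. z \<noteq> 0 \<longrightarrow> z \<in> V \<or> inverse z \<in> V)"

lemma sum_power_shift:
  fixes s :: "'a::field"
  assumes "s \<noteq> 0" "degree p \<le> n"
  shows "poly p (inverse s) * s ^ n = (\<Sum>i\<le>n. coeff p i * s ^ (n - i))"
proof -
  have "poly p (inverse s) = (\<Sum>i\<le>n. coeff p i * inverse s ^ i)"
    unfolding poly_altdef by (rule sum.mono_neutral_left) (use assms in \<open>auto simp: coeff_eq_0\<close>)
  also have "\<dots> * s ^ n = (\<Sum>i\<le>n. coeff p i * s ^ (n - i))" unfolding sum_distrib_right
  proof (intro sum.cong refl)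
    fix i assume "i \<in> {..n}"
    then have "s ^ n = s ^ i * s ^ (n - i)" by (simp add: power_add[symmetric])
    then show "coeff p i * inverse s ^ i * s ^ n = coeff p i * s ^ (n - i)"
      using assms(1) by (simp add: power_inverse field_simps)
  qed
  finally show ?thesis .
qed

text \<open>A maximal subring \<open>A\<close> in which \<open>u\<close> is not invertible is a
  valuation ring. If \<open>z\<close> and \<open>inverse z\<close> were both outside, adjoining
  either would make \<open>u\<close> invertible; this gives two relations, and of two such relations
  of least degree the longer one can be shortened by the other.\<close>

lemma chevalley:
  fixes A0 :: "'a::field set"
  assumes A0: "is_subring A0" and u: "u \<in> A0" "\<And>a. a \<in> A0 \<Longrightarrow> u * a \<noteq> 1"
  shows "\<exists>V. valring V \<and> A0 \<subseteq> V \<and> (\<forall>a\<in>V. u * a \<noteq> 1)"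
proof -
  define good where "good = (\<lambda>A. is_subring A \<and> A0 \<subseteq> A \<and> (\<forall>a\<in>A. u * a \<noteq> 1))"
  have "\<exists>M\<in>{A. good A}. \<forall>X\<in>{A. good A}. M \<subseteq> X \<longrightarrow> X = M"
  proof (rule subset_Zorn_nonempty)
    show "{A. good A} \<noteq> {}" using assms by (auto simp: good_def)
    fix \<C> assume C: "\<C> \<noteq> {}" "subset.chain {A. good A} \<C>"
    then have gd: "\<And>A. A \<in> \<C> \<Longrightarrow> good A" by (auto simp: subset.chain_def)
    have ch: "\<exists>A\<in>\<C>. x \<in> A \<and> y \<in> A" if "x \<in> \<Union>\<C>" "y \<in> \<Union>\<C>" for x y
      using that C(2) unfolding subset.chain_def by blast
    have sub: "A0 \<subseteq> \<Union>\<C>" using C(1) gd unfolding good_def by blast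
    have "is_subring (\<Union>\<C>)" unfolding is_subring_def
    proof (intro conjI ballI)
      show "1 \<in> \<Union>\<C>" using sub subring_1[OF A0] by blast
      fix x y assume "x \<in> \<Union>\<C>" "y \<in> \<Union>\<C>"
      then obtain A where A: "A \<in> \<C>" "x \<in> A" "y \<in> A" using ch by blast
      then have "is_subring A" using gd by (simp add: good_def)
      then have "x - y \<in> A" "x * y \<in> A" using A subring_diff subring_mult by auto
      then show "x - y \<in> \<Union>\<C>" "x * y \<in> \<Union>\<C>" using A by auto
    qed
    then show "\<Union>\<C> \<in> {A. good A}" using sub gd by (auto simp: good_def)
  qed
  then obtain A where A: "good A" and max: "\<And>X. good X \<Longrightarrow> A \<subseteq> X \<Longrightarrow> X = A" by auto
  then have S: "is_subring A" and uA: "u \<in> A" and nu: "\<And>a. a \<in> A \<Longrightarrow> u * a \<noteq> 1"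
    and A0A: "A0 \<subseteq> A" using u by (auto simp: good_def)
  have maxE: "\<exists>p. poly_over A p \<and> u * poly p x = 1" if "x \<notin> A" for x
  proof (rule ccontr)
    assume "\<not> ?thesis"
    then have "good {poly p x | p. poly_over A p}"
      using subring_adjoin[OF S] adjoin_superset[OF S, of x] A0A by (auto simp: good_def)
    from max[OF this adjoin_superset[OF S]] adjoin_self[OF S, of x] that show False by simp
  qed
  \<comment> \<open>Otherwise \<open>u * poly p (inverse s) = 1\<close> with
    \<open>s = 1 - u * a\<close>. Multiplied by \<open>s ^ n\<close>, this makes
    \<open>s ^ n\<close> a multiple of \<open>u\<close> in \<open>A\<close>; but it is also 1 minus
    such a multiple, so \<open>u\<close> would be invertible.\<close>
  have unit: "inverse (1 - u * a) \<in> A" if a: "a \<in> A" for a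
  proof (rule ccontr)
    define s where "s = 1 - u * a"
    assume "inverse (1 - u * a) \<notin> A"
    from maxE[OF this] obtain p where p: "poly_over A p" "u * poly p (inverse s) = 1" by (auto simp: s_def)
    have s0: "s \<noteq> 0" using nu[OF a] by (simp add: s_def)
    have sA: "s \<in> A" unfolding s_def by (intro subring_diff[OF S] subring_mult[OF S] subring_1[OF S] a uA)
    define n where "n = degree p"
    define b where "b = poly p (inverse s) * s ^ n"
    have b: "b \<in> A" unfolding b_def using sum_power_shift[OF s0, of p n] p
      by (auto simp: n_def poly_over_def intro!: subring_sum[OF S] subring_mult[OF S] subring_power[OF S] sA)
    have "\<exists>e\<in>A. s ^ k = 1 - u * e" for k
    proof (induction k)
      case 0 then show ?case by (intro bexI[of _ 0]) (auto simp: subring_0[OF S])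
    next
      case (Suc k)
      then obtain e where "e \<in> A" "s ^ k = 1 - u * e" by blast
      then have "s ^ Suc k = 1 - u * (e + a - u * a * e)" 
        by (simp only: power_Suc s_def[symmetric]) (simp add: s_def algebra_simps)
      moreover have "e + a - u * a * e \<in> A" using \<open>e \<in> A\<close> a uA
        by (intro subring_diff[OF S] subring_add[OF S] subring_mult[OF S])
      ultimately show ?case by blast
    qed
    then obtain e where e: "e \<in> A" "s ^ n = 1 - u * e" by blast
    have "u * b = s ^ n" using p by (simp add: b_def mult.assoc[symmetric])
    then have "u * (b + e) = 1" using e by (simp add: algebra_simps)
    then show False using nu subring_add[OF S b e(1)] by blast
  qed
  have core: False if w: "w \<noteq> 0" and p: "poly_over A p" "u * poly p w = 1"
    and pmin: "\<And>p'. poly_over A p' \<Longrightarrow> u * poly p' w = 1 \<Longrightarrow> degree p \<le> degree p'"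
    and q: "poly_over A q" "u * poly q (inverse w) = 1" "degree q \<le> degree p" for w p q
  proof -
    obtain c q' where cq: "q = pCons c q'" by (rule pCons_cases)
    have cA: "c \<in> A" "poly_over A q'" using q cq by (auto simp: S)
    define t where "t = inverse (1 - u * c)"
    have tA: "t \<in> A" using unit[OF cA(1)] by (simp add: t_def)
    have t: "t * (1 - u * c) = 1" using nu[OF cA(1)] by (simp add: t_def)
    have q'0: "q' \<noteq> 0" using q(2) nu[OF cA(1)] cq by auto
    define n where "n = degree p"
    have dq': "degree q' \<le> n - 1" "n \<ge> 1" using q(3) cq q'0 by (auto simp: n_def)
    \<comment> \<open>The relation for \<open>inverse w\<close>, multiplied by \<open>w ^ n\<close>
      and divided by the unit \<open>1 - u * c\<close>, expresses \<open>w ^ n\<close> as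
      \<open>u * poly r w\<close> with \<open>degree r < n\<close>. Replacing the leading term of
      \<open>p\<close> accordingly gives the shorter relation \<open>p'\<close>.\<close>
    define r where "r = (\<Sum>i\<le>n-1. monom (t * coeff q' i) (n - 1 - i))"
    have rA: "poly_over A r" unfolding r_def
      using cA tA by (intro poly_over_sum[OF S] poly_over_monom[OF S] subring_mult[OF S]) (auto simp: poly_over_def)
    have dr: "degree r \<le> n - 1" unfolding r_def
      by (intro degree_sum_le) (auto intro: order_trans[OF degree_monom_le])
    have "poly r w = t * (\<Sum>i\<le>n-1. coeff q' i * w ^ (n - 1 - i))"
      by (simp add: r_def poly_sum poly_monom sum_distrib_left mult.assoc)
    also have "(\<Sum>i\<le>n-1. coeff q' i * w ^ (n - 1 - i)) = poly q' (inverse w) * w ^ (n - 1)"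
      using sum_power_shift[OF w dq'(1)] by simp
    finally have rw: "poly r w = t * (poly q' (inverse w) * w ^ (n - 1))" .
    have wn: "w ^ n = w * w ^ (n - 1)" using dq'(2) by (cases n) auto
    have "1 - u * c = u * (inverse w * poly q' (inverse w))" using q(2) cq by (simp add: algebra_simps)
    then have "w * (1 - u * c) = u * poly q' (inverse w)" using w by (simp add: field_simps)
    then have "u * poly r w = t * (w * (1 - u * c)) * w ^ (n - 1)" by (simp add: rw mult_ac)
    also have "\<dots> = w ^ n" using t wn by (metis mult.assoc mult.commute mult_1)
    finally have ur: "u * poly r w = w ^ n" .
    define p' where "p' = p - monom (lead_coeff p) n + smult (lead_coeff p * u) r"
    have "poly p' w = poly p w - lead_coeff p * w ^ n + lead_coeff p * (u * poly r w)"
      by (simp add: p'_def poly_monom mult_ac)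
    then have "u * poly p' w = 1" using ur p by simp
    moreover have "lead_coeff p \<in> A" using p by (auto simp: poly_over_def)
    then have "poly_over A p'" unfolding p'_def
      by (intro poly_over_add[OF S] poly_over_diff[OF S] poly_over_smult[OF S] poly_over_monom[OF S] subring_mult[OF S] p rA uA)
    moreover have "degree p' < degree p"
    proof -
      have "degree p' \<le> n" unfolding p'_def
        by (intro degree_add_le degree_diff_le order_trans[OF degree_smult_le] degree_monom_le)
          (use dr in \<open>auto simp: n_def\<close>)
      moreover have "coeff r n = 0" using dr dq' by (intro coeff_eq_0) auto
      then have "coeff p' n = 0" by (simp add: p'_def n_def)
      ultimately show ?thesis using dq'(2) n_def
        by (metis degree_0 leading_coeff_0_iff less_le_not_le not_one_le_zero order_le_imp_less_or_eq bot_nat_0.not_eq_extremum)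
    qed
    ultimately show False using pmin by fastforce
  qed
  have "z \<in> A \<or> inverse z \<in> A" if z: "z \<noteq> 0" for z
  proof (rule ccontr)
    define Q where "Q = (\<lambda>w p. poly_over A p \<and> u * poly p w = 1)"
    assume "\<not> ?thesis"
    then have "\<exists>p. Q z p" "\<exists>p. Q (inverse z) p" using maxE by (auto simp: Q_def)
    then obtain p q where p: "Q z p" "\<And>p'. Q z p' \<Longrightarrow> degree p \<le> degree p'"
      and q: "Q (inverse z) q" "\<And>q'. Q (inverse z) q' \<Longrightarrow> degree q \<le> degree q'"
      using ex_has_least_nat[of "Q z" _ degree] ex_has_least_nat[of "Q (inverse z)" _ degree] by metis
    consider "degree q \<le> degree p" | "degree p \<le> degree q" by linarith
    then show False
    proof cases
      case 1
      show False by (rule core[of z p q]) (use z p q 1 in \<open>auto simp: Q_def\<close>)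
    next
      case 2
      show False by (rule core[of "inverse z" q p]) (use z p q 2 in \<open>auto simp: Q_def\<close>)
    qed
  qed
  then show ?thesis using S A0A nu by (intro exI[of _ A]) (auto simp: valring_def)
qed

text \<open>If \<open>z\<close> is outside \<open>V\<close>, then \<open>inverse z\<close> is
  inside, and dividing the relation by \<open>z ^ (n - 1)\<close> expresses the product through
  non-negative powers of \<open>inverse z\<close>.\<close>

lemma valring_lead_coeff:
  assumes V: "valring V" and p: "poly_over V p" "poly p z = 0" "degree p \<ge> 1"
  shows "lead_coeff p * z \<in> V"
proof (cases "z \<in> V")
  case True
  then show ?thesis using p V by (auto simp: valring_def poly_over_def intro: subring_mult)
next
  case False
  have S: "is_subring V" using V by (simp add: valring_def)
  have z: "z \<noteq> 0" using False subring_0[OF S] by auto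
  then have iz: "inverse z \<in> V" using V False by (auto simp: valring_def)
  define n where "n = degree p"
  have n: "n = Suc (n - 1)" using p by (simp add: n_def)
  have "0 = (\<Sum>i\<le>n. coeff p i * z ^ i)" using p by (simp add: poly_altdef n_def)
  also have "\<dots> = (\<Sum>i\<le>n-1. coeff p i * z ^ i) + lead_coeff p * z ^ n"
    unfolding n_def using p(3) by (cases "degree p") auto
  finally have "lead_coeff p * z ^ n = - (\<Sum>i\<le>n-1. coeff p i * z ^ i)" by (simp add: eq_neg_iff_add_eq_0 add.commute)
  moreover have "lead_coeff p * z = (lead_coeff p * z ^ n) * inverse z ^ (n - 1)"
  proof -
    have "z ^ n = z * z ^ (n - 1)" using n by (metis power_Suc)
    then show ?thesis using z by (simp add: field_simps)
  qed
  ultimately have "lead_coeff p * z = - (\<Sum>i\<le>n-1. coeff p i * (z ^ i * inverse z ^ (n - 1)))"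
    by (simp add: sum_distrib_right mult.assoc)
  also have "\<dots> = - (\<Sum>i\<le>n-1. coeff p i * inverse z ^ (n - 1 - i))"
  proof -
    have "z ^ i * inverse z ^ (n - 1) = inverse z ^ (n - 1 - i)" if "i \<le> n - 1" for i
    proof -
      have "z ^ (n - 1) = z ^ i * z ^ (n - 1 - i)" 
        unfolding power_add[symmetric] le_add_diff_inverse[OF that] ..
      then show ?thesis using z by (simp add: power_inverse field_simps del: power_Suc)
    qed
    then show ?thesis by (auto intro!: sum.cong)
  qed
  also have "\<dots> \<in> V" using p iz
    by (intro subring_uminus[OF S] subring_sum[OF S] subring_mult[OF S] subring_power[OF S]) (auto simp: poly_over_def)
  finally show ?thesis .
qed

section \<open>Algebraic integers and denominators\<close>

lemma Ints_subring: "is_subring S \<Longrightarrow> \<int> \<subseteq> S"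
  unfolding Ints_def using subring_of_int by auto

text \<open>The integral closure of the integers is the intersection of all valuation rings. If
  \<open>z\<close> is not integral, \<open>inverse z\<close> is not invertible in the ring it
  generates, and \<open>chevalley\<close> yields a valuation ring without \<open>z\<close>. With
  this criterion, closure under ring operations and under taking roots is immediate.\<close>

lemma algebraic_int_iff_valring:
  fixes z :: "'a::field_char_0"
  shows "algebraic_int z \<longleftrightarrow> (\<forall>V. valring V \<longrightarrow> z \<in> V)"
proof
  assume "algebraic_int z"
  then obtain p where p: "lead_coeff p = 1" "\<forall>i. coeff p i \<in> \<int>" "poly p z = 0" by (auto elim: algebraic_int.cases)
  have "degree p \<ge> 1"
  proof (rule ccontr)
    assume "\<not> ?thesis"
    then obtain c where "p = [:c:]" by (metis degree_eq_zeroE not_one_le_zero less_one linorder_not_less)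
    then show False using p by simp
  qed
  show "\<forall>V. valring V \<longrightarrow> z \<in> V"
  proof (intro allI impI)
    fix V :: "'a set" assume V: "valring V"
    then have "poly_over V p" using p Ints_subring by (fastforce simp: poly_over_def valring_def)
    from valring_lead_coeff[OF V this p(3) \<open>degree p \<ge> 1\<close>] p show "z \<in> V" by simp
  qed
next
  assume all: "\<forall>V. valring V \<longrightarrow> z \<in> V"
  show "algebraic_int z"
  proof (rule ccontr)
    assume not: "\<not> algebraic_int z"
    then have z: "z \<noteq> 0" by auto
    have SZ: "is_subring (\<int> :: 'a set)" by (simp add: is_subring_def)
    let ?A = "{poly p (inverse z) | p. poly_over \<int> p}"
    have "inverse z * a \<noteq> 1" if "a \<in> ?A" for a
    proof
      assume a1: "inverse z * a = 1"
      from that obtain p where p: "poly_over \<int> p" "a = poly p (inverse z)" by auto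
      define n where "n = degree p"
      \<comment> \<open>The relation \<open>inverse z * poly p (inverse z) = 1\<close>, multiplied
        by \<open>z ^ Suc n\<close>, becomes a monic equation for \<open>z\<close>.\<close>
      define q where "q = monom 1 (Suc n) - (\<Sum>i\<le>n. monom (coeff p i) (n - i))"
      have d: "degree (\<Sum>i\<le>n. monom (coeff p i) (n - i)) \<le> n"
        by (intro degree_sum_le) (auto intro: order_trans[OF degree_monom_le])
      then have "degree (\<Sum>i\<le>n. monom (coeff p i) (n - i)) < degree (monom (1::'a) (Suc n))"
        by (simp add: degree_monom_eq)
      then have "lead_coeff q = 1" unfolding q_def
        using lead_coeff_add_le[of "- (\<Sum>i\<le>n. monom (coeff p i) (n - i))" "monom (1::'a) (Suc n)"]
        by (simp add: degree_monom_eq)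
      moreover have "\<forall>i. coeff q i \<in> \<int>"
      proof -
        have "poly_over \<int> q" unfolding q_def using p
          by (intro poly_over_diff[OF SZ] poly_over_sum[OF SZ] poly_over_monom[OF SZ]) (auto simp: poly_over_def)
        then show ?thesis by (simp add: poly_over_def)
      qed
      moreover have "poly q z = 0"
      proof -
        have "a * z ^ n = z ^ Suc n" using a1 z by (simp add: field_simps)
        moreover have "a * z ^ n = (\<Sum>i\<le>n. coeff p i * z ^ (n - i))"
          unfolding p(2) using z by (rule sum_power_shift) (simp add: n_def)
        ultimately have "z ^ Suc n = (\<Sum>i\<le>n. coeff p i * z ^ (n - i))" by (simp only:)
        then show ?thesis by (simp add: q_def poly_sum poly_monom)
      qed
      ultimately show False using not by (auto simp: algebraic_int.simps)
    qed
    then obtain V where V: "valring V" "?A \<subseteq> V" "\<forall>a\<in>V. inverse z * a \<noteq> 1"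
      using chevalley[OF subring_adjoin[OF SZ] adjoin_self[OF SZ], of "inverse z"] by blast
    have "z \<in> V" using all V by blast
    then show False using V(3) z by fastforce
  qed
qed

lemma valring_subring: "valring V \<Longrightarrow> is_subring V"
  by (simp add: valring_def)

lemma subring_algebraic_int: "is_subring {z :: 'a::field_char_0. algebraic_int z}"
  unfolding is_subring_def mem_Collect_eq algebraic_int_iff_valring
  by (auto intro: subring_1 subring_diff subring_mult valring_subring)

lemma valring_power_cancel:
  assumes V: "valring V" and "n \<ge> 1" "z ^ n \<in> V"
  shows "z \<in> V"
proof (rule ccontr)
  assume z: "z \<notin> V"
  note S = valring_subring[OF V]
  have "z \<noteq> 0" using z subring_0[OF S] by auto
  then have "inverse z \<in> V" using V z by (auto simp: valring_def)
  then have "z ^ n * inverse z ^ (n - 1) \<in> V" by (intro subring_mult[OF S assms(3)] subring_power[OF S])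
  moreover have "z ^ n * inverse z ^ (n - 1) = z" using \<open>z \<noteq> 0\<close> \<open>n \<ge> 1\<close> by (cases n) (auto simp: field_simps)
  ultimately show False using z by simp
qed

lemma algebraic_int_power_cancel: "n \<ge> 1 \<Longrightarrow> algebraic_int (z ^ n) \<Longrightarrow> algebraic_int (z :: 'a::field_char_0)"
  unfolding algebraic_int_iff_valring using valring_power_cancel by blast

lemma gen_field_empty: "gen_field ({} :: 'a::field_char_0 set) = \<rat>"
proof
  show "gen_field {} \<subseteq> (\<rat> :: 'a set)" by (rule gen_field_least) (auto simp: is_subfield_def)
  show "\<rat> \<subseteq> gen_field ({} :: 'a set)"
  proof
    fix x :: 'a assume "x \<in> \<rat>"
    then obtain a b where "x = of_int a / of_int b" by (auto elim: Rats_cases')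
    then show "x \<in> gen_field {}" 
      by (auto intro!: subfield_divide[OF subfield_fld] subring_of_int subfield_subring subfield_fld)
  qed
qed

lemma algebraic_over_rat_iff_algebraic: "algebraic_over (gen_field {}) z \<longleftrightarrow> algebraic (z :: 'a::field_char_0)"
  unfolding algebraic_over_altdef gen_field_empty poly_over_def algebraic_altdef by auto

text \<open>The leading coefficient of an integer polynomial for \<open>z\<close> is a denominator:
  by \<open>valring_lead_coeff\<close> its product with \<open>z\<close> lies in every valuation
  ring.\<close>

lemma algebraic_multiple_int:
  assumes "algebraic (z :: 'a::field_char_0)"
  shows "\<exists>D::nat. D \<ge> 1 \<and> algebraic_int (of_nat D * z)"
proof -
  obtain p where p: "\<forall>i. coeff p i \<in> \<int>" "p \<noteq> 0" "poly p z = 0" using assms by (auto simp: algebraic_def)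
  obtain a where a: "lead_coeff p = of_int a" using p by (metis Ints_cases)
  have a0: "a \<noteq> 0" using a p by auto
  have "degree p \<ge> 1"
  proof (rule ccontr)
    assume "\<not> ?thesis"
    then obtain c where "p = [:c:]" by (metis degree_eq_zeroE not_one_le_zero less_one linorder_not_less)
    then show False using p by simp
  qed
  then have "algebraic_int (of_int a * z)" unfolding algebraic_int_iff_valring a[symmetric]
    using valring_lead_coeff p Ints_subring[OF valring_subring] by (fastforce simp: poly_over_def)
  then have "algebraic_int (of_nat (nat \<bar>a\<bar>) * z)"
    by (cases "a \<ge> 0") (auto simp: of_nat_nat)
  then show ?thesis using a0 by (intro exI[of _ "nat \<bar>a\<bar>"]) auto
qed

lemma coeff_prod_linear_bound:
  fixes M :: "complex multiset"
  assumes "\<forall>x\<in>#M. norm x \<le> C"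
  shows "norm (coeff (\<Prod>x\<in>#M. [:-x, 1:]) i) \<le> (1 + C) ^ size M"
  using assms
proof (induction M arbitrary: i)
  case empty
  show ?case by (cases i) (auto simp: one_pCons)
next
  case (add x M)
  let ?q = "\<Prod>x\<in>#M. [:-x, 1:]"
  have C: "norm x \<le> C" "C \<ge> 0" using add.prems by (auto intro: order_trans[OF norm_ge_zero])
  have b: "norm (coeff ?q i) \<le> (1 + C) ^ size M" for i using add by simp
  have "coeff (\<Prod>x\<in>#add_mset x M. [:-x, 1:]) i = (case i of 0 \<Rightarrow> 0 | Suc j \<Rightarrow> coeff ?q j) - x * coeff ?q i"
    by (cases i) (auto simp: mult_pCons_left)
  also have "norm \<dots> \<le> (1 + C) ^ size M + C * (1 + C) ^ size M"
  proof -
    have "norm (case i of 0 \<Rightarrow> 0 | Suc j \<Rightarrow> coeff ?q j) \<le> (1 + C) ^ size M"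
      using b C by (cases i) auto
    moreover have "norm (x * coeff ?q i) \<le> C * (1 + C) ^ size M"
      unfolding norm_mult using b C by (intro mult_mono) auto
    ultimately show ?thesis by (intro order_trans[OF norm_triangle_ineq4] add_mono)
  qed
  finally show ?case by (simp add: algebra_simps)
qed

lemma poly_over_prod_linear:
  assumes S: "is_subring S" and "\<forall>x\<in>#M. x \<in> S"
  shows "poly_over S (\<Prod>x\<in>#M. [:-x, 1:])"
  using assms(2) by (induction M) (auto intro!: poly_over_mult[OF S] simp: S subring_1[OF S] subring_uminus[OF S] simp del: mult_pCons_left)

lemma finite_int_polys:
  "finite {p :: complex poly. degree p \<le> d \<and> (\<forall>i. coeff p i \<in> \<int> \<and> norm (coeff p i) \<le> N)}"
proof -
  have "finite {z :: complex. z \<in> \<int> \<and> norm z \<le> N}"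
  proof (rule finite_subset)
    show "{z :: complex. z \<in> \<int> \<and> norm z \<le> N} \<subseteq> of_int ` {-\<lceil>N\<rceil>..\<lceil>N\<rceil>}"
    proof
      fix z :: complex assume "z \<in> {z. z \<in> \<int> \<and> norm z \<le> N}"
      then obtain k where k: "z = of_int k" "norm z \<le> N" by (auto elim: Ints_cases)
      then have "\<bar>real_of_int k\<bar> \<le> N" by simp
      then have "\<bar>k\<bar> \<le> \<lceil>N\<rceil>" by linarith
      then show "z \<in> of_int ` {-\<lceil>N\<rceil>..\<lceil>N\<rceil>}"
        using k by (intro image_eqI[of _ _ k]) (auto simp: abs_le_iff)
    qed
  qed simp
  then have "finite (Poly ` {xs. set xs \<subseteq> {z :: complex. z \<in> \<int> \<and> norm z \<le> N} \<and> length xs \<le> Suc d})"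
    by (intro finite_imageI finite_lists_length_le)
  then show ?thesis
  proof (rule finite_subset[rotated], intro subsetI)
    fix p :: "complex poly" assume "p \<in> {p. degree p \<le> d \<and> (\<forall>i. coeff p i \<in> \<int> \<and> norm (coeff p i) \<le> N)}"
    then have "set (coeffs p) \<subseteq> {z. z \<in> \<int> \<and> norm z \<le> N}" "length (coeffs p) \<le> Suc d"
      by (auto simp: coeffs_def)
    then show "p \<in> Poly ` {xs. set xs \<subseteq> {z :: complex. z \<in> \<int> \<and> norm z \<le> N} \<and> length xs \<le> Suc d}"
      by (intro image_eqI[of _ _ "coeffs p"]) auto
  qed
qed

text \<open>Northcott's argument: the conjugates of such \<open>g\<close> are bounded, and so are the denominators.\<close>
lemma finite_bounded_radicals:
  fixes h :: "'i \<Rightarrow> complex"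
  assumes I: "finite I" and h: "\<And>i. i \<in> I \<Longrightarrow> algebraic_over (gen_field {}) (h i)"
  shows "finite {g. algebraic_deg_le (gen_field {}) d g \<and> (\<exists>n e. n \<ge> 1 \<and> (\<forall>i\<in>I. e i \<le> n) \<and> g ^ n = (\<Prod>i\<in>I. h i ^ e i))}"
    (is "finite ?X")
proof -
  define Q :: "complex set" where "Q = gen_field {}"
  have Q: "is_subfield Q" by (simp add: Q_def subfield_fld)
  note QA = embedding_subring[OF Q]
  define AI where "AI = {z :: complex. algebraic_int z}"
  have AI: "is_subring AI" by (simp add: AI_def subring_algebraic_int)
  have "\<forall>i. i \<in> I \<longrightarrow> (\<exists>D::nat. D \<ge> 1 \<and> algebraic_int (of_nat D * h i))"
    using h algebraic_over_rat_iff_algebraic algebraic_multiple_int by blast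
  then obtain Df :: "'i \<Rightarrow> nat" where Df: "\<And>i. i \<in> I \<Longrightarrow> Df i \<ge> 1" "\<And>i. i \<in> I \<Longrightarrow> algebraic_int (of_nat (Df i) * h i)"
    by metis
  define D where "D = (\<Prod>i\<in>I. Df i)"
  have D1: "D \<ge> 1" unfolding D_def using Df(1) by (intro prod_ge_1) auto
  have Dh: "of_nat D * h i \<in> AI" if "i \<in> I" for i
  proof -
    have "D = Df i * (\<Prod>j\<in>I-{i}. Df j)" unfolding D_def using I that by (simp add: prod.remove)
    then have "of_nat D * h i = of_nat (\<Prod>j\<in>I-{i}. Df j) * (of_nat (Df i) * h i)" by simp
    also have "\<dots> \<in> AI"
      by (rule subring_mult[OF AI subring_of_nat[OF AI]]) (use Df(2)[OF that] in \<open>simp add: AI_def\<close>)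
    finally show ?thesis .
  qed
  have "\<forall>i. i \<in> I \<longrightarrow> (\<exists>p. p \<noteq> 0 \<and> poly_over Q p \<and> poly p (of_nat D * h i) = 0)"
  proof (intro allI impI)
    fix i assume i: "i \<in> I"
    have "of_nat D * h i \<in> {z. algebraic_over Q z}" using h[OF i]
      by (intro subring_mult[OF QA] subring_of_nat[OF QA]) (simp add: Q_def)
    then show "\<exists>p. p \<noteq> 0 \<and> poly_over Q p \<and> poly p (of_nat D * h i) = 0" by (simp add: algebraic_over_altdef)
  qed
  then obtain P where P: "\<And>i. i \<in> I \<Longrightarrow> P i \<noteq> 0" "\<And>i. i \<in> I \<Longrightarrow> poly_over Q (P i)"
    "\<And>i. i \<in> I \<Longrightarrow> poly (P i) (of_nat D * h i) = 0" by metis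
  define R where "R = (\<Union>i\<in>I. {y. poly (P i) y = 0})"
  have "finite R" unfolding R_def using I P by (auto intro: poly_roots_finite)
  \<comment> \<open>\<open>R\<close> contains all conjugates of the numbers
    \<open>of_nat D * h i\<close>. \<open>D\<close> itself enters the bound because the powers
    \<open>D ^ (n - e i)\<close> have to be bounded as well.\<close>
  define B where "B = real D + (\<Sum>y\<in>R. norm y)"
  have B: "norm y \<le> B" if "y \<in> R" for y
    using member_le_sum[of y R norm] \<open>finite R\<close> that by (simp add: B_def add_increasing)
  have BD: "real D \<le> B" by (simp add: B_def sum_nonneg)
  have B1: "B \<ge> 1" using BD D1 by linarith
  define C where "C = B ^ card I"
  have C0: "C \<ge> 0" using B1 by (simp add: C_def)
  define PP where "PP = {p :: complex poly. degree p \<le> d \<and> (\<forall>i. coeff p i \<in> \<int> \<and> norm (coeff p i) \<le> (1 + C) ^ d)}"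
  define F where "F = (\<Union>p\<in>PP - {0}. {y. poly p y = 0})"
  have "finite F" unfolding F_def PP_def using finite_int_polys[of d "(1 + C) ^ d"]
    by (intro finite_UN_I) (auto intro: poly_roots_finite)
  have key: "of_nat D ^ card I * g \<in> F" if g: "g \<in> ?X" for g
  proof -
    \<comment> \<open>Since the exponents \<open>e i\<close> are at most \<open>n\<close>, the power
      \<open>f ^ n\<close> is a product of integers \<open>D ^ (n - e i)\<close> and powers of
      algebraic integers \<open>of_nat D * h i\<close>. So \<open>f\<close> is an algebraic integer,
      with a denominator that does not depend on \<open>n\<close>.\<close>
    define f where "f = of_nat D ^ card I * g"
    obtain n e where ne: "n \<ge> 1" "\<forall>i\<in>I. e i \<le> n" "g ^ n = (\<Prod>i\<in>I. h i ^ e i)" and gd: "algebraic_deg_le Q d g"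
      using g by (auto simp: Q_def)
    have "f ^ n = (\<Prod>i\<in>I. of_nat D ^ n) * (\<Prod>i\<in>I. h i ^ e i)"
      by (simp add: f_def power_mult_distrib ne(3) power_mult[symmetric] mult.commute)
    also have "\<dots> = (\<Prod>i\<in>I. of_nat D ^ (n - e i) * (of_nat D * h i) ^ e i)"
      unfolding prod.distrib[symmetric] using ne(2) 
      by (intro prod.cong refl) (simp add: power_mult_distrib power_add[symmetric] mult.assoc[symmetric])
    finally have fn: "f ^ n = (\<Prod>i\<in>I. of_nat D ^ (n - e i) * (of_nat D * h i) ^ e i)" .
    have fAI: "algebraic_int f"
    proof (rule algebraic_int_power_cancel[OF ne(1)])
      have "f ^ n \<in> AI" unfolding fn using Dh 
        by (intro subring_prod[OF AI] subring_mult[OF AI subring_power[OF AI subring_of_nat[OF AI]] subring_power[OF AI]])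
      then show "algebraic_int (f ^ n)" by (simp add: AI_def)
    qed
    have DQ: "of_nat D \<in> Q" using Q by (simp add: subfield_subring subring_of_nat)
    have galg: "algebraic_over Q g" using gd by (auto simp: algebraic_over_def)
    have falg: "algebraic_over Q f"
      using subring_mult[OF QA subring_power[OF QA subring_of_nat[OF QA]], of g D "card I"] galg by (simp add: f_def)
    obtain m where m: "lead_coeff m = 1" "poly_over Q m" "poly m f = 0" "degree m \<ge> 1"
      "\<And>p. poly_over Q p \<Longrightarrow> poly p f = 0 \<Longrightarrow> \<exists>q. poly_over Q q \<and> p = q * m"
      by (rule minimal_poly[OF Q falg]) blast
    have m0: "m \<noteq> 0" using m by auto
    have dm: "degree m \<le> d"
    proof -
      obtain p where p: "p \<noteq> 0" "poly_over Q p" "degree p \<le> d" "poly p g = 0" using gd by (auto simp: algebraic_deg_le_def)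
      define c where "c = (of_nat D :: complex) ^ card I"
      have c0: "c \<noteq> 0" using D1 by (simp add: c_def)
      have cQ: "c \<in> Q" unfolding c_def by (intro subring_power[OF subfield_subring[OF Q]] DQ)
      define p' where "p' = p \<circ>\<^sub>p [:0, inverse c:]"
      have cp': "coeff p' i = coeff p i * inverse c ^ i" for i
        unfolding p'_def by (simp add: coeff_pcompose_linear)
      have "poly_over Q p'" unfolding poly_over_def cp'
        using p cQ subfield_subring[OF Q] subfield_inverse[OF Q] 
        by (auto intro!: subring_mult subring_power simp: poly_over_def)
      moreover have "poly p' f = 0" using p c0 by (simp add: p'_def poly_pcompose f_def c_def[symmetric] field_simps)
      ultimately obtain q where q: "p' = q * m" using m(5) by blast
      have "degree p' = degree p" using c0 by (simp add: p'_def degree_pcompose)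
      moreover have "p' \<noteq> 0" using p(1) c0 cp' by (metis leading_coeff_0_iff coeff_0 mult_eq_0_iff inverse_nonzero_iff_nonzero power_eq_0_iff)
      then have "degree p' = degree q + degree m" using q m0 by (metis degree_mult_eq mult_zero_left)
      ultimately show ?thesis using p(3) by linarith
    qed
    \<comment> \<open>An embedding that carries \<open>f\<close> to \<open>y\<close> turns the
      formula for \<open>f ^ n\<close> into one for \<open>y ^ n\<close>, which bounds it by
      \<open>C ^ n\<close>; taking \<open>n\<close>-th roots removes \<open>n\<close>.\<close>
    have roots: "y \<in> AI \<and> norm y \<le> C" if y: "poly m y = 0" for y
    proof -
      obtain \<sigma> where \<sigma>: "embedding Q \<sigma>" "\<sigma> f = y"
        using minimal_poly_root_conjugate[OF Q m(2) m0 m(3) m(5) y] by blast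
      have hs: "hom_on {z. algebraic_over Q z} \<sigma>" using \<sigma> by (simp add: embedding_def)
      have Da: "of_nat D * h i \<in> {z. algebraic_over Q z}" if "i \<in> I" for i
        using h[OF that] by (intro subring_mult[OF QA] subring_of_nat[OF QA]) (simp add: Q_def)
      have t: "of_nat D ^ (n - e i) * (of_nat D * h i) ^ e i \<in> {z. algebraic_over Q z}" if "i \<in> I" for i
        by (intro subring_mult[OF QA] subring_power[OF QA] subring_of_nat[OF QA] Da that)
      have "y ^ n = \<sigma> (f ^ n)" using \<sigma> falg hom_power[OF QA hs, of f n] by simp
      also have "\<dots> = (\<Prod>i\<in>I. \<sigma> (of_nat D ^ (n - e i) * (of_nat D * h i) ^ e i))"
        unfolding fn by (rule hom_prod[OF QA hs t])
      also have "\<dots> = (\<Prod>i\<in>I. of_nat D ^ (n - e i) * \<sigma> (of_nat D * h i) ^ e i)"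
      proof (intro prod.cong refl)
        fix i assume i: "i \<in> I"
        have "\<sigma> (of_nat D ^ (n - e i) * (of_nat D * h i) ^ e i) =
            \<sigma> (of_nat D ^ (n - e i)) * \<sigma> ((of_nat D * h i) ^ e i)"
          by (intro hom_mult[OF QA hs] subring_power[OF QA] subring_of_nat[OF QA] Da i)
        also have "\<dots> = of_nat D ^ (n - e i) * \<sigma> (of_nat D * h i) ^ e i"
          using hom_power[OF QA hs Da[OF i]] hom_power[OF QA hs subring_of_nat[OF QA]] hom_of_nat[OF QA hs] by metis
        finally show "\<sigma> (of_nat D ^ (n - e i) * (of_nat D * h i) ^ e i) = of_nat D ^ (n - e i) * \<sigma> (of_nat D * h i) ^ e i" .
      qed
      finally have yn: "y ^ n = (\<Prod>i\<in>I. of_nat D ^ (n - e i) * \<sigma> (of_nat D * h i) ^ e i)" .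
      have "norm y ^ n = (\<Prod>i\<in>I. real D ^ (n - e i) * norm (\<sigma> (of_nat D * h i)) ^ e i)"
        using arg_cong[OF yn, of norm] by (simp add: norm_power norm_mult prod_norm[symmetric])
      also have "\<dots> \<le> (\<Prod>i\<in>I. B ^ n)"
      proof (intro prod_mono conjI)
        fix i assume i: "i \<in> I"
        have "\<sigma> (of_nat D * h i) \<in> R"
          using embedding_alg[OF Q \<sigma>(1) P(2,3)] Da i by (auto simp: R_def)
        then have "norm (\<sigma> (of_nat D * h i)) \<le> B" by (rule B)
        then have "real D ^ (n - e i) * norm (\<sigma> (of_nat D * h i)) ^ e i \<le> B ^ (n - e i) * B ^ e i"
          using BD B1 by (intro mult_mono power_mono) auto
        also have "\<dots> = B ^ n" using ne i by (simp add: power_add[symmetric])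
        finally show "real D ^ (n - e i) * norm (\<sigma> (of_nat D * h i)) ^ e i \<le> B ^ n" .
      qed auto
      also have "\<dots> = C ^ n" by (simp add: C_def power_mult[symmetric] mult.commute)
      finally have "norm y ^ n \<le> C ^ n" .
      then have "norm y \<le> C" using C0 ne(1) by (metis power_mono_iff norm_ge_zero less_eq_Suc_le One_nat_def)
      moreover have "algebraic_int y"
      proof -
        obtain p where p: "lead_coeff p = 1" "\<forall>i. coeff p i \<in> \<int>" "poly p f = 0" using fAI by (auto elim: algebraic_int.cases)
        have "poly_over Q p" using p Ints_subring[OF subfield_subring[OF Q]] by (auto simp: poly_over_def)
        from embedding_alg[OF Q \<sigma>(1) this p(3) falg] have "poly p y = 0" using \<sigma> by simp
        then show ?thesis using p by (auto simp: algebraic_int.simps)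
      qed
      ultimately show ?thesis by (simp add: AI_def)
    qed
    have dec: "m = (\<Prod>x\<in>#proots m. [:-x, 1:])" and sz: "size (proots m) = degree m"
      using complex_poly_decompose_multiset[of m] m(1) size_proots_complex[of m] by simp_all
    have rts: "\<forall>x\<in>#proots m. x \<in> AI \<and> norm x \<le> C" using roots m0 by simp
    have "m \<in> PP" unfolding PP_def
    proof (intro CollectI conjI allI dm)
      fix i
      have "coeff m i \<in> AI" using poly_over_prod_linear[OF AI, of "proots m"] rts dec by (auto simp: poly_over_def)
      moreover have "coeff m i \<in> \<rat>" using m(2) gen_field_empty by (auto simp: poly_over_def Q_def)
      ultimately show "coeff m i \<in> \<int>" using rational_algebraic_int_is_int by (auto simp: AI_def)
      have "norm (coeff m i) \<le> (1 + C) ^ degree m"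
        using coeff_prod_linear_bound[of "proots m" C i] rts dec sz by simp
      also have "\<dots> \<le> (1 + C) ^ d" using C0 dm by (intro power_increasing) auto
      finally show "norm (coeff m i) \<le> (1 + C) ^ d" .
    qed
    then show ?thesis using m(3) m0 by (auto simp: F_def f_def)
  qed
  have "?X \<subseteq> (\<lambda>f. f / of_nat D ^ card I) ` F"
  proof
    fix g assume "g \<in> ?X"
    from key[OF this] show "g \<in> (\<lambda>f. f / of_nat D ^ card I) ` F" using D1
      by (intro image_eqI[of _ _ "of_nat D ^ card I * g"]) auto
  qed
  then show ?thesis using \<open>finite F\<close> finite_surj by blast
qed

section \<open>Units of a valuation ring and discrete valuations\<close>

context
  fixes V :: "'a::field set"
  assumes V: "valring V"
begin

definition unitV :: "'a \<Rightarrow> bool" where "unitV z \<longleftrightarrow> z \<noteq> 0 \<and> z \<in> V \<and> inverse z \<in> V"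

lemma unitV_1: "unitV 1" by (simp add: unitV_def subring_1[OF valring_subring[OF V]])

lemma unitV_inverse: "unitV z \<Longrightarrow> unitV (inverse z)" by (simp add: unitV_def)

lemma unitV_mult: "unitV z \<Longrightarrow> unitV w \<Longrightarrow> unitV (z * w)"
  by (auto simp: unitV_def intro!: subring_mult[OF valring_subring[OF V]])

lemma unitV_powi: "unitV z \<Longrightarrow> unitV (z powi k)"
proof -
  assume z: "unitV z"
  have "unitV (w ^ n)" if "unitV w" for w n using that by (induction n) (auto simp: unitV_1 unitV_mult)
  then show ?thesis using z by (auto simp: power_int_def unitV_inverse)
qed

text \<open>One of \<open>x / y\<close> and \<open>y / x\<close> lies in \<open>V\<close>; if
  \<open>a / b\<close> does, invertibility of \<open>a + b\<close> would make \<open>b\<close>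
  invertible. This is the additive part of the maximal ideal.\<close>

lemma nonunit_add:
  assumes x: "x \<in> V" "\<not> unitV x" and y: "y \<in> V" "\<not> unitV y"
  shows "\<not> unitV (x + y)"
proof
  assume u: "unitV (x + y)"
  note S = valring_subring[OF V]
  have main: False if "a \<in> V" "b \<in> V" "a / b \<in> V" "b \<noteq> 0" "\<not> unitV b" "unitV (a + b)" for a b
  proof -
    have "inverse b = (a / b + 1) * inverse (a + b)" using that by (simp add: field_simps unitV_def)
    also have "\<dots> \<in> V" using that by (intro subring_mult[OF S] subring_add[OF S] subring_1[OF S]) (auto simp: unitV_def)
    finally show False using that by (auto simp: unitV_def)
  qed
  have "x \<noteq> 0" "y \<noteq> 0" using u x y by auto
  then have "x / y \<in> V \<or> y / x \<in> V" using V unfolding valring_def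
    by (metis divide_eq_0_iff inverse_divide)
  then show False using main[of x y] main[of y x] u assms \<open>x \<noteq> 0\<close> \<open>y \<noteq> 0\<close> by (auto simp: add.commute)
qed

lemma nonunit_sum:
  "(\<And>i. i \<in> I \<Longrightarrow> f i \<in> V \<and> \<not> unitV (f i)) \<Longrightarrow> sum f I \<in> V \<and> \<not> unitV (sum f I)"
proof (induction I rule: infinite_finite_induct)
  case (insert i I)
  then show ?case using nonunit_add subring_add[OF valring_subring[OF V]] by auto
qed (auto simp: unitV_def subring_0[OF valring_subring[OF V]])

lemma nonunit_mult:
  assumes "x \<in> V" "\<not> unitV x" "a \<in> V" shows "\<not> unitV (a * x)"
proof
  assume u: "unitV (a * x)"
  then have "inverse x = a * inverse (a * x)" by (simp add: unitV_def field_simps)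
  also have "\<dots> \<in> V" using u assms by (intro subring_mult[OF valring_subring[OF V]]) (auto simp: unitV_def)
  finally show False using u assms by (auto simp: unitV_def)
qed

text \<open>Divisibility in a valuation ring is total, so a finite set has a member of largest
  absolute value; \<open>y / x \<in> V\<close> says that \<open>y\<close> is not larger than
  \<open>x\<close>.\<close>

lemma valring_max:
  assumes "finite X" "X \<noteq> {}" "0 \<notin> X"
  shows "\<exists>x\<in>X. \<forall>y\<in>X. y / x \<in> V"
  using assms
proof (induction X rule: finite_ne_induct)
  case (singleton x)
  then show ?case by (simp add: subring_1[OF valring_subring[OF V]])
next
  case (insert x X)
  then obtain z where z: "z \<in> X" "\<forall>y\<in>X. y / z \<in> V" by auto
  have nz: "x \<noteq> 0" "z \<noteq> 0" using insert z by auto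
  have "x / z \<in> V \<or> z / x \<in> V" using V nz unfolding valring_def
    by (metis divide_eq_0_iff inverse_divide)
  then show ?case
  proof
    assume "x / z \<in> V" then show ?thesis using z by auto
  next
    assume zx: "z / x \<in> V"
    have "y / x \<in> V" if "y \<in> insert x X" for y
    proof (cases "y = x")
      case True then show ?thesis using nz subring_1[OF valring_subring[OF V]] by simp
    next
      case False
      then have "y / z \<in> V" using that z by auto
      then have "(y / z) * (z / x) \<in> V" using zx by (rule subring_mult[OF valring_subring[OF V]])
      then show ?thesis using nz by simp
    qed
    then show ?thesis by blast
  qed
qed

end

text \<open>\<open>v\<close> is the \<open>u\<close>-adic valuation of \<open>E(u)\<close>, extended to \<open>L\<close> and scaled by \<open>d!\<close> to make it integral.\<close>
lemma discrete_valuation: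
  fixes L E :: "'a::field set"
  assumes E: "is_subfield E" and u: "\<not> algebraic_over E u" and L: "\<And>a. a \<in> L \<Longrightarrow> algebraic_deg_le (gen_field (insert u E)) d a"
    and closed: "\<And>a b. a \<in> L \<Longrightarrow> b \<in> L \<Longrightarrow> a * b \<in> L" and uL: "u \<in> L"
  shows "\<exists>v :: 'a \<Rightarrow> int. v u \<noteq> 0 \<and> (\<forall>a\<in>L - {0}. \<forall>b\<in>L - {0}. v (a * b) = v a + v b)"
proof -
  note S = subfield_subring[OF E]
  have u0: "u \<noteq> 0" using u algebraic_over_self[OF E subring_0[OF S]] by auto
  have "u * a \<noteq> 1" if a: "a \<in> {poly p u | p. poly_over E p}" for a
  proof
    assume "u * a = 1"
    moreover obtain p where p: "poly_over E p" "a = poly p u" using a by auto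
    ultimately have "poly (pCons (-1) p) u = 0" by simp
    moreover have "poly_over E (pCons (-1) p)" using p by (simp add: S subring_uminus[OF S] subring_1[OF S])
    moreover have "pCons (-1) p \<noteq> 0" by simp
    ultimately show False using u by (auto simp: algebraic_over_altdef)
  qed
  then obtain V where V: "valring V" "{poly p u | p. poly_over E p} \<subseteq> V" "\<forall>a\<in>V. u * a \<noteq> 1"
    using chevalley[OF subring_adjoin[OF S] adjoin_self[OF S], of u] by blast
  note SV = valring_subring[OF V(1)]
  let ?unit = "unitV V"
  note unit_def = unitV_def[OF V(1)]
  note unit_1 = unitV_1[OF V(1)] and unit_inv = unitV_inverse[OF V(1)] and unit_mult = unitV_mult[OF V(1)]
    and unit_powi = unitV_powi[OF V(1)]
  have EV: "E \<subseteq> V" using adjoin_superset[OF S] V(2) by blast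
  have uV: "u \<in> V" using adjoin_self[OF S] V(2) by blast
  have iu: "inverse u \<notin> V" using V(3) u0 by fastforce
  have u_nu: "\<not> ?unit u" using iu by (simp add: unit_def)
  have uk: "k = 0" if "?unit (u powi k)" for k
  proof -
    have pos: "\<not> ?unit (u ^ n)" if "n > 0" for n
      using that nonunit_mult[OF V(1) uV u_nu, of "u ^ (n - 1)"] subring_power[OF SV uV]
      by (cases n) (auto simp: mult.commute)
    show ?thesis
    proof (rule ccontr)
      assume "k \<noteq> 0"
      then consider "k > 0" | "k < 0" by linarith
      then show False
      proof cases
        case 1 then show False using that pos[of "nat k"] by (simp add: power_int_def)
      next
        case 2
        then have "?unit (inverse (u powi k))" using that unit_inv by blast
        then have "?unit (u ^ nat (-k))" using 2 by (simp add: power_int_def power_inverse)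
        then show False using 2 pos by simp
      qed
    qed
  qed
  \<comment> \<open>Non-zero constants from \<open>E\<close> are units and \<open>u\<close> is not,
    so a polynomial with non-zero constant term is a unit at \<open>u\<close>; otherwise a factor
    \<open>u\<close> is split off.\<close>
  have polyval: "\<exists>k. ?unit (poly p u / u powi k)" if "p \<noteq> 0" "poly_over E p" for p
    using that
  proof (induction p)
    case (pCons a p)
    then have aE: "a \<in> E" and pE: "poly_over E p" by (auto simp: S)
    show ?case
    proof (cases "a = 0")
      case True
      then have "p \<noteq> 0" using pCons by auto
      then obtain k where k: "?unit (poly p u / u powi k)" using pCons pE by blast
      have "poly (pCons a p) u / u powi (k + 1) = poly p u / u powi k" using True u0 by (simp add: power_int_add)
      then show ?thesis using k by metis
    next
      case False
      have pu: "poly p u \<in> V" using V(2) pE by blast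
      have ua: "?unit a" using False aE EV subfield_inverse[OF E] by (auto simp: unit_def)
      have "?unit (a + u * poly p u)"
      proof (rule ccontr)
        assume "\<not> ?thesis"
        moreover have "\<not> ?unit (- (u * poly p u))"
          using nonunit_mult[OF V(1) uV u_nu, of "- poly p u"] subring_uminus[OF SV pu] by (simp add: mult.commute)
        moreover have "u * poly p u \<in> V" using uV pu by (rule subring_mult[OF SV])
        then have "a + u * poly p u \<in> V" "- (u * poly p u) \<in> V"
          using aE EV by (auto intro: subring_add[OF SV] subring_uminus[OF SV])
        ultimately have "\<not> ?unit ((a + u * poly p u) + - (u * poly p u))"
          using nonunit_add[OF V(1)] by blast
        then show False using ua by simp
      qed
      then show ?thesis by (intro exI[of _ 0]) simp
    qed
  qed auto
  have fldval: "\<exists>k. ?unit (c / u powi k)" if c: "c \<in> gen_field (insert u E)" "c \<noteq> 0" for c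
  proof -
    obtain p q where pq: "poly_over E p" "poly_over E q" "poly q u \<noteq> 0" "c = poly p u / poly q u"
      using gen_field_adjoin_quotient[OF E c(1)] by blast
    have "p \<noteq> 0" "q \<noteq> 0" using pq that by auto
    then obtain k l where kl: "?unit (poly p u / u powi k)" "?unit (poly q u / u powi l)" using polyval pq by metis
    have "?unit ((poly p u / u powi k) * inverse (poly q u / u powi l))" using kl unit_mult unit_inv by blast
    moreover have "(poly p u / u powi k) * inverse (poly q u / u powi l) = c / u powi (k - l)"
      using u0 pq by (simp add: power_int_diff field_simps)
    ultimately show ?thesis by metis
  qed
  \<comment> \<open>In a vanishing sum of non-zero terms, a largest term needs a second one of the
    same value to cancel it. The quotient of the two determines the value of some
    \<open>a powi N\<close>, where \<open>N\<close> is non-zero of absolute value at most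
    \<open>d\<close> and hence divides \<open>fact d\<close>.\<close>
  have ex: "\<exists>K. ?unit (a ^ fact d / u powi K)" if a: "a \<in> L" "a \<noteq> 0" for a
  proof -
    obtain p where p: "p \<noteq> 0" "poly_over (gen_field (insert u E)) p" "degree p \<le> d" "poly p a = 0"
      using L[OF a(1)] by (auto simp: algebraic_deg_le_def)
    define x where "x = (\<lambda>i. coeff p i * a ^ i)"
    define I where "I = {i. i \<le> degree p \<and> coeff p i \<noteq> 0}"
    have fI: "finite I" by (simp add: I_def)
    have "degree p \<in> I" using p by (simp add: I_def)
    have x0: "x i \<noteq> 0" if "i \<in> I" for i using that a by (simp add: x_def I_def)
    obtain i where i: "i \<in> I" "\<And>j. j \<in> I \<Longrightarrow> x j / x i \<in> V"
      using valring_max[OF V(1), of "x ` I"] fI \<open>degree p \<in> I\<close> x0 by (metis (no_types, lifting) empty_iff finite_imageI imageE image_eqI image_is_empty)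
    have "(\<Sum>j\<in>I. x j) = 0"
    proof -
      have "(\<Sum>j\<in>I. x j) = poly p a" unfolding poly_altdef x_def
        by (rule sum.mono_neutral_left) (auto simp: I_def)
      then show ?thesis using p by simp
    qed
    then have "(\<Sum>j\<in>I. x j / x i) = 0" by (simp add: sum_divide_distrib[symmetric])
    then have "(\<Sum>j\<in>I-{i}. x j / x i) = - 1" using fI i(1) x0[OF i(1)] by (simp add: sum.remove[of _ i] eq_neg_iff_add_eq_0 add.commute)
    moreover have "?unit (- 1)" using subring_uminus[OF SV subring_1[OF SV]] by (simp add: unit_def)
    ultimately have "\<exists>j\<in>I-{i}. ?unit (x j / x i)" using nonunit_sum[OF V(1), of "I - {i}" "\<lambda>j. x j / x i"] i(2) by auto
    then obtain j where j: "j \<in> I" "j \<noteq> i" "?unit (x j / x i)" by blast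
    have "coeff p j \<in> gen_field (insert u E)" "coeff p i \<in> gen_field (insert u E)" "coeff p j \<noteq> 0" "coeff p i \<noteq> 0"
      using p i j by (auto simp: poly_over_def I_def)
    then obtain k l where kl: "?unit (coeff p j / u powi k)" "?unit (coeff p i / u powi l)" using fldval by metis
    define N where "N = int j - int i"
    have "x j / x i = (coeff p j / coeff p i) * a powi N"
      using a by (simp add: x_def N_def power_int_diff)
    then have "a powi N / u powi (l - k) = (x j / x i) * ((coeff p i / u powi l) * inverse (coeff p j / u powi k))"
      using u0 x0[OF i(1)] \<open>coeff p j \<noteq> 0\<close> \<open>coeff p i \<noteq> 0\<close> by (simp add: power_int_diff field_simps)
    then have un: "?unit (a powi N / u powi (l - k))" using j(3) kl unit_mult unit_inv by metis
    have "nat \<bar>N\<bar> \<le> d" "nat \<bar>N\<bar> \<ge> 1" using i j p(3) by (auto simp: N_def I_def)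
    then have "nat \<bar>N\<bar> dvd fact d" by (intro dvd_fact) auto
    then have "\<bar>N\<bar> dvd int (fact d)" by (metis abs_ge_zero int_dvd_int_iff nat_0_le)
    then obtain M where M: "int (fact d) = N * M" by auto
    have "a ^ fact d = (a powi N) powi M" by (metis M power_int_mult power_int_of_nat)
    then have "(a powi N / u powi (l - k)) powi M = a ^ fact d / u powi ((l - k) * M)"
      by (simp add: power_int_divide_distrib power_int_mult)
    then show ?thesis using unit_powi[OF un, of M] by metis
  qed
  define v where "v = (\<lambda>a. SOME K. ?unit (a ^ fact d / u powi K))"
  have v: "?unit (a ^ fact d / u powi (v a))" if "a \<in> L" "a \<noteq> 0" for a
    unfolding v_def using someI_ex[OF ex[OF that]] .
  have uniq: "K = K'" if "?unit (a ^ fact d / u powi K)" "?unit (a ^ fact d / u powi K')" for a K K'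
  proof -
    have "a \<noteq> 0" using that by (auto simp: unit_def)
    have "(a ^ fact d / u powi K) * inverse (a ^ fact d / u powi K') = u powi (K' - K)"
      using u0 \<open>a \<noteq> 0\<close> by (simp add: power_int_diff field_simps)
    then have "?unit (u powi (K' - K))" using that unit_mult unit_inv by metis
    then show ?thesis using uk by fastforce
  qed
  have "v u = fact d"
  proof (rule uniq[OF v[OF uL u0]])
    show "?unit (u ^ fact d / u powi (fact d))"
      using u0 unit_1 by (metis divide_self_if power_int_of_nat of_nat_fact power_not_zero)
  qed
  then have "v u \<noteq> 0" by simp
  moreover have "v (a * b) = v a + v b" if "a \<in> L - {0}" "b \<in> L - {0}" for a b
  proof (rule uniq)
    show "?unit ((a * b) ^ fact d / u powi (v (a * b)))" using that closed by (intro v) auto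
    have "?unit ((a ^ fact d / u powi (v a)) * (b ^ fact d / u powi (v b)))" 
      using that by (intro unit_mult v) auto
    moreover have "(a ^ fact d / u powi (v a)) * (b ^ fact d / u powi (v b)) = (a * b) ^ fact d / u powi (v a + v b)"
      using u0 by (simp add: power_int_add power_mult_distrib)
    ultimately show "?unit ((a * b) ^ fact d / u powi (v a + v b))" by simp
  qed
  ultimately show ?thesis by blast
qed

section \<open>Multiplicative groups in finitely generated fields\<close>

definition mul_group :: "'a::field set \<Rightarrow> bool" where
  "mul_group M \<longleftrightarrow> 1 \<in> M \<and> 0 \<notin> M \<and> (\<forall>x\<in>M. \<forall>y\<in>M. x / y \<in> M)"

definition fg_mul_group :: "'a::field set \<Rightarrow> bool" where
  "fg_mul_group M \<longleftrightarrow> (\<exists>F. finite F \<and> F \<subseteq> M \<and> (\<forall>N. mul_group N \<and> F \<subseteq> N \<longrightarrow> M \<subseteq> N))"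

text \<open>A bound on the torsion-free rank: any \<open>r + 1\<close> elements are multiplicatively
  dependent. Unlike a bound on numbers of generators, it extends to groups of radicals, see
  \<open>rank_radical_closure\<close>.\<close>

definition rank_le :: "nat \<Rightarrow> 'a::field set \<Rightarrow> bool" where
  "rank_le r M \<longleftrightarrow> (\<forall>x::nat \<Rightarrow> 'a. (\<forall>i\<le>r. x i \<in> M) \<longrightarrow>
     (\<exists>e::nat \<Rightarrow> int. (\<exists>i\<le>r. e i \<noteq> 0) \<and> (\<Prod>i\<le>r. x i powi e i) = 1))"

context
  fixes M :: "'a::field set"
  assumes M: "mul_group M"
begin

lemma mul_group_1: "1 \<in> M" and mul_group_nonzero: "x \<in> M \<Longrightarrow> x \<noteq> 0"
  and mul_group_divide: "x \<in> M \<Longrightarrow> y \<in> M \<Longrightarrow> x / y \<in> M"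
  using M by (auto simp: mul_group_def)

lemma mul_group_inverse: "x \<in> M \<Longrightarrow> inverse x \<in> M"
  using mul_group_divide[OF mul_group_1] by (simp add: inverse_eq_divide)

lemma mul_group_mult: "x \<in> M \<Longrightarrow> y \<in> M \<Longrightarrow> x * y \<in> M"
  using mul_group_divide[OF _ mul_group_inverse] by (simp add: divide_inverse)

lemma mul_group_power: "x \<in> M \<Longrightarrow> x ^ n \<in> M"
  by (induction n) (auto intro: mul_group_1 mul_group_mult)

lemma mul_group_powi: "x \<in> M \<Longrightarrow> x powi k \<in> M"
  by (auto simp: power_int_def intro: mul_group_power mul_group_inverse)

lemma mul_group_prod: "(\<And>i. i \<in> I \<Longrightarrow> f i \<in> M) \<Longrightarrow> prod f I \<in> M"
  by (induction I rule: infinite_finite_induct) (auto intro: mul_group_1 mul_group_mult)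

end

lemma powi_abs_eq: "x \<noteq> 0 \<Longrightarrow> x powi k = y \<Longrightarrow> x ^ nat \<bar>k\<bar> = y powi (sgn k)" for x y :: "'a::field"
  by (cases k "0::int" rule: linorder_cases) (auto simp: power_int_def power_inverse)

lemma prod_powi: "(\<Prod>i\<in>I. (f i :: 'a::field)) powi k = (\<Prod>i\<in>I. f i powi k)"
  by (induction I rule: infinite_finite_induct) (auto simp: power_int_mult_distrib)

text \<open>For the least \<open>s\<close> with \<open>rank_le s M\<close> there are
  \<open>s\<close> independent elements; any further \<open>m\<close> makes them dependent, and
  independence forces the exponent of \<open>m\<close> in the relation to be non-zero.\<close>

lemma maximal_independent:
  assumes M: "mul_group M" and r: "rank_le r M"
  shows "\<exists>s x. (\<forall>i<s. x i \<in> M) \<and> (\<forall>m\<in>M. \<exists>n e. n \<ge> (1::nat) \<and> m ^ n = (\<Prod>i<(s::nat). x i powi (e i :: int)))"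
proof -
  define s where "s = (LEAST s. rank_le s M)"
  have s: "rank_le s M" unfolding s_def using r by (rule LeastI)
  have "\<exists>x. (\<forall>i<s. x i \<in> M) \<and> (\<forall>e::nat\<Rightarrow>int. (\<Prod>i<s. x i powi e i) = 1 \<longrightarrow> (\<forall>i<s. e i = 0))"
  proof (cases s)
    case (Suc t)
    then have "\<not> rank_le t M" using not_less_Least[of t "\<lambda>s. rank_le s M"] by (simp add: s_def)
    then show ?thesis unfolding rank_le_def Suc lessThan_Suc_atMost less_Suc_eq_le by blast
  qed auto
  then obtain x where x: "\<And>i. i < s \<Longrightarrow> x i \<in> M"
    "\<And>e::nat\<Rightarrow>int. (\<Prod>i<s. x i powi e i) = 1 \<Longrightarrow> (\<forall>i<s. e i = 0)" by blast
  have "\<exists>n e. n \<ge> (1::nat) \<and> m ^ n = (\<Prod>i<s. x i powi (e i :: int))" if m: "m \<in> M" for m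
  proof -
    have "\<forall>i\<le>s. (x(s := m)) i \<in> M" using x(1) m by auto
    then obtain e :: "nat \<Rightarrow> int" where e: "\<exists>i\<le>s. e i \<noteq> 0" "(\<Prod>i\<le>s. (x(s := m)) i powi e i) = 1"
      using s unfolding rank_le_def by blast
    have "(\<Prod>i\<le>s. (x(s := m)) i powi e i) = (\<Prod>i<s. x i powi e i) * m powi e s"
      unfolding lessThan_Suc_atMost[symmetric] by simp
    then have rel: "(\<Prod>i<s. x i powi e i) * m powi e s = 1" using e by simp
    have es: "e s \<noteq> 0"
    proof
      assume "e s = 0"
      then have "\<forall>i<s. e i = 0" using x(2) rel by simp
      then show False using e(1) \<open>e s = 0\<close> by (metis le_neq_implies_less)
    qed
    have m0: "m \<noteq> 0" using mul_group_nonzero[OF M m] .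
    have "m powi e s = inverse (\<Prod>i<s. x i powi e i)" using rel by (metis inverse_unique mult.commute)
    then have "m ^ nat \<bar>e s\<bar> = (inverse (\<Prod>i<s. x i powi e i)) powi sgn (e s)" using powi_abs_eq[OF m0] by blast
    also have "\<dots> = (\<Prod>i<s. x i powi (- e i * sgn (e s)))"
      by (simp add: power_int_minus[symmetric] prod_inversef[symmetric] prod_powi power_int_mult[symmetric] flip: power_int_inverse)
    finally show ?thesis using es by (intro exI[of _ "nat \<bar>e s\<bar>"]) auto
  qed
  then show ?thesis using x(1) by blast
qed

text \<open>Dividing the exponents in \<open>m ^ n\<close> by \<open>n\<close> with remainder writes
  \<open>m\<close> as a product of powers of the \<open>x i\<close> times some \<open>g\<close>,
  where \<open>g ^ n\<close> is a product of powers of the \<open>x i\<close> with exponents below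
  \<open>n\<close>. By \<open>finite_bounded_radicals\<close> only finitely many \<open>g\<close>
  occur, for all \<open>n\<close> together.\<close>

lemma fg_mul_group_algebraic:
  fixes M :: "complex set"
  assumes M: "mul_group M" and r: "rank_le r M" and d: "\<And>a. a \<in> M \<Longrightarrow> algebraic_deg_le (gen_field {}) d a"
  shows "fg_mul_group M"
proof -
  obtain s x where x: "\<And>i. i < s \<Longrightarrow> x i \<in> M"
    "\<And>m. m \<in> M \<Longrightarrow> \<exists>n e. n \<ge> (1::nat) \<and> m ^ n = (\<Prod>i<(s::nat). x i powi (e i :: int))"
    using maximal_independent[OF M r] by blast
  define X where "X = {g. algebraic_deg_le (gen_field {}) d g \<and> (\<exists>n e. n \<ge> 1 \<and> (\<forall>i\<in>{..<s}. e i \<le> n) \<and> g ^ n = (\<Prod>i<s. x i ^ e i))}"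
  have "finite X" unfolding X_def
    by (rule finite_bounded_radicals) (use x(1) d in \<open>auto simp: algebraic_over_def\<close>)
  define F where "F = (X \<inter> M) \<union> x ` {..<s}"
  have "finite F" "F \<subseteq> M" using \<open>finite X\<close> x(1) by (auto simp: F_def)
  moreover have "M \<subseteq> N" if N: "mul_group N" "F \<subseteq> N" for N
  proof
    fix m assume m: "m \<in> M"
    obtain n e where ne: "n \<ge> (1::nat)" "m ^ n = (\<Prod>i<s. x i powi (e i :: int))" using x(2)[OF m] by blast
    define t where "t = (\<Prod>i<s. x i powi (e i div int n))"
    define g where "g = m / t"
    have t: "t \<in> M" unfolding t_def by (intro mul_group_prod[OF M] mul_group_powi[OF M] x) auto
    have t0: "t \<noteq> 0" using mul_group_nonzero[OF M t] .
    have gM: "g \<in> M" unfolding g_def using m t by (rule mul_group_divide[OF M])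
    have xi: "x i powi e i = x i ^ nat (e i mod int n) * (x i powi (e i div int n)) ^ n" if "i < s" for i
    proof -
      have x0: "x i \<noteq> 0" using mul_group_nonzero[OF M x(1)[OF that]] .
      have "x i powi e i = x i powi (e i mod int n + (e i div int n) * int n)" by simp
      also have "\<dots> = x i powi (e i mod int n) * (x i powi (e i div int n)) powi int n"
        using x0 by (subst power_int_add) (simp_all add: power_int_mult)
      finally show ?thesis using ne(1) by (simp add: power_int_def)
    qed
    have "m ^ n = (\<Prod>i<s. x i ^ nat (e i mod int n) * (x i powi (e i div int n)) ^ n)" 
      unfolding ne(2) using xi by (intro prod.cong) auto
    also have "\<dots> = (\<Prod>i<s. x i ^ nat (e i mod int n)) * t ^ n"
      by (simp add: prod.distrib t_def prod_power_distrib)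
    finally have "g ^ n = (\<Prod>i<s. x i ^ nat (e i mod int n))" using t0 by (simp add: g_def power_divide)
    moreover have "\<forall>i\<in>{..<s}. nat (e i mod int n) \<le> n"
      using ne(1) by (auto simp: nat_le_iff intro: less_imp_le pos_mod_bound)
    ultimately have "g \<in> X" unfolding X_def using ne(1) d[OF gM]
      by (intro CollectI conjI exI[of _ n] exI[of _ "\<lambda>i. nat (e i mod int n)"]) auto
    then have "g \<in> N" using gM N by (auto simp: F_def)
    moreover have "t \<in> N" unfolding t_def using N
      by (intro mul_group_prod[OF N(1)] mul_group_powi[OF N(1)]) (auto simp: F_def)
    ultimately have "g * t \<in> N" by (rule mul_group_mult[OF N(1)])
    then show "m \<in> N" using t0 by (simp add: g_def)
  qed
  ultimately show ?thesis unfolding fg_mul_group_def by blast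
qed

text \<open>Modulo the kernel of \<open>v\<close> the group is infinite cyclic, so the kernel and
  one element of least positive value generate it. As \<open>u\<close> is independent of the kernel,
  the rank drops by one there, which makes the induction hypothesis \<open>IH\<close>
  applicable.\<close>

lemma fg_mul_group_kernel:
  fixes v :: "'a::field \<Rightarrow> int"
  assumes M: "mul_group M" and v: "\<And>a b. a \<in> M \<Longrightarrow> b \<in> M \<Longrightarrow> v (a * b) = v a + v b"
    and u: "u \<in> M" "v u \<noteq> 0" and r: "rank_le r M"
    and IH: "\<And>r'. r = Suc r' \<Longrightarrow> mul_group {m\<in>M. v m = 0} \<Longrightarrow> rank_le r' {m\<in>M. v m = 0} \<Longrightarrow>
      fg_mul_group {m\<in>M. v m = 0}"
  shows "fg_mul_group M"
proof -
  define K where "K = {m\<in>M. v m = 0}"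
  note M1 = mul_group_1[OF M]
  have v1: "v 1 = 0" using v[OF M1 M1] by simp
  have vinv: "v (inverse a) = - v a" if "a \<in> M" for a
    using v[OF that mul_group_inverse[OF M that]] mul_group_nonzero[OF M that] v1 by simp
  have vpow: "v (a ^ n) = int n * v a" if "a \<in> M" for a n
    by (induction n) (use v1 v[OF that mul_group_power[OF M that]] in \<open>auto simp: algebra_simps\<close>)
  have vpowi: "v (a powi k) = k * v a" if "a \<in> M" for a k
    using vpow[OF that] vpow[OF mul_group_inverse[OF M that]] vinv[OF that] by (auto simp: power_int_def)
  have vdiv: "v (a / b) = v a - v b" if "a \<in> M" "b \<in> M" for a b
    using v[OF that(1) mul_group_inverse[OF M that(2)]] vinv[OF that(2)] by (simp add: divide_inverse)
  have vprod: "v (prod f I) = (\<Sum>i\<in>I. v (f i))" if "\<And>i. i \<in> I \<Longrightarrow> f i \<in> M" for f and I :: "nat set"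
    using that by (induction I rule: infinite_finite_induct) (auto simp: v1 v mul_group_prod[OF M])
  have K: "mul_group K" using M v1 vdiv by (auto simp: mul_group_def K_def)
  have rank: "\<exists>r'. r = Suc r' \<and> rank_le r' K"
  proof (cases r)
    case 0
    \<comment> \<open>Rank 0 cannot occur: a relation would be a trivial power of \<open>u\<close>,
      whose value is non-zero.\<close>
    have "\<forall>i\<le>r. (\<lambda>_. u) i \<in> M" using u by simp
    then obtain e :: "nat \<Rightarrow> int" where "\<exists>i\<le>r. e i \<noteq> 0" "(\<Prod>i\<le>r. u powi e i) = 1"
      using r[unfolded rank_le_def, rule_format, of "\<lambda>_. u"] by auto
    then have "e 0 \<noteq> 0" "u powi e 0 = 1" using 0 by auto
    then have "e 0 * v u = 0" using vpowi[OF u(1), of "e 0"] v1 by simp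
    then show ?thesis using \<open>e 0 \<noteq> 0\<close> u by simp
  next
    case (Suc r')
    have "rank_le r' K" unfolding rank_le_def
    proof (intro allI impI)
      fix x :: "nat \<Rightarrow> 'a" assume x: "\<forall>i\<le>r'. x i \<in> K"
      then have "\<forall>i\<le>r. (x(r := u)) i \<in> M" using u Suc by (auto simp: K_def)
      then obtain e :: "nat \<Rightarrow> int" where e: "\<exists>i\<le>r. e i \<noteq> 0" "(\<Prod>i\<le>r. (x(r := u)) i powi e i) = 1"
        using r unfolding rank_le_def by blast
      have "(\<Prod>i\<le>r. (x(r := u)) i powi e i) = (\<Prod>i\<le>r'. x i powi e i) * u powi e r" unfolding Suc by simp
      then have rel: "(\<Prod>i\<le>r'. x i powi e i) * u powi e r = 1" using e by simp
      have xM: "x i powi e i \<in> M" if "i \<le> r'" for i using x that by (intro mul_group_powi[OF M]) (auto simp: K_def)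
      have "v (\<Prod>i\<le>r'. x i powi e i) = (\<Sum>i\<le>r'. v (x i powi e i))" by (rule vprod) (use xM in auto)
      also have "\<dots> = 0" using x by (intro sum.neutral) (auto simp: vpowi K_def)
      finally have v0: "v (\<Prod>i\<le>r'. x i powi e i) = 0" .
      have "(\<Prod>i\<le>r'. x i powi e i) \<in> M" by (rule mul_group_prod[OF M]) (use xM in auto)
      from v[OF this mul_group_powi[OF M u(1)]] have "v ((\<Prod>i\<le>r'. x i powi e i) * u powi e r) = e r * v u"
        by (simp add: v0 vpowi[OF u(1)])
      then have "e r = 0" using rel v1 u by simp
      then have "\<exists>i\<le>r'. e i \<noteq> 0" using e(1) Suc by (metis le_SucE)
      then show "\<exists>e::nat \<Rightarrow> int. (\<exists>i\<le>r'. e i \<noteq> 0) \<and> (\<Prod>i\<le>r'. x i powi e i) = 1" using rel \<open>e r = 0\<close> by auto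
    qed
    then show ?thesis using Suc by blast
  qed
  then obtain r' where "r = Suc r'" "rank_le r' K" by (elim exE conjE)
  then have "fg_mul_group K" using IH[of r'] K unfolding K_def by simp
  then obtain F where F: "finite F" "F \<subseteq> K" "\<And>N. mul_group N \<Longrightarrow> F \<subseteq> N \<Longrightarrow> K \<subseteq> N" 
    unfolding fg_mul_group_def by metis
  define Q where "Q = (\<lambda>n. n > 0 \<and> (\<exists>m\<in>M. v m = int n))"
  have "Q (nat \<bar>v u\<bar>)" unfolding Q_def
  proof (intro conjI)
    show "nat \<bar>v u\<bar> > 0" using u by simp
    show "\<exists>m\<in>M. v m = int (nat \<bar>v u\<bar>)"
      by (rule bexI[of _ "u powi sgn (v u)"]) (simp_all add: vpowi u mul_group_powi[OF M] sgn_if)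
  qed
  define n0 where "n0 = (LEAST n. Q n)"
  have "Q n0" unfolding n0_def using \<open>Q (nat \<bar>v u\<bar>)\<close> by (rule LeastI)
  then obtain m0 where m0: "m0 \<in> M" "v m0 = int n0" "n0 > 0" by (auto simp: Q_def)
  have "finite (insert m0 F)" "insert m0 F \<subseteq> M" using F m0 by (auto simp: K_def)
  moreover have "M \<subseteq> N" if N: "mul_group N" "insert m0 F \<subseteq> N" for N
  proof
    fix m assume m: "m \<in> M"
    define q where "q = v m div int n0"
    define m' where "m' = m / m0 powi q"
    have m'M: "m' \<in> M" unfolding m'_def by (intro mul_group_divide[OF M] mul_group_powi[OF M] m m0)
    have vm': "v m' = v m mod int n0"
      using vdiv[OF m mul_group_powi[OF M m0(1)], of q] vpowi[OF m0(1), of q] m0(2)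
      by (simp add: m'_def q_def minus_div_mult_eq_mod)
    have "v m' = 0"
    proof (rule ccontr)
      assume "v m' \<noteq> 0"
      moreover have "v m' \<ge> 0" using vm' m0(3) by simp
      ultimately have "nat (v m') > 0" "v m' = int (nat (v m'))" by simp_all
      then have "Q (nat (v m'))" unfolding Q_def using m'M by blast
      then have "n0 \<le> nat (v m')" unfolding n0_def by (rule Least_le)
      moreover have "v m' < int n0" using vm' m0(3) by simp
      ultimately show False using m0(3) by linarith
    qed
    then have "m' \<in> N" using F(3)[OF N(1)] N(2) m'M by (auto simp: K_def)
    then have "m' * m0 powi q \<in> N" using N by (intro mul_group_mult[OF N(1)] mul_group_powi[OF N(1)]) auto
    then show "m \<in> N" using mul_group_nonzero[OF M m0(1)] by (simp add: m'_def)
  qed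
  ultimately show ?thesis unfolding fg_mul_group_def by (intro exI[of _ "insert m0 F"]) simp
qed

text \<open>Induction on the rank: a transcendental \<open>u\<close> in \<open>M\<close> has
  non-zero value under some discrete valuation, whose kernel in \<open>M\<close> has smaller rank.
  If there is no such \<open>u\<close>, all elements are algebraic of bounded degree.\<close>

theorem fg_mul_group_in_fg_field:
  fixes M :: "complex set"
  assumes F: "finite F" and "mul_group M" "M \<subseteq> gen_field F" "rank_le r M"
  shows "fg_mul_group M"
  using assms(2-)
proof (induction r arbitrary: M rule: less_induct)
  case (less r M)
  show ?case
  proof (cases "\<forall>a\<in>M. algebraic_over (gen_field {}) a")
    case True
    obtain d where d: "\<forall>a\<in>gen_field F. algebraic_over (gen_field {}) a \<longrightarrow> algebraic_deg_le (gen_field {}) d a"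
      using fg_field_algebraic_elements[OF F] by blast
    show ?thesis by (rule fg_mul_group_algebraic[OF less.prems(1,3), of d]) (use d True less.prems in auto)
  next
    case False
    then obtain u where u: "u \<in> M" "\<not> algebraic_over (gen_field {}) u" by blast
    have uF: "u \<in> gen_field F" using u less.prems by auto
    obtain E d where E: "is_subfield E" "\<not> algebraic_over E u" "\<forall>a\<in>gen_field F. algebraic_deg_le (gen_field (insert u E)) d a"
      using fg_field_over_transcendental[OF F u(2) uF] by blast
    have "\<exists>v :: complex \<Rightarrow> int. v u \<noteq> 0 \<and> (\<forall>a\<in>gen_field F - {0}. \<forall>b\<in>gen_field F - {0}. v (a * b) = v a + v b)"
      by (rule discrete_valuation[OF E(1,2)])
        (use E(3) uF subring_mult[OF subfield_subring[OF subfield_fld]] in auto)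
    then obtain v :: "complex \<Rightarrow> int" where v: "v u \<noteq> 0"
      "\<And>a b. a \<in> gen_field F - {0} \<Longrightarrow> b \<in> gen_field F - {0} \<Longrightarrow> v (a * b) = v a + v b" by blast
    have MF: "a \<in> gen_field F - {0}" if "a \<in> M" for a using that less.prems mul_group_nonzero by blast
    show ?thesis
    proof (rule fg_mul_group_kernel[where u = u and v = v and r = r])
      show "mul_group M" "u \<in> M" "v u \<noteq> 0" "rank_le r M" by fact+
      show "v (a * b) = v a + v b" if "a \<in> M" "b \<in> M" for a b using that MF v(2) by blast
      show "fg_mul_group {m \<in> M. v m = 0}"
        if "r = Suc r'" "mul_group {m \<in> M. v m = 0}" "rank_le r' {m \<in> M. v m = 0}" for r'
        by (rule less.IH[of r']) (use that less.prems in auto)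
    qed
  qed
qed

text \<open>A root of unity is a radical of the empty product, so
  \<open>finite_bounded_radicals\<close> with empty index set leaves only finitely many of bounded
  degree.\<close>

lemma roots_of_unity_exponent:
  assumes F: "finite F"
  shows "\<exists>w\<ge>1. \<forall>z\<in>gen_field F. (\<exists>n\<ge>1. z ^ n = (1::complex)) \<longrightarrow> z ^ w = 1"
proof -
  obtain d where d: "\<forall>a\<in>gen_field F. algebraic_over (gen_field {}) a \<longrightarrow> algebraic_deg_le (gen_field {}) d a"
    using fg_field_algebraic_elements[OF F] by blast
  define Z where "Z = {g :: complex. algebraic_deg_le (gen_field {}) d g \<and> (\<exists>n\<ge>1. g ^ n = 1)}"
  have "finite Z" using finite_bounded_radicals[of "{} :: nat set" "\<lambda>_. 1" d] by (simp add: Z_def)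
  have "\<forall>g\<in>Z. \<exists>n\<ge>1. g ^ n = 1" by (auto simp: Z_def)
  then obtain n :: "complex \<Rightarrow> nat" where n: "\<And>g. g \<in> Z \<Longrightarrow> n g \<ge> 1" "\<And>g. g \<in> Z \<Longrightarrow> g ^ n g = 1" by metis
  define w where "w = (\<Prod>g\<in>Z. n g)"
  have "w \<ge> 1" unfolding w_def using n(1) by (intro prod_ge_1) auto
  moreover have "z ^ w = 1" if z: "z \<in> gen_field F" "k \<ge> 1" "z ^ k = 1" for z k
  proof -
    have "algebraic_over (gen_field {}) z" unfolding algebraic_over_altdef
    proof (intro exI[of _ "monom 1 k - 1"] conjI)
      show "monom 1 k - (1 :: complex poly) \<noteq> 0" using z(2)
        by (auto simp: poly_eq_iff intro!: exI[of _ k])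
      show "poly_over (gen_field {}) (monom 1 k - (1 :: complex poly))"
        by (intro poly_over_diff poly_over_monom poly_over_1 subring_1 subfield_subring subfield_fld)
      show "poly (monom 1 k - 1) z = 0" using z by (simp add: poly_monom)
    qed
    then have "z \<in> Z" using z d by (auto simp: Z_def)
    then have "w = n z * (\<Prod>g\<in>Z-{z}. n g)" unfolding w_def using \<open>finite Z\<close> by (simp add: prod.remove)
    then show ?thesis using n(2)[OF \<open>z \<in> Z\<close>] by (simp add: power_mult)
  qed
  ultimately show ?thesis by blast
qed

section \<open>Linear independence of radicals\<close>

text \<open>Artin's argument: \<open>\<sigma>\<close> maps a shortest relation to another one, and their difference is shorter.\<close>
lemma independent_representatives:
  fixes L :: "'a::field set"
  assumes L: "is_subfield L" and \<Gamma>: "mul_group \<Gamma>" and A: "is_subring A" "L \<subseteq> A" "\<Gamma> \<subseteq> A"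
    and step: "\<And>J. finite J \<Longrightarrow> J \<subseteq> \<Gamma> \<Longrightarrow> 1 \<in> J \<Longrightarrow> \<not> J \<subseteq> L \<Longrightarrow>
      \<exists>\<sigma>. hom_on A \<sigma> \<and> (\<forall>x\<in>L. \<sigma> x = x) \<and> (\<forall>m\<in>J. \<exists>\<omega>\<in>L. \<sigma> m = \<omega> * m) \<and> (\<exists>m\<in>J. \<sigma> m \<noteq> (m :: 'a))"
    and "finite J" "J \<subseteq> \<Gamma>" "\<And>x y. x \<in> J \<Longrightarrow> y \<in> J \<Longrightarrow> x \<noteq> y \<Longrightarrow> x / y \<notin> L"
    and "\<And>m. m \<in> J \<Longrightarrow> y m \<in> L" "(\<Sum>m\<in>J. y m * m) = 0"
  shows "\<forall>m\<in>J. y m = 0"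
  using assms(7-)
proof (induction "card J" arbitrary: J y rule: less_induct)
  case less
  note S = subfield_subring[OF L]
  show ?case
  proof (rule ccontr)
    assume "\<not> (\<forall>m\<in>J. y m = 0)"
    then obtain m1 where m1: "m1 \<in> J" "y m1 \<noteq> 0" by blast
    have all: "y m \<noteq> 0" if m: "m \<in> J" for m
    proof
      assume ym: "y m = 0"
      have "card (J - {m}) < card J" using less.prems(1) m by (rule card_Diff1_less)
      moreover have "(\<Sum>m\<in>J - {m}. y m * m) = 0" using less.prems(1,5) m ym by (simp add: sum.remove)
      ultimately have "\<forall>x\<in>J - {m}. y x = 0" using less.prems by (intro less.hyps) auto
      then show False using m1 ym by (metis Diff_iff singletonD)
    qed
    have nz: "m \<noteq> 0" if "m \<in> J" for m using that less.prems(2) mul_group_nonzero[OF \<Gamma>] by blast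
    have "J \<noteq> {m1}" using less.prems(5) m1 nz by auto
    then obtain m2 where m2: "m2 \<in> J" "m2 \<noteq> m1" using m1 by blast
    \<comment> \<open>After division by \<open>m1\<close> the element 1 occurs and is fixed by
      \<open>\<sigma>\<close>, so the term of \<open>m1\<close> disappears from the difference of
      the two relations.\<close>
    let ?K = "(\<lambda>m. m / m1) ` J"
    have K\<Gamma>: "?K \<subseteq> \<Gamma>" using less.prems(2) m1 mul_group_divide[OF \<Gamma>] by blast
    have "1 \<in> ?K" using m1 nz by force
    moreover have "\<not> ?K \<subseteq> L" using less.prems(3)[OF m2(1) m1(1) m2(2)] m2(1) by blast
    ultimately obtain \<sigma> where \<sigma>: "hom_on A \<sigma>" "\<forall>x\<in>L. \<sigma> x = x" "\<forall>m\<in>?K. \<exists>\<omega>\<in>L. \<sigma> m = \<omega> * m" "\<exists>m\<in>?K. \<sigma> m \<noteq> m"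
      using step[of ?K] less.prems(1) K\<Gamma> by blast
    have "\<forall>m\<in>J. \<exists>\<omega>. \<omega> \<in> L \<and> \<sigma> (m / m1) = \<omega> * (m / m1)" using \<sigma>(3) by blast
    then obtain \<omega> where \<omega>: "\<And>m. m \<in> J \<Longrightarrow> \<omega> m \<in> L" "\<And>m. m \<in> J \<Longrightarrow> \<sigma> (m / m1) = \<omega> m * (m / m1)" by metis
    have inA: "y m \<in> A" "m / m1 \<in> A" if "m \<in> J" for m using that less.prems(4) A K\<Gamma> by blast+
    have "(\<Sum>m\<in>J. y m * (m / m1)) = (\<Sum>m\<in>J. y m * m) / m1" by (simp add: sum_divide_distrib)
    then have rel: "(\<Sum>m\<in>J. y m * (m / m1)) = 0" using less.prems(5) by simp
    have "\<sigma> (\<Sum>m\<in>J. y m * (m / m1)) = (\<Sum>m\<in>J. \<sigma> (y m * (m / m1)))"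
      by (rule hom_sum[OF A(1) \<sigma>(1)]) (intro subring_mult[OF A(1)] inA)
    also have "\<dots> = (\<Sum>m\<in>J. y m * (\<omega> m * (m / m1)))"
      by (intro sum.cong refl, subst hom_mult[OF A(1) \<sigma>(1)]) (use \<omega>(2) inA \<sigma>(2) less.prems(4) in auto)
    finally have rel2: "(\<Sum>m\<in>J. y m * (\<omega> m * (m / m1))) = 0" using rel hom_0[OF A(1) \<sigma>(1)] by simp
    define z where "z = (\<lambda>m. y m * (\<omega> m - 1))"
    have "(\<Sum>m\<in>J. z m * m) = m1 * ((\<Sum>m\<in>J. y m * (\<omega> m * (m / m1))) - (\<Sum>m\<in>J. y m * (m / m1)))"
      using nz[OF m1(1)] by (simp add: z_def sum_subtractf[symmetric] sum_distrib_left algebra_simps)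
    then have z0: "(\<Sum>m\<in>J. z m * m) = 0" using rel rel2 by simp
    have "\<omega> m1 = 1" using \<omega>(2)[OF m1(1)] nz[OF m1(1)] hom_1[OF A(1) \<sigma>(1)] by simp
    then have "(\<Sum>m\<in>J - {m1}. z m * m) = 0" using z0 less.prems(1) m1 by (simp add: sum.remove z_def)
    moreover have "card (J - {m1}) < card J" using less.prems(1) m1(1) by (rule card_Diff1_less)
    moreover have "z m \<in> L" if "m \<in> J - {m1}" for m
      unfolding z_def using that less.prems(4) \<omega> by (intro subring_mult[OF S] subring_diff[OF S] subring_1[OF S]) auto
    ultimately have "\<forall>m\<in>J - {m1}. z m = 0" using less.prems(1-3) by (intro less.hyps) auto
    then have "\<omega> m = 1" if "m \<in> J" for m using that all \<open>\<omega> m1 = 1\<close> by (cases "m = m1") (auto simp: z_def)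
    then have "\<sigma> m = m" if "m \<in> ?K" for m using that \<omega>(2) by auto
    then show False using \<sigma>(4) by blast
  qed
qed

text \<open>One representative is chosen in each coset modulo \<open>L\<close>, and the quotients by
  it are absorbed into the coefficients. The premise \<open>step\<close> is the common interface of
  the Kummer and the cyclotomic case, provided by \<open>kummer_step\<close> and
  \<open>cyclotomic_step\<close>.\<close>

lemma independent_cosets:
  fixes L :: "'a::field set" and g c :: "'i \<Rightarrow> 'a"
  assumes L: "is_subfield L" and \<Gamma>: "mul_group \<Gamma>" and A: "is_subring A" "L \<subseteq> A" "\<Gamma> \<subseteq> A"
    and step: "\<And>J. finite J \<Longrightarrow> J \<subseteq> \<Gamma> \<Longrightarrow> 1 \<in> J \<Longrightarrow> \<not> J \<subseteq> L \<Longrightarrow>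
      \<exists>\<sigma>. hom_on A \<sigma> \<and> (\<forall>x\<in>L. \<sigma> x = x) \<and> (\<forall>m\<in>J. \<exists>\<omega>\<in>L. \<sigma> m = \<omega> * m) \<and> (\<exists>m\<in>J. \<sigma> m \<noteq> (m :: 'a))"
    and I: "finite I" and g: "\<And>i. i \<in> I \<Longrightarrow> g i \<in> \<Gamma>" and c: "\<And>i. i \<in> I \<Longrightarrow> c i \<in> L"
    and sum0: "(\<Sum>i\<in>I. c i * g i) = 0" and i0: "i0 \<in> I"
  shows "(\<Sum>i\<in>{i\<in>I. g i / g i0 \<in> L}. c i * g i) = 0"
proof -
  note S = subfield_subring[OF L]
  have nz: "g i \<noteq> 0" if "i \<in> I" for i using g[OF that] mul_group_nonzero[OF \<Gamma>] by blast
  define rep where "rep = (\<lambda>z. SOME x. x \<in> g ` I \<and> z / x \<in> L)"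
  have rep: "rep (g i) \<in> g ` I" "g i / rep (g i) \<in> L" if "i \<in> I" for i
  proof -
    have "rep (g i) \<in> g ` I \<and> g i / rep (g i) \<in> L" unfolding rep_def
      by (rule someI[of _ "g i"]) (use that nz subring_1[OF S] in auto)
    then show "rep (g i) \<in> g ` I" "g i / rep (g i) \<in> L" by auto
  qed
  have rnz: "rep (g i) \<noteq> 0" if "i \<in> I" for i using rep(1)[OF that] nz by force
  have div: "a / c \<in> L" if "a / b \<in> L" "b / c \<in> L" "b \<noteq> 0" for a b c
    using subring_mult[OF S that(1,2)] that(3) by simp
  have swap: "b / a \<in> L" if "a / b \<in> L" for a b
    using subfield_inverse[OF L that] by simp
  have rep_eq: "rep (g i) = rep (g j) \<longleftrightarrow> g i / g j \<in> L" if ij: "i \<in> I" "j \<in> I" for i j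
  proof
    assume "rep (g i) = rep (g j)"
    then show "g i / g j \<in> L" using rep(2)[OF ij(1)] swap[OF rep(2)[OF ij(2)]] rnz[OF ij(2)] div by metis
  next
    assume "g i / g j \<in> L"
    then have "(x \<in> g ` I \<and> g i / x \<in> L) \<longleftrightarrow> (x \<in> g ` I \<and> g j / x \<in> L)" for x
      using div[of "g i" "g j" x] div[of "g j" "g i" x] swap nz ij by blast
    then show "rep (g i) = rep (g j)" unfolding rep_def by simp
  qed
  define J where "J = (\<lambda>i. rep (g i)) ` I"
  define y where "y = (\<lambda>m. \<Sum>i\<in>{i\<in>I. rep (g i) = m}. c i * (g i / m))"
  have yJ: "y m * m = (\<Sum>i\<in>{i\<in>I. rep (g i) = m}. c i * g i)" if "m \<in> J" for m
    using that rnz by (auto simp: y_def sum_distrib_right J_def intro!: sum.cong)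
  have "\<forall>m\<in>J. y m = 0"
  proof (rule independent_representatives[OF L \<Gamma> A step])
    show "finite J" using I by (simp add: J_def)
    show "J \<subseteq> \<Gamma>"
    proof
      fix x assume "x \<in> J"
      then obtain i where "i \<in> I" "x = rep (g i)" by (auto simp: J_def)
      then have "x \<in> g ` I" using rep(1) by simp
      then show "x \<in> \<Gamma>" using g by auto
    qed
    show "x / x' \<notin> L" if xx: "x \<in> J" "x' \<in> J" "x \<noteq> x'" for x x'
    proof
      assume xL: "x / x' \<in> L"
      obtain i j where ij: "i \<in> I" "x = rep (g i)" "j \<in> I" "x' = rep (g j)" using xx by (auto simp: J_def)
      have "g i / x' \<in> L" using div[of "g i" x x'] rep(2)[OF ij(1)] xL rnz[OF ij(1)] ij by simp
      then have "g i / g j \<in> L" using div[of "g i" x' "g j"] swap[OF rep(2)[OF ij(3)]] rnz[OF ij(3)] ij by simp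
      then show False using rep_eq ij xx(3) by simp
    qed
    show "y m \<in> L" if "m \<in> J" for m unfolding y_def
      by (intro subring_sum[OF S] subring_mult[OF S]) (use c rep(2) in auto)
    have "(\<Sum>m\<in>J. y m * m) = (\<Sum>m\<in>J. \<Sum>i\<in>{i\<in>I. rep (g i) = m}. c i * g i)" using yJ by (intro sum.cong) auto
    also have "\<dots> = (\<Sum>i\<in>I. c i * g i)" unfolding J_def by (rule sum.image_gen[OF I, symmetric])
    finally show "(\<Sum>m\<in>J. y m * m) = 0" using sum0 by simp
  qed
  moreover have "rep (g i0) \<in> J" using i0 by (simp add: J_def)
  ultimately have "(\<Sum>i\<in>{i\<in>I. rep (g i) = rep (g i0)}. c i * g i) = 0" using yJ by (metis mult_zero_left)
  moreover have "{i\<in>I. rep (g i) = rep (g i0)} = {i\<in>I. g i / g i0 \<in> L}" using rep_eq i0 by auto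
  ultimately show ?thesis by simp
qed

section \<open>Roots of unity, radicals and their images under embeddings\<close>

definition zeta :: "nat \<Rightarrow> complex" where "zeta N = cis (2 * pi / real N)"

lemma zeta_power: "zeta N ^ k = cis (2 * pi * real k / real N)"
  unfolding zeta_def Complex.DeMoivre by (simp add: field_simps)

lemma root_of_unity_power_zeta:
  assumes "N \<ge> 1" "z ^ N = 1" shows "\<exists>j. z = zeta N ^ j"
proof -
  have "z \<in> (\<lambda>k. cis (2 * pi * real k / real N)) ` {..<N}"
    using bij_betw_imp_surj_on[OF Complex.bij_betw_roots_unity[of N]] assms by auto
  then show ?thesis by (auto simp: zeta_power)
qed

lemma zeta_power_self: "N \<ge> 1 \<Longrightarrow> zeta N ^ N = 1"
  by (simp add: zeta_power)

lemma zeta_power_eq_1: 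
  assumes "N \<ge> 1" shows "zeta N ^ k = 1 \<longleftrightarrow> N dvd k"
proof
  assume "N dvd k"
  then show "zeta N ^ k = 1" using zeta_power_self[OF assms] by (auto simp: power_mult)
next
  assume k: "zeta N ^ k = 1"
  have "zeta N ^ k = zeta N ^ (N * (k div N) + k mod N)" by simp
  also have "\<dots> = zeta N ^ (k mod N)" unfolding power_add power_mult zeta_power_self[OF assms] by simp
  finally have "cis (2 * pi * real (k mod N) / real N) = cis (2 * pi * real 0 / real N)" using k by (simp add: zeta_power)
  moreover have "inj_on (\<lambda>k. cis (2 * pi * real k / real N)) {..<N}"
    using bij_betw_imp_inj_on[OF Complex.bij_betw_roots_unity[of N]] assms by simp
  ultimately have "k mod N = 0" using assms by (elim inj_onD) auto
  then show "N dvd k" by auto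
qed

lemma zeta_nonzero: "zeta N \<noteq> 0"
  by (simp add: zeta_def)

definition roots_of_unity :: "complex set" where
  "roots_of_unity = {z. \<exists>n\<ge>1. z ^ n = 1}"

lemma mul_group_roots_of_unity: "mul_group roots_of_unity"
  unfolding mul_group_def
proof (intro conjI ballI)
  show "1 \<in> roots_of_unity" "0 \<notin> roots_of_unity" by (auto simp: roots_of_unity_def power_0_left)
  fix x y assume "x \<in> roots_of_unity" "y \<in> roots_of_unity"
  then obtain m n where "m \<ge> 1" "n \<ge> 1" "x ^ m = 1" "y ^ n = 1" by (auto simp: roots_of_unity_def)
  moreover have "(x / y) ^ (m * n) = (x ^ m) ^ n / (y ^ n) ^ m"
    unfolding power_divide power_mult[symmetric] by (simp add: mult.commute)
  ultimately have "(x / y) ^ (m * n) = 1" "m * n \<ge> 1" by simp_all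
  then show "x / y \<in> roots_of_unity" unfolding roots_of_unity_def by blast
qed

lemma radical_alg:
  assumes L: "is_subfield L" and "n \<ge> 1" "z ^ n \<in> L" shows "algebraic_over L z"
  unfolding algebraic_over_altdef
proof (intro exI[of _ "monom 1 n - [:z ^ n:]"] conjI)
  note S = subfield_subring[OF L]
  have "coeff (monom 1 n - [:z ^ n:]) n = 1" using assms(2) by (cases n) auto
  then show "monom 1 n - [:z ^ n:] \<noteq> 0" by (metis coeff_0 zero_neq_one)
  show "poly_over L (monom 1 n - [:z ^ n:])"
    using assms by (intro poly_over_diff[OF S] poly_over_monom[OF S]) (auto simp: S subring_1[OF S])
  show "poly (monom 1 n - [:z ^ n:]) z = 0" by (simp add: poly_monom)
qed

lemma roots_of_unity_alg: "is_subfield L \<Longrightarrow> z \<in> roots_of_unity \<Longrightarrow> algebraic_over L z"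
  using radical_alg[of L _ z] subring_1[OF subfield_subring, of L] by (auto simp: roots_of_unity_def)

context
  fixes L :: "complex set" and \<sigma>
  assumes L: "is_subfield L" and \<sigma>: "embedding L \<sigma>"
begin

lemma emb_hom: "hom_on {z. algebraic_over L z} \<sigma>" using \<sigma> by (simp add: embedding_def)

lemma emb_fixes: "x \<in> L \<Longrightarrow> \<sigma> x = x" using \<sigma> by (simp add: embedding_def)

lemma emb_mult: "algebraic_over L x \<Longrightarrow> algebraic_over L y \<Longrightarrow> \<sigma> (x * y) = \<sigma> x * \<sigma> y"
  using hom_mult[OF embedding_subring[OF L] emb_hom] by simp

lemma emb_diff: "algebraic_over L x \<Longrightarrow> algebraic_over L y \<Longrightarrow> \<sigma> (x - y) = \<sigma> x - \<sigma> y"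
  using hom_diff[OF embedding_subring[OF L] emb_hom] by simp

lemma emb_power: "algebraic_over L x \<Longrightarrow> \<sigma> (x ^ n) = \<sigma> x ^ n"
  using hom_power[OF embedding_subring[OF L] emb_hom] by simp

lemma emb_0: "\<sigma> 0 = 0" and emb_1: "\<sigma> 1 = 1"
  using hom_0[OF embedding_subring[OF L] emb_hom] hom_1[OF embedding_subring[OF L] emb_hom] by auto

lemma emb_inverse: "algebraic_over L x \<Longrightarrow> \<sigma> (inverse x) = inverse (\<sigma> x)"
proof (cases "x = 0")
  case False
  assume x: "algebraic_over L x"
  then have "algebraic_over L (inverse x)" using subfield_inverse[OF subfield_alg[OF L]] by simp
  from emb_mult[OF x this] False have "\<sigma> x * \<sigma> (inverse x) = 1" by (simp add: emb_1)
  then show ?thesis by (metis inverse_unique)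
qed (simp add: emb_0)

text \<open>The \<open>N\<close>-th roots of unity are the powers of \<open>zeta N\<close>, so a
  single exponent describes \<open>\<sigma>\<close> on all of them.\<close>

lemma emb_unity: 
  assumes "N \<ge> 1" shows "\<exists>t\<ge>1. \<forall>z. z ^ N = 1 \<longrightarrow> \<sigma> z = z ^ t"
proof -
  have za: "algebraic_over L z" if "z ^ N = 1" for z
    using that assms by (intro roots_of_unity_alg[OF L]) (auto simp: roots_of_unity_def)
  have zn: "zeta N ^ N = 1" by (rule zeta_power_self[OF assms])
  then have "\<sigma> (zeta N) ^ N = 1" using emb_power[OF za[OF zn], of N] emb_1 by simp
  then obtain t where t: "\<sigma> (zeta N) = zeta N ^ t" using root_of_unity_power_zeta[OF assms] by blast
  \<comment> \<open>Adding \<open>N\<close> leaves the power unchanged and makes the exponent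
    positive, so that \<open>t - 1\<close> can be formed later.\<close>
  have "\<sigma> z = z ^ (t + N)" if z: "z ^ N = 1" for z
  proof -
    obtain j where j: "z = zeta N ^ j" using root_of_unity_power_zeta[OF assms z] by blast
    have "\<sigma> z = zeta N ^ (t * j)" unfolding j by (simp add: emb_power[OF za[OF zn]] t power_mult)
    also have "\<dots> = z ^ t" by (simp add: j power_mult[symmetric] mult.commute)
    finally show ?thesis using z by (simp add: power_add)
  qed
  then show ?thesis using assms by (intro exI[of _ "t + N"]) auto
qed

lemma emb_radical:
  assumes "n \<ge> 1" "g ^ n \<in> L" shows "\<exists>\<omega>. \<omega> ^ n = 1 \<and> \<sigma> g = \<omega> * g"
proof (cases "g = 0")
  case True then show ?thesis by (intro exI[of _ 1]) (simp add: emb_0)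
next
  case False
  have "\<sigma> g ^ n = g ^ n" using emb_power[OF radical_alg[OF L assms], of n] emb_fixes[OF assms(2)] by simp
  then have "(\<sigma> g / g) ^ n = 1" using False by (simp add: power_divide)
  then show ?thesis using False by (intro exI[of _ "\<sigma> g / g"]) simp
qed

end

text \<open>Any embedding that moves an element of \<open>J\<close> will do: the factor by which it
  scales a radical is a root of unity, and \<open>L\<close> contains all of these.\<close>

lemma kummer_step:
  assumes L: "is_subfield L" "roots_of_unity \<subseteq> L" and rad: "\<And>g. g \<in> \<Gamma> \<Longrightarrow> \<exists>n\<ge>1. g ^ n \<in> L"
    and J: "J \<subseteq> \<Gamma>" "\<not> J \<subseteq> L"
  shows "\<exists>\<sigma>. hom_on {z. algebraic_over L z} \<sigma> \<and> (\<forall>x\<in>L. \<sigma> x = x) \<and> (\<forall>m\<in>J. \<exists>\<omega>\<in>L. \<sigma> m = \<omega> * m) \<and> (\<exists>m\<in>J. \<sigma> m \<noteq> m)"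
proof -
  obtain z where z: "z \<in> J" "z \<notin> L" using J by blast
  then have "algebraic_over L z" using rad[of z] J radical_alg[OF L(1)] by blast
  then obtain \<sigma> where \<sigma>: "embedding L \<sigma>" "\<sigma> z \<noteq> z" using embedding_moves[OF L(1) _ z(2)] by blast
  have "\<exists>\<omega>\<in>L. \<sigma> m = \<omega> * m" if m: "m \<in> J" for m
  proof -
    obtain n where n: "n \<ge> 1" "m ^ n \<in> L" using rad[OF subsetD[OF J(1) m]] by blast
    obtain \<omega> where "\<omega> ^ n = 1" "\<sigma> m = \<omega> * m" using emb_radical[OF L(1) \<sigma>(1) n] by blast
    moreover have "\<omega> \<in> L" using \<open>\<omega> ^ n = 1\<close> n L(2) by (auto simp: roots_of_unity_def)
    ultimately show ?thesis by blast
  qed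
  then show ?thesis using \<sigma> z by (intro exI[of _ \<sigma>]) (auto simp: embedding_def)
qed

lemma geometric_int: "(a - 1) * (\<Sum>i<n. a ^ i) = a ^ n - (1::int)"
  by (simp add: power_diff_1_eq)

lemma geometric_int_cong:
  assumes "m dvd a - (1::int)" shows "m dvd (\<Sum>i<n. a ^ i) - int n"
proof -
  have "m dvd a ^ i - 1" for i using assms geometric_int[of a i] by (metis dvd_mult2)
  then have "m dvd (\<Sum>i<n. a ^ i - 1)" by (intro dvd_sum) auto
  then show ?thesis by (simp add: sum_subtractf)
qed

text \<open>The power \<open>\<sigma>\<close> of an embedding is chosen so that it acts on \<open>J\<close> by \<open>z \<mapsto> z ^ t\<close> with \<open>t ^ Q\<close> trivial
  but \<open>t\<close> nontrivial on \<open>J\<close>; as \<open>t \<equiv> 1\<close> modulo \<open>Q\<^sup>2\<close>, the factors \<open>z ^ (t - 1)\<close> are \<open>Q\<close>-th roots of unity.\<close>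
lemma cyclotomic_step:
  assumes L: "is_subfield L" "zeta (Q ^ 2) \<in> L" and Q: "Q \<ge> 1"
    and J: "finite J" "\<And>z. z \<in> J \<Longrightarrow> \<exists>s. z ^ (Q ^ s) = 1" "\<not> J \<subseteq> L"
  shows "\<exists>\<sigma>. hom_on {z. algebraic_over L z} \<sigma> \<and> (\<forall>x\<in>L. \<sigma> x = x) \<and> (\<forall>m\<in>J. \<exists>\<omega>\<in>L. \<sigma> m = \<omega> * m) \<and> (\<exists>m\<in>J. \<sigma> m \<noteq> m)"
proof -
  note S = subfield_subring[OF L(1)]
  obtain s where s: "\<And>z. z \<in> J \<Longrightarrow> z ^ (Q ^ s z) = 1" using J(2) by metis
  \<comment> \<open>The summand 2 makes \<open>Q ^ 2\<close> divide \<open>N\<close>, so that the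
    exponent \<open>t\<close> also describes the action on \<open>zeta (Q ^ 2)\<close>.\<close>
  define M where "M = (\<Sum>z\<in>J. s z) + 2"
  define N where "N = Q ^ M"
  have N1: "N \<ge> 1" using Q by (simp add: N_def)
  have JN: "z ^ N = 1" if "z \<in> J" for z
  proof -
    have "s z \<le> M" using member_le_sum[of z J s] that J(1) by (simp add: M_def)
    then have "N = Q ^ s z * Q ^ (M - s z)" by (simp add: N_def power_add[symmetric])
    then show ?thesis using s[OF that] by (simp add: power_mult)
  qed
  have J0: "z \<noteq> 0" if "z \<in> J" for z using JN[OF that] N1 by (auto simp: power_0_left)
  have Jalg: "algebraic_over L z" if "z \<in> J" for z
    using JN[OF that] N1 by (intro roots_of_unity_alg[OF L(1)]) (auto simp: roots_of_unity_def)
  obtain z0 where z0: "z0 \<in> J" "z0 \<notin> L" using J(3) by blast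
  obtain \<tau> where \<tau>: "embedding L \<tau>" "\<tau> z0 \<noteq> z0" using embedding_moves[OF L(1) Jalg[OF z0(1)] z0(2)] by blast
  obtain t where t: "t \<ge> 1" "\<And>z. z ^ N = 1 \<Longrightarrow> \<tau> z = z ^ t" using emb_unity[OF L(1) \<tau>(1) N1] by blast
  have tQ: "int (Q ^ 2) dvd int t - 1"
  proof -
    define K where "K = Q ^ (M - 2)"
    have NK: "Q ^ 2 * K = N" by (simp add: N_def K_def power_add[symmetric] M_def)
    have Q2: "Q ^ 2 \<ge> 1" using Q by simp
    have "\<tau> (zeta (Q ^ 2)) = zeta (Q ^ 2) ^ t"
    proof (rule t(2))
      show "zeta (Q ^ 2) ^ N = 1" unfolding NK[symmetric] power_mult zeta_power_self[OF Q2] by simp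
    qed
    then have "zeta (Q ^ 2) * zeta (Q ^ 2) ^ (t - 1) = zeta (Q ^ 2)" using emb_fixes[OF L(1) \<tau>(1) L(2)] t(1)
      by (cases t) auto
    then have "zeta (Q ^ 2) ^ (t - 1) = 1" using zeta_nonzero by simp
    then have "Q ^ 2 dvd t - 1" using zeta_power_eq_1[OF Q2] by blast
    then have "int (Q ^ 2) dvd int (t - 1)" by (rule of_nat_dvd_iff[THEN iffD2])
    then show ?thesis using t(1) by (simp add: of_nat_diff)
  qed
  define E where "E = (\<lambda>e. e \<ge> 1 \<and> (\<forall>z\<in>J. z ^ e = 1))"
  \<comment> \<open>\<open>e\<close> is the exponent of the group generated by \<open>J\<close>;
    congruences modulo \<open>e\<close> decide how powers act on \<open>J\<close>.\<close>
  define e where "e = (LEAST e. E e)"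
  have "E N" using N1 JN by (simp add: E_def)
  then have "E e" unfolding e_def by (rule LeastI)
  then have e: "e \<ge> 1" "\<And>z. z \<in> J \<Longrightarrow> z ^ e = 1" by (auto simp: E_def)
  have edvd: "int e dvd k \<longleftrightarrow> (\<forall>z\<in>J. z powi k = 1)" for k
  proof
    assume "int e dvd k"
    then obtain l where "k = int e * l" by blast
    then show "\<forall>z\<in>J. z powi k = 1" using e(2) by (simp add: power_int_mult)
  next
    assume k: "\<forall>z\<in>J. z powi k = 1"
    define r where "r = nat (k mod int e)"
    have rk: "int r = k mod int e" using e(1) by (simp add: r_def)
    have "z ^ r = 1" if "z \<in> J" for z
    proof -
      have "z powi k = z powi (int e * (k div int e) + int r)" using rk by simp
      also have "\<dots> = (z ^ e) powi (k div int e) * z ^ r"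
        using J0[OF that] by (subst power_int_add) (auto simp: power_int_mult)
      finally show ?thesis using k that e(2)[OF that] by simp
    qed
    then have "r \<ge> 1 \<Longrightarrow> E r" by (simp add: E_def)
    then have "r \<ge> 1 \<Longrightarrow> e \<le> r" unfolding e_def by (rule Least_le)
    moreover have "int r < int e" unfolding rk using e(1) by simp
    ultimately have "r = 0" by linarith
    then show "int e dvd k" using rk by auto
  qed
  have eN: "int e dvd int Q ^ M" using edvd[of "int N"] JN unfolding N_def by (simp flip: of_nat_power)
  \<comment> \<open>Each further \<open>Q\<close>-th power of \<open>t\<close> gains a factor
    \<open>Q\<close>: the geometric sum has \<open>Q\<close> terms, all congruent to 1 modulo
    \<open>Q\<close>.\<close>
  have Qj: "int Q ^ Suc j dvd int t ^ (Q ^ j) - 1" for j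
  proof (induction j)
    case 0
    have "int Q dvd int t - 1" using tQ by (metis dvd_trans dvd_triv_left of_nat_mult power2_eq_square)
    then show ?case by simp
  next
    case (Suc j)
    let ?a = "int t ^ (Q ^ j)"
    have "int Q dvd int Q ^ Suc j" by simp
    then have "int Q dvd ?a - 1" using Suc by (rule dvd_trans)
    then have "int Q dvd (\<Sum>i<Q. ?a ^ i) - int Q" by (rule geometric_int_cong)
    then have "int Q dvd ((\<Sum>i<Q. ?a ^ i) - int Q) + int Q" by (rule dvd_add) simp
    then have "int Q dvd (\<Sum>i<Q. ?a ^ i)" by simp
    with Suc have "int Q ^ Suc j * int Q dvd (?a - 1) * (\<Sum>i<Q. ?a ^ i)" by (rule mult_dvd_mono)
    then show ?case unfolding geometric_int by (simp add: power_mult[symmetric] mult_ac)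
  qed
  define B where "B = (\<lambda>j. int e dvd int t ^ (Q ^ j) - 1)"
  have BM: "B M" unfolding B_def using eN Qj[of M] by (metis dvd_trans dvd_triv_right power_Suc)
  have nB0: "\<not> B 0"
  proof
    assume "B 0"
    then have "z0 powi (int t - 1) = 1" using edvd z0 by (simp add: B_def)
    then have "z0 ^ t = z0" using J0[OF z0(1)] by (simp add: power_int_diff)
    then show False using \<tau>(2) t(2)[OF JN[OF z0(1)]] by simp
  qed
  \<comment> \<open>Iterated \<open>Q ^ j\<close> times, the embedding still moves some element of
    \<open>J\<close>, whereas \<open>Q ^ Suc j\<close> iterations act trivially on
    \<open>J\<close>.\<close>
  obtain j where j: "\<not> B j" "B (Suc j)" using BM nB0 by (induction M) auto
  define t' where "t' = t ^ (Q ^ j)"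
  define \<sigma> where "\<sigma> = \<tau> ^^ (Q ^ j)"
  have pw: "(\<tau> ^^ k) z = z ^ (t ^ k)" if "z ^ N = 1" for z k
  proof (induction k)
    case (Suc k)
    have "(z ^ (t ^ k)) ^ N = 1" using that by (metis power_commutes power_mult mult.commute power_one)
    then show ?case using Suc t(2) by (simp add: power_mult[symmetric] mult.commute)
  qed auto
  have hom: "hom_on {z. algebraic_over L z} (\<tau> ^^ k) \<and> (\<forall>z\<in>{z. algebraic_over L z}. (\<tau> ^^ k) z \<in> {z. algebraic_over L z}) \<and> (\<forall>x\<in>L. (\<tau> ^^ k) x = x)" for k
  proof (induction k)
    case (Suc k)
    then show ?case using embedding_into_alg[OF L(1) \<tau>(1)] emb_1[OF L(1) \<tau>(1)] emb_diff[OF L(1) \<tau>(1)]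
      emb_mult[OF L(1) \<tau>(1)] emb_fixes[OF L(1) \<tau>(1)] by (simp add: hom_on_def)
  qed (auto simp: hom_on_def)
  have \<sigma>z: "\<sigma> z = z powi (int t' - 1) * z" if "z \<in> J" for z
    using pw[OF JN[OF that], of "Q ^ j"] J0[OF that] 
    by (simp add: \<sigma>_def t'_def power_int_diff flip: of_nat_power)
  have t'1: "int (Q ^ 2) dvd int t' - 1"
    using tQ geometric_int[of "int t" "Q ^ j"] by (metis dvd_mult2 of_nat_power t'_def)
  \<comment> \<open>Here the square is needed: as \<open>t'\<close> is 1 modulo
    \<open>Q ^ 2\<close>, the geometric sum equals \<open>Q * (1 + Q * x)\<close>, and
    \<open>1 + Q * x\<close> is coprime to \<open>e\<close>, which divides a power of
    \<open>Q\<close>. So only the factor \<open>Q\<close> remains.\<close>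
  have "int e dvd int Q * (int t' - 1)"
  proof -
    let ?S = "\<Sum>i<Q. int t' ^ i"
    obtain x where x: "?S - int Q = int (Q ^ 2) * x" using geometric_int_cong[OF t'1, of Q] by (elim dvdE)
    have "?S = int Q * (1 + int Q * x)" using x by (simp add: power2_eq_square algebra_simps)
    moreover have "int e dvd (int t' - 1) * ?S"
      unfolding geometric_int using j(2) by (simp add: B_def t'_def power_mult[symmetric] mult.commute)
    ultimately have d: "int e dvd (int Q * (int t' - 1)) * (1 + int Q * x)" by (simp add: mult_ac)
    have "coprime (int Q) (1 + int Q * x)" 
      using gcd_add_mult[of "int Q" x 1] by (simp add: coprime_iff_gcd_eq_1 add.commute mult.commute)
    then have "coprime (int Q ^ M) (1 + int Q * x)" by simp
    then have "coprime (int e) (1 + int Q * x)" using eN by (rule coprime_divisors[OF _ dvd_refl, rotated])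
    then show ?thesis using d by (simp add: coprime_dvd_mult_left_iff)
  qed
  then have \<omega>Q: "(z powi (int t' - 1)) ^ Q = 1" if "z \<in> J" for z
    using edvd that by (metis power_int_mult power_int_of_nat mult.commute)
  have QL: "\<omega> \<in> L" if \<omega>: "\<omega> ^ Q = 1" for \<omega>
  proof -
    have "\<omega> ^ (Q ^ 2) = 1" using \<omega> by (simp add: power2_eq_square power_mult)
    moreover have "Q ^ 2 \<ge> 1" using Q by simp
    ultimately obtain i where "\<omega> = zeta (Q ^ 2) ^ i" using root_of_unity_power_zeta by blast
    then show ?thesis using L(2) subring_power[OF S] by simp
  qed
  have "\<exists>m\<in>J. \<sigma> m \<noteq> m"
  proof -
    have "\<not> int e dvd int t' - 1" using j(1) by (simp add: B_def t'_def)
    then obtain z where "z \<in> J" "z powi (int t' - 1) \<noteq> 1" using edvd by blast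
    then show ?thesis using \<sigma>z[of z] J0[of z] by (intro bexI[of _ z]) auto
  qed
  moreover have "\<forall>m\<in>J. \<exists>\<omega>\<in>L. \<sigma> m = \<omega> * m" using \<sigma>z \<omega>Q QL by blast
  ultimately show ?thesis using hom[of "Q ^ j"] unfolding \<sigma>_def by blast
qed

text \<open>Schinzel's theorem on abelian binomials: if \<open>\<sigma>\<close> acts on the \<open>n\<close>-th roots of unity by \<open>z \<mapsto> z ^ t\<close>, then
  \<open>\<sigma> g / g ^ t\<close> is fixed by every embedding \<open>\<tau>\<close>, because \<open>\<tau>\<close> commutes with \<open>\<sigma>\<close> on \<open>g\<close>.\<close>
lemma schinzel:
  assumes L: "is_subfield L" and w: "w \<ge> 1" "\<And>z. z \<in> L \<Longrightarrow> z \<in> roots_of_unity \<Longrightarrow> z ^ w = 1"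
    and g: "g \<noteq> 0" "n \<ge> 1" "g ^ n \<in> L" "g \<in> gen_field (L \<union> roots_of_unity)"
  shows "\<exists>z\<in>roots_of_unity. \<exists>l\<in>L. g ^ w = z * l"
proof -
  note S = subfield_subring[OF L]
  note R = mul_group_roots_of_unity
  define K where "K = gen_field (L \<union> roots_of_unity)"
  have K: "is_subfield K" by (simp add: K_def subfield_fld)
  have galg: "algebraic_over L g" using radical_alg[OF L g(2,3)] .
  note A = subfield_alg[OF L]
  have Kalg: "algebraic_over L z" if "z \<in> K" for z
  proof -
    have "K \<subseteq> {z. algebraic_over L z}" unfolding K_def
      by (rule gen_field_least[OF A]) (use roots_of_unity_alg[OF L] algebraic_over_self[OF L] in auto)
    then show ?thesis using that by blast
  qed
  \<comment> \<open>Cyclotomic extensions are abelian: embeddings act on roots of unity by powers,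
    which commute, and the elements on which two embeddings commute form a field.\<close>
  have commute: "\<sigma> (\<tau> z) = \<tau> (\<sigma> z)" if e: "embedding L \<sigma>" "embedding L \<tau>" and z: "z \<in> K" for \<sigma> \<tau> z
  proof -
    define C where "C = {z. algebraic_over L z \<and> \<sigma> (\<tau> z) = \<tau> (\<sigma> z)}"
    have "is_subfield C" unfolding is_subfield_def
    proof (intro conjI ballI)
      show "0 \<in> C" "1 \<in> C" using e A 
        by (auto simp: C_def emb_0[OF L] emb_1[OF L] is_subfield_def)
      fix x y assume xy: "x \<in> C" "y \<in> C"
      then have a: "algebraic_over L x" "algebraic_over L y" by (auto simp: C_def)
      then have "algebraic_over L (\<sigma> x)" "algebraic_over L (\<sigma> y)" "algebraic_over L (\<tau> x)" "algebraic_over L (\<tau> y)" "algebraic_over L (x - y)" "algebraic_over L (x * y)" "algebraic_over L (inverse x)"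
        using embedding_into_alg[OF L] e A by (auto simp: is_subfield_def)
      then show "x - y \<in> C" "x * y \<in> C" "inverse x \<in> C" using xy a e 
        by (auto simp: C_def emb_diff[OF L] emb_mult[OF L] emb_inverse[OF L])
    qed
    moreover have "L \<union> roots_of_unity \<subseteq> C"
    proof
      fix x assume "x \<in> L \<union> roots_of_unity"
      then show "x \<in> C"
      proof
        assume "x \<in> L" then show ?thesis using e by (simp add: C_def emb_fixes[OF L] algebraic_over_self[OF L])
      next
        assume x: "x \<in> roots_of_unity"
        then obtain N where N: "N \<ge> 1" "x ^ N = 1" by (auto simp: roots_of_unity_def)
        obtain a where a: "\<And>z. z ^ N = 1 \<Longrightarrow> \<sigma> z = z ^ a" using emb_unity[OF L e(1) N(1)] by blast
        obtain b where b: "\<And>z. z ^ N = 1 \<Longrightarrow> \<tau> z = z ^ b" using emb_unity[OF L e(2) N(1)] by blast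
        have xk: "(x ^ k) ^ N = 1" for k using N by (metis power_mult mult.commute power_one)
        have "\<sigma> (\<tau> x) = \<tau> (\<sigma> x)" using a[OF xk] b[OF xk] a[OF N(2)] b[OF N(2)]
          by (simp add: power_mult[symmetric] mult.commute)
        then show ?thesis using roots_of_unity_alg[OF L x] by (simp add: C_def)
      qed
    qed
    ultimately have "K \<subseteq> C" unfolding K_def by (rule gen_field_least)
    then show ?thesis using z by (auto simp: C_def)
  qed
  have fixed: "z \<in> L" if z: "algebraic_over L z" "\<And>\<tau>. embedding L \<tau> \<Longrightarrow> \<tau> z = z" for z
    using embedding_moves[OF L z(1)] z(2) by blast
  \<comment> \<open>An ideal of the integers: the exponents for which the power of \<open>g\<close>
    is a root of unity times an element of \<open>L\<close>. Its positive generator is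
    \<open>d\<close>, and the goal is \<open>w\<close> in \<open>I\<close>.\<close>
  define I where "I = {x::int. \<exists>z\<in>roots_of_unity. \<exists>l\<in>L. l \<noteq> 0 \<and> g powi x = z * l}"
  have I_diff: "x - y \<in> I" if xy: "x \<in> I" "y \<in> I" for x y
  proof -
    obtain z l z' l' where *: "z \<in> roots_of_unity" "l \<in> L" "l \<noteq> 0" "g powi x = z * l" "z' \<in> roots_of_unity" "l' \<in> L" "l' \<noteq> 0" "g powi y = z' * l'"
      using xy by (auto simp: I_def)
    have "g powi (x - y) = (z / z') * (l / l')" using g(1) * by (simp add: power_int_diff)
    moreover have "z / z' \<in> roots_of_unity" "l / l' \<in> L" using * mul_group_divide[OF R] subfield_divide[OF L] by auto
    ultimately show ?thesis unfolding I_def using * by (intro CollectI bexI[of _ "z / z'"] bexI[of _ "l / l'"]) auto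
  qed
  have nI: "int n \<in> I" unfolding I_def using g mul_group_1[OF R]
    by (intro CollectI bexI[of _ 1] bexI[of _ "g ^ n"]) auto
  have I0: "0 \<in> I" using I_diff[OF nI nI] by simp
  have I_neg: "- x \<in> I" if "x \<in> I" for x using I_diff[OF I0 that] by simp
  have I_add: "x + y \<in> I" if "x \<in> I" "y \<in> I" for x y using I_diff[OF that(1) I_neg[OF that(2)]] by simp
  have I_mult: "x * y \<in> I" if "x \<in> I" for x y
  proof -
    have nn: "x * int k \<in> I" for k by (induction k) (auto simp: I0 I_add that algebra_simps)
    show ?thesis using nn[of "nat y"] I_neg[OF nn[of "nat (-y)"]] by (cases "y \<ge> 0") auto
  qed
  define D where "D = (\<lambda>d. d \<ge> 1 \<and> int d \<in> I)"
  define d where "d = (LEAST d. D d)"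
  have "D n" using nI g by (simp add: D_def)
  then have "D d" unfolding d_def by (rule LeastI)
  then have d1: "d \<ge> 1" and dI: "int d \<in> I" by (auto simp: D_def)
  have d_dvd: "int d dvd x" if "x \<in> I" for x
  proof -
    have "x mod int d = x - int d * (x div int d)" by (simp add: minus_mult_div_eq_mod)
    then have "x mod int d \<in> I" using I_diff[OF that I_mult[OF dI]] by simp
    then have "nat (x mod int d) \<ge> 1 \<Longrightarrow> D (nat (x mod int d))" using d1 by (simp add: D_def)
    then have "nat (x mod int d) \<ge> 1 \<Longrightarrow> d \<le> nat (x mod int d)" unfolding d_def by (rule Least_le)
    moreover have "x mod int d < int d" "x mod int d \<ge> 0" using d1 by auto
    ultimately have "x mod int d = 0" by linarith
    then show ?thesis by auto
  qed
  \<comment> \<open>\<open>\<sigma> g\<close> is a root of unity times \<open>g\<close>, so once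
    \<open>\<sigma> g / g ^ t\<close> is known to lie in \<open>L\<close>, the exponent
    \<open>t - 1\<close> belongs to \<open>I\<close>.\<close>
  have tI: "int t - 1 \<in> I" if \<sigma>: "embedding L \<sigma>" and t: "\<And>z. z ^ n = 1 \<Longrightarrow> \<sigma> z = z ^ t" for \<sigma> t
  proof -
    define y where "y = \<sigma> g / g ^ t"
    obtain \<omega> where \<omega>: "\<omega> ^ n = 1" "\<sigma> g = \<omega> * g" using emb_radical[OF L \<sigma> g(2,3)] by blast
    have \<omega>R: "z \<in> roots_of_unity" if "z ^ n = 1" for z using that g(2) by (auto simp: roots_of_unity_def)
    have \<sigma>galg: "algebraic_over L (\<sigma> g)" using embedding_into_alg[OF L \<sigma> galg] .
    have gta: "algebraic_over L (g ^ t)" using subring_power[OF subfield_subring[OF A]] galg by simp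
    have igta: "algebraic_over L (inverse (g ^ t))" using subfield_inverse[OF A] gta by simp
    have ya: "algebraic_over L y" unfolding y_def using subfield_divide[OF A] \<sigma>galg gta by simp
    have "\<tau> y = y" if \<tau>: "embedding L \<tau>" for \<tau>
    proof -
      obtain \<omega>' where \<omega>': "\<omega>' ^ n = 1" "\<tau> g = \<omega>' * g" using emb_radical[OF L \<tau> g(2,3)] by blast
      have "\<tau> (\<sigma> g) = \<sigma> (\<tau> g)" using commute[OF \<sigma> \<tau>] g(4) by (simp add: K_def)
      also have "\<dots> = \<omega>' ^ t * \<sigma> g" unfolding \<omega>'(2)
        using emb_mult[OF L \<sigma> roots_of_unity_alg[OF L \<omega>R[OF \<omega>'(1)]] galg] t[OF \<omega>'(1)] by simp
      finally have 1: "\<tau> (\<sigma> g) = \<omega>' ^ t * \<sigma> g" .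
      have 2: "\<tau> (g ^ t) = \<omega>' ^ t * g ^ t" using emb_power[OF L \<tau> galg] \<omega>' by (simp add: power_mult_distrib)
      have "\<omega>' \<noteq> 0" using \<omega>'(1) g(2) by (auto simp: power_0_left)
      have "\<tau> y = \<tau> (\<sigma> g) * inverse (\<tau> (g ^ t))" unfolding y_def divide_inverse
        using emb_mult[OF L \<tau> \<sigma>galg igta] emb_inverse[OF L \<tau> gta] by simp
      also have "\<dots> = y" unfolding 1 2 y_def using \<open>\<omega>' \<noteq> 0\<close> by (simp add: field_simps)
      finally show ?thesis .
    qed
    then have yL: "y \<in> L" using fixed[OF ya] by blast
    have "\<omega> \<noteq> 0" using \<omega>(1) g(2) by (auto simp: power_0_left)
    then have y0: "y \<noteq> 0" using g(1) \<omega>(2) by (simp add: y_def)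
    have "g powi (int t - 1) = \<omega> * inverse y" using g(1) \<omega>(2) \<open>\<omega> \<noteq> 0\<close> by (simp add: power_int_diff y_def)
    then show ?thesis unfolding I_def using yL y0 \<omega>R[OF \<omega>(1)] subfield_inverse[OF L yL]
      by (intro CollectI bexI[of _ \<omega>] bexI[of _ "inverse y"]) auto
  qed
  have "int d dvd int n" using d_dvd[OF nI] .
  then obtain k where k: "n = d * k" by auto
  \<comment> \<open>Every embedding acts on \<open>zeta d\<close> by an exponent \<open>t\<close>
    with \<open>d\<close> dividing \<open>t - 1\<close>, hence trivially. So \<open>L\<close>
    contains a primitive \<open>d\<close>-th root of unity, and the choice of \<open>w\<close> makes
    \<open>d\<close> divide \<open>w\<close>.\<close>
  have zL: "zeta d \<in> L"
  proof (rule fixed)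
    have zd: "zeta d ^ d = 1" by (rule zeta_power_self[OF d1])
    then show "algebraic_over L (zeta d)" using d1 by (intro roots_of_unity_alg[OF L]) (auto simp: roots_of_unity_def)
    fix \<tau> assume \<tau>: "embedding L \<tau>"
    obtain t where t: "t \<ge> 1" "\<And>z. z ^ n = 1 \<Longrightarrow> \<tau> z = z ^ t" using emb_unity[OF L \<tau> g(2)] by blast
    have "int d dvd int t - 1" using d_dvd[OF tI[OF \<tau> t(2)]] by blast
    then have "int d dvd int (t - 1)" using t(1) by (simp add: of_nat_diff)
    then have "d dvd t - 1" by (simp only: of_nat_dvd_iff)
    then have z1: "zeta d ^ (t - 1) = 1" using zeta_power_eq_1[OF d1] by blast
    have "\<tau> (zeta d) = zeta d ^ t" by (rule t(2)) (simp add: k power_mult zd)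
    also have "\<dots> = zeta d * zeta d ^ (t - 1)" using t(1) by (cases t) auto
    finally show "\<tau> (zeta d) = zeta d" using z1 by simp
  qed
  then have "zeta d ^ w = 1" using w(2) zeta_power_self[OF d1] d1 by (auto simp: roots_of_unity_def)
  then have "d dvd w" using zeta_power_eq_1[OF d1] by blast
  then obtain c where "w = d * c" by blast
  then have "int w \<in> I" using I_mult[OF dI, of "int c"] by simp
  then show ?thesis unfolding I_def by auto
qed

section \<open>Abelian groups of finite rank\<close>

lemma nsmul_add: "nsmul (m + n) g = nsmul m g + nsmul n g"
  by (induction m) (auto simp: algebra_simps)

lemma nsmul_add_right: "nsmul n (g + h) = nsmul n g + nsmul n h"
  by (induction n) (auto simp: algebra_simps)

lemma nsmul_0_right [simp]: "nsmul n 0 = 0"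
  by (induction n) auto

lemma nsmul_mult: "nsmul (m * n) g = nsmul m (nsmul n g)"
  by (induction m) (auto simp: nsmul_add)

lemma nsmul_minus: "nsmul n (- g) = - nsmul n g"
  by (induction n) (auto simp: algebra_simps)

definition zsmul :: "int \<Rightarrow> 'g::ab_group_add \<Rightarrow> 'g" where
  "zsmul k g = (if k \<ge> 0 then nsmul (nat k) g else - nsmul (nat (- k)) g)"

lemma zsmul_of_nat: "zsmul (int n) g = nsmul n g"
  by (simp add: zsmul_def)

lemma zsmul_0 [simp]: "zsmul 0 g = 0" and zsmul_1 [simp]: "zsmul 1 g = g"
  by (simp_all add: zsmul_def)

lemma zsmul_0_right [simp]: "zsmul k 0 = 0"
  by (simp add: zsmul_def)

lemma zsmul_uminus: "zsmul (- k) g = - zsmul k g"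
  by (simp add: zsmul_def)

lemma nsmul_diff: "n \<le> m \<Longrightarrow> nsmul (m - n) g = nsmul m g - nsmul n g"
  using nsmul_add[of "m - n" n g] by simp

lemma zsmul_of_nat_diff: "zsmul (int m - int n) g = nsmul m g - nsmul n g"
proof (cases "n \<le> m")
  case True
  then show ?thesis by (simp add: zsmul_def nsmul_diff nat_diff_distrib)
next
  case False
  then have "nsmul (nat (int n - int m)) g = nsmul n g - nsmul m g" using nsmul_diff[of m n g] by (simp add: nat_diff_distrib)
  then show ?thesis using False by (simp add: zsmul_def)
qed

lemma zsmul_add: "zsmul (j + k) g = zsmul j g + zsmul k g"
proof -
  obtain a b where j: "j = int a - int b" by (rule int_diff_cases)
  obtain c d where k: "k = int c - int d" by (rule int_diff_cases)
  have "j + k = int (a + c) - int (b + d)" by (simp add: j k)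
  then show ?thesis unfolding j k by (simp only: zsmul_of_nat_diff nsmul_add) (simp add: algebra_simps)
qed

lemma zsmul_diff: "zsmul (j - k) g = zsmul j g - zsmul k g"
  using zsmul_add[of j "- k" g] by (simp add: zsmul_uminus)

lemma zsmul_add_right: "zsmul k (g + h) = zsmul k g + zsmul k h"
  by (simp add: zsmul_def nsmul_add_right)

lemma zsmul_minus_right: "zsmul k (- g) = - zsmul k g"
  by (simp add: zsmul_def nsmul_minus)

lemma zsmul_diff_right: "zsmul k (g - h) = zsmul k g - zsmul k h"
  using zsmul_add_right[of k g "- h"] by (simp add: zsmul_minus_right)

lemma zsmul_sum_right: "zsmul k (sum f I) = (\<Sum>i\<in>I. zsmul k (f i))"
  by (induction I rule: infinite_finite_induct) (auto simp: zsmul_add_right)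

lemma zsmul_mult: "zsmul (j * k) g = zsmul j (zsmul k g)"
proof -
  have *: "zsmul (int n * k) g = zsmul (int n) (zsmul k g)" for n
    by (induction n) (auto simp: algebra_simps zsmul_add)
  show ?thesis
  proof (cases "j \<ge> 0")
    case True then show ?thesis using *[of "nat j"] by simp
  next
    case False 
    then have "zsmul (- j * k) g = zsmul (- j) (zsmul k g)" using *[of "nat (- j)"] by simp
    then show ?thesis by (simp add: zsmul_uminus)
  qed
qed

context
  fixes H :: "'g::ab_group_add set"
  assumes H: "is_subgroup H"
begin

lemma subgroup_0: "0 \<in> H" and subgroup_diff: "x \<in> H \<Longrightarrow> y \<in> H \<Longrightarrow> x - y \<in> H"
  using H by (auto simp: is_subgroup_def)

lemma subgroup_uminus: "x \<in> H \<Longrightarrow> - x \<in> H"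
  using subgroup_diff[OF subgroup_0] by fastforce

lemma subgroup_add: "x \<in> H \<Longrightarrow> y \<in> H \<Longrightarrow> x + y \<in> H"
  using subgroup_diff[OF _ subgroup_uminus] by fastforce

lemma subgroup_nsmul: "x \<in> H \<Longrightarrow> nsmul n x \<in> H"
  by (induction n) (auto intro: subgroup_0 subgroup_add)

lemma subgroup_zsmul: "x \<in> H \<Longrightarrow> zsmul k x \<in> H"
  by (simp add: zsmul_def subgroup_nsmul subgroup_uminus)

lemma subgroup_sum: "(\<And>i. i \<in> I \<Longrightarrow> f i \<in> H) \<Longrightarrow> sum f I \<in> H"
  by (induction I rule: infinite_finite_induct) (auto intro: subgroup_0 subgroup_add)

end

lemma subgroup_gen: "is_subgroup (gen_subgroup F)"
  by (auto simp: gen_subgroup_def is_subgroup_def)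

lemma gen_subgroup_superset: "F \<subseteq> gen_subgroup F"
  by (auto simp: gen_subgroup_def)

lemma gen_subgroup_least: "is_subgroup H \<Longrightarrow> F \<subseteq> H \<Longrightarrow> gen_subgroup F \<subseteq> H"
  by (auto simp: gen_subgroup_def)

lemma gen_subgroup_family:
  assumes I: "finite I" and y: "y \<in> gen_subgroup (x ` I)"
  shows "\<exists>e. y = (\<Sum>i\<in>I. zsmul (e i) (x i))"
proof -
  let ?H = "{y. \<exists>e. y = (\<Sum>i\<in>I. zsmul (e i) (x i))}"
  have "is_subgroup ?H" unfolding is_subgroup_def
  proof (intro conjI ballI)
    show "0 \<in> ?H" by (intro CollectI exI[of _ "\<lambda>_. 0"]) simp
    fix a b assume "a \<in> ?H" "b \<in> ?H"
    then obtain e f where "a = (\<Sum>i\<in>I. zsmul (e i) (x i))" "b = (\<Sum>i\<in>I. zsmul (f i) (x i))" by blast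
    then have "a - b = (\<Sum>i\<in>I. zsmul (e i - f i) (x i))" by (simp add: zsmul_diff sum_subtractf)
    then show "a - b \<in> ?H" by - (rule CollectI, rule exI)
  qed
  moreover have "x ` I \<subseteq> ?H"
  proof
    fix z assume "z \<in> x ` I"
    then obtain j where j: "j \<in> I" "z = x j" by blast
    have "(\<Sum>i\<in>I. zsmul (if i = j then 1 else 0) (x i)) = (\<Sum>i\<in>I. if i = j then x i else 0)"
      by (intro sum.cong) auto
    also have "\<dots> = z" using I j by (simp add: sum.delta)
    finally show "z \<in> ?H" by (intro CollectI exI[of _ "\<lambda>i. if i = j then 1 else 0"]) simp
  qed
  ultimately show ?thesis using gen_subgroup_least y by blast
qed

section \<open>Consequences of finite rank\<close>

definition group_rank_le :: "nat \<Rightarrow> 'g::ab_group_add itself \<Rightarrow> bool" where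
  "group_rank_le r _ \<longleftrightarrow> (\<forall>X::'g set. finite X \<longrightarrow>
     (\<exists>F. finite F \<and> card F \<le> r \<and> gen_subgroup X = gen_subgroup F))"

lemma finite_rank_group_rank_le:
  "finite_rank_group TYPE('g::ab_group_add) \<Longrightarrow> \<exists>r. group_rank_le r TYPE('g)"
proof -
  assume "finite_rank_group TYPE('g)"
  then obtain r where r: "\<And>H :: 'g set. fg_subgroup H \<Longrightarrow> \<exists>F. finite F \<and> card F \<le> r \<and> H = gen_subgroup F"
    unfolding finite_rank_group_def by blast
  have "group_rank_le r TYPE('g)" unfolding group_rank_le_def using r by (simp add: fg_subgroup_def) blast
  then show ?thesis ..
qed

text \<open>Multiplication by \<open>N\<close> carries the subgroup generated by the
  \<open>x j\<close> into \<open>K\<close>. With respect to at most \<open>r\<close> generators of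
  this subgroup, the coordinates modulo \<open>N\<close> therefore determine the coset of
  \<open>K\<close>.\<close>

lemma rank_bounds_index:
  fixes K :: "'g::ab_group_add set"
  assumes r: "group_rank_le r TYPE('g)" and K: "is_subgroup K" and N: "N \<ge> 1"
    and J: "finite J" "\<And>j. j \<in> J \<Longrightarrow> zsmul (int N) (x j) \<in> K"
    and dist: "\<And>i j. i \<in> J \<Longrightarrow> j \<in> J \<Longrightarrow> i \<noteq> j \<Longrightarrow> x i - x j \<notin> K"
  shows "card J \<le> N ^ r"
proof -
  obtain F where F: "finite F" "card F \<le> r" "gen_subgroup (x ` J) = gen_subgroup F"
    using r J(1) unfolding group_rank_le_def by blast
  have "is_subgroup {g. zsmul (int N) g \<in> K}" unfolding is_subgroup_def
    using subgroup_0[OF K] subgroup_diff[OF K] by (auto simp: zsmul_diff_right)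
  then have "gen_subgroup (x ` J) \<subseteq> {g. zsmul (int N) g \<in> K}"
    by (rule gen_subgroup_least) (use J in auto)
  then have NF: "zsmul (int N) f \<in> K" if "f \<in> F" for f using that gen_subgroup_superset[of F] F(3) by auto
  have "\<exists>e. x j = (\<Sum>f\<in>F. zsmul (e f) f)" if "j \<in> J" for j
  proof -
    have "x j \<in> gen_subgroup (x ` J)" using gen_subgroup_superset[of "x ` J"] that by auto
    then show ?thesis using gen_subgroup_family[OF F(1), of "x j" "\<lambda>f. f"] F(3) by simp
  qed
  then obtain e where e: "\<And>j. j \<in> J \<Longrightarrow> x j = (\<Sum>f\<in>F. zsmul (e j f) f)" by metis
  define p where "p = (\<lambda>j. restrict (\<lambda>f. e j f mod int N) F)"
  have "inj_on p J"
  proof (rule inj_onI, rule ccontr)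
    fix i j assume ij: "i \<in> J" "j \<in> J" "p i = p j" "i \<noteq> j"
    have "zsmul (e i f) f - zsmul (e j f) f \<in> K" if f: "f \<in> F" for f
    proof -
      have "e i f mod int N = e j f mod int N" using ij(3) f by (metis p_def restrict_apply')
      then have "int N dvd e i f - e j f" by (simp add: mod_eq_dvd_iff)
      then obtain q where q: "e i f - e j f = q * int N" by (metis dvdE mult.commute)
      have "zsmul (e i f) f - zsmul (e j f) f = zsmul q (zsmul (int N) f)"
        by (simp add: zsmul_diff[symmetric] q zsmul_mult[symmetric])
      then show ?thesis using subgroup_zsmul[OF K NF[OF f]] by simp
    qed
    then have "(\<Sum>f\<in>F. zsmul (e i f) f - zsmul (e j f) f) \<in> K" by (rule subgroup_sum[OF K])
    then have "x i - x j \<in> K" using e ij by (simp add: sum_subtractf)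
    then show False using dist ij by blast
  qed
  moreover have "p ` J \<subseteq> PiE F (\<lambda>_. {0..<int N})" using N by (auto simp: p_def)
  moreover have "finite (PiE F (\<lambda>_. {0..<int N}))" using F(1) by (intro finite_PiE) auto
  ultimately have "card J \<le> card (PiE F (\<lambda>_. {0..<int N}))" by (rule card_inj_on_le)
  also have "\<dots> = N ^ card F" using F(1) by (simp add: card_PiE)
  also have "\<dots> \<le> N ^ r" using F(2) N by (intro power_increasing) auto
  finally show ?thesis .
qed

text \<open>If \<open>r + 1\<close> elements were independent, the \<open>2 ^ Suc r\<close> sums
  with coefficients 0 and 1 would be incongruent modulo twice the subgroup they span, more than
  \<open>rank_bounds_index\<close> allows.\<close>

lemma rank_dependent:
  fixes x :: "nat \<Rightarrow> 'g::ab_group_add"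
  assumes r: "group_rank_le r TYPE('g)"
  shows "\<exists>e. (\<exists>i\<le>r. e i \<noteq> 0) \<and> (\<Sum>i\<le>r. zsmul (e i) (x i)) = 0"
proof (rule ccontr)
  assume "\<not> ?thesis"
  then have ind: "(\<Sum>i\<le>r. zsmul (e i) (x i)) \<noteq> 0" if "\<exists>i\<le>r. e i \<noteq> 0" for e
    using that by blast
  define A where "A = gen_subgroup (x ` {..r})"
  have A: "is_subgroup A" by (simp add: A_def subgroup_gen)
  define K where "K = {zsmul 2 a | a. a \<in> A}"
  have K: "is_subgroup K" unfolding is_subgroup_def
  proof (intro conjI ballI)
    show "0 \<in> K" unfolding K_def using subgroup_0[OF A] by (intro CollectI exI[of _ 0]) simp
    fix a b assume "a \<in> K" "b \<in> K"
    then obtain a' b' where "a = zsmul 2 a'" "b = zsmul 2 b'" "a' \<in> A" "b' \<in> A" by (auto simp: K_def)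
    then have "a - b = zsmul 2 (a' - b')" "a' - b' \<in> A" using subgroup_diff[OF A] by (auto simp: zsmul_diff_right)
    then show "a - b \<in> K" unfolding K_def by blast
  qed
  define J where "J = PiE {..r} (\<lambda>_. {0, 1::int})"
  define y where "y = (\<lambda>e. \<Sum>i\<le>r. zsmul (e i) (x i))"
  have yA: "y e \<in> A" for e unfolding y_def
    by (intro subgroup_sum[OF A] subgroup_zsmul[OF A]) (auto simp: A_def intro: gen_subgroup_superset[THEN subsetD])
  have "card J \<le> 2 ^ r"
  proof (rule rank_bounds_index[OF r K])
    show "finite J" unfolding J_def by (intro finite_PiE) auto
    show "zsmul (int 2) (y e) \<in> K" for e unfolding K_def using yA by auto
    fix e e' assume e: "e \<in> J" "e' \<in> J" "e \<noteq> e'"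
    show "y e - y e' \<notin> K"
    proof
      assume "y e - y e' \<in> K"
      then obtain a where a: "a \<in> A" "y e - y e' = zsmul 2 a" by (auto simp: K_def)
      then obtain n where n: "a = (\<Sum>i\<le>r. zsmul (n i) (x i))" using gen_subgroup_family[of "{..r}" a x] by (auto simp: A_def)
      have "(\<Sum>i\<le>r. zsmul (e i - e' i - 2 * n i) (x i)) = 0"
        using a(2) by (simp add: n y_def zsmul_diff sum_subtractf zsmul_sum_right zsmul_mult)
      then have "\<forall>i\<le>r. e i - e' i - 2 * n i = 0" using ind[of "\<lambda>i. e i - e' i - 2 * n i"] by metis
      then have z: "e i - e' i = 2 * n i" if "i \<le> r" for i using that by simp
      have "e i = e' i" for i
      proof (cases "i \<le> r")
        case True
        then have "e i \<in> {0, 1}" "e' i \<in> {0, 1}" using e by (auto simp: J_def PiE_iff)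
        then have "e i = 0 \<or> e i = 1" "e' i = 0 \<or> e' i = 1" by auto
        then show ?thesis using z[OF True] by presburger
      next
        case False then show ?thesis using e by (auto simp: J_def PiE_iff extensional_def)
      qed
      then show False using e by auto
    qed
  qed simp
  moreover have "card J = 2 ^ Suc r" unfolding J_def by (subst card_PiE) (simp_all add: numeral_2_eq_2)
  ultimately show False by simp
qed

lemma rank_maximal_independent:
  assumes r: "group_rank_le r TYPE('g::ab_group_add)"
  shows "\<exists>(s::nat) (x::nat \<Rightarrow> 'g). \<forall>g. \<exists>n e. n \<ge> 1 \<and> nsmul n g = (\<Sum>i<s. zsmul (e i) (x i))"
proof -
  define D where "D = (\<lambda>s. \<forall>x::nat \<Rightarrow> 'g. \<exists>e. (\<exists>i\<le>s. e i \<noteq> 0) \<and> (\<Sum>i\<le>s. zsmul (e i) (x i)) = 0)"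
  define s where "s = (LEAST s. D s)"
  have "D r" using rank_dependent[OF r] by (auto simp: D_def)
  then have s: "D s" unfolding s_def by (rule LeastI)
  have "\<exists>x :: nat \<Rightarrow> 'g. \<forall>e. (\<Sum>i<s. zsmul (e i) (x i)) = 0 \<longrightarrow> (\<forall>i<s. e i = 0)"
  proof (cases s)
    case (Suc t)
    then have "\<not> D t" using not_less_Least[of t D] by (simp add: s_def)
    then show ?thesis unfolding D_def Suc lessThan_Suc_atMost less_Suc_eq_le by blast
  qed auto
  then obtain x :: "nat \<Rightarrow> 'g" where x: "\<And>e. (\<Sum>i<s. zsmul (e i) (x i)) = 0 \<Longrightarrow> (\<forall>i<s. e i = 0)" by blast
  have "\<exists>n e. n \<ge> 1 \<and> nsmul n g = (\<Sum>i<s. zsmul (e i) (x i))" for g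
  proof -
    obtain e where e: "\<exists>i\<le>s. e i \<noteq> 0" "(\<Sum>i\<le>s. zsmul (e i) ((x(s := g)) i)) = 0" 
      using s unfolding D_def by blast
    have "(\<Sum>i\<le>s. zsmul (e i) ((x(s := g)) i)) = (\<Sum>i<s. zsmul (e i) (x i)) + zsmul (e s) g"
      unfolding lessThan_Suc_atMost[symmetric] by simp
    then have rel: "(\<Sum>i<s. zsmul (e i) (x i)) + zsmul (e s) g = 0" using e by simp
    have es: "e s \<noteq> 0"
    proof
      assume "e s = 0"
      then have "\<forall>i<s. e i = 0" using x rel by simp
      then show False using e(1) \<open>e s = 0\<close> by (metis le_neq_implies_less)
    qed
    have "zsmul (e s) g = - (\<Sum>i<s. zsmul (e i) (x i))" using rel by (metis add.commute eq_neg_iff_add_eq_0)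
    then have "zsmul (sgn (e s) * e s) g = (\<Sum>i<s. zsmul (- sgn (e s) * e i) (x i))"
      by (simp add: zsmul_mult zsmul_minus_right zsmul_sum_right zsmul_uminus sum_negf)
    moreover have "sgn (e s) * e s = int (nat \<bar>e s\<bar>)" by (simp add: sgn_if)
    ultimately have "nsmul (nat \<bar>e s\<bar>) g = (\<Sum>i<s. zsmul (- sgn (e s) * e i) (x i))" using zsmul_of_nat by metis
    then show ?thesis using es by (intro exI[of _ "nat \<bar>e s\<bar>"] exI[of _ "\<lambda>i. - sgn (e s) * e i"]) auto
  qed
  then show ?thesis by blast
qed

text \<open>Every element solves an equation \<open>nsmul n g = h\<close> with \<open>h\<close>
  among countably many integer combinations. Two solutions differ by an element killed by
  \<open>n\<close>, so \<open>rank_bounds_index\<close> with trivial \<open>K\<close> leaves at most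
  \<open>n ^ r\<close> of them.\<close>

lemma rank_countable:
  assumes r: "group_rank_le r TYPE('g::ab_group_add)"
  shows "countable (UNIV :: 'g set)"
proof -
  obtain s x where sx: "\<And>g::'g. \<exists>n e. n \<ge> 1 \<and> nsmul n g = (\<Sum>i<(s::nat). zsmul (e i) (x i))"
    using rank_maximal_independent[OF r] by blast
  define fib where "fib = (\<lambda>(n, es). {g. n \<ge> 1 \<and> nsmul n g = (\<Sum>i<s. zsmul (es ! i) (x i))})"
  have fin: "finite (fib p)" for p
  proof (rule ccontr)
    obtain n es where p: "p = (n, es)" by (cases p)
    assume "infinite (fib p)"
    then obtain X where X: "finite X" "card X = Suc (n ^ r)" "X \<subseteq> fib p"
      using infinite_arbitrarily_large by blast
    then have "X \<noteq> {}" by auto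
    then obtain g0 where g0: "g0 \<in> X" by blast
    have n1: "n \<ge> 1" using g0 X(3) by (auto simp: fib_def p)
    have "card X \<le> n ^ r"
    proof (rule rank_bounds_index[OF r _ n1 X(1)])
      show "is_subgroup {0::'g}" by (simp add: is_subgroup_def)
      show "zsmul (int n) (g - g0) \<in> {0}" if "g \<in> X" for g
        using that g0 X(3) by (auto simp: fib_def p zsmul_diff_right zsmul_of_nat subset_iff)
      show "(g - g0) - (h - g0) \<notin> {0}" if "g \<noteq> h" for g h using that by simp
    qed
    then show False using X by simp
  qed
  have "UNIV \<subseteq> (\<Union>p. fib p)"
  proof
    fix g :: 'g
    obtain n e where "n \<ge> 1" "nsmul n g = (\<Sum>i<s. zsmul (e i) (x i))" using sx by blast
    then have "g \<in> fib (n, map e [0..<s])" by (simp add: fib_def)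
    then show "g \<in> (\<Union>p. fib p)" by blast
  qed
  moreover have "countable (\<Union>p. fib p)" using fin by (intro countable_UN) (auto intro: countable_finite)
  ultimately show ?thesis by (rule countable_subset)
qed

text \<open>\<open>N ^ r\<close> bounds the sets of elements of \<open>G1\<close> that are pairwise
  incongruent modulo \<open>K\<close>; a largest such set meets every coset that \<open>G1\<close>
  meets.\<close>

lemma rank_finite_index:
  fixes G1 :: "'g::ab_group_add set"
  assumes r: "group_rank_le r TYPE('g)" and K: "is_subgroup K" and N: "N \<ge> 1"
    and G1: "\<And>g. g \<in> G1 \<Longrightarrow> nsmul N g \<in> K"
  shows "\<exists>F. finite F \<and> F \<subseteq> G1 \<and> (\<forall>g\<in>G1. \<exists>f\<in>F. g - f \<in> K)"
proof -
  define Q where "Q = (\<lambda>X. finite X \<and> X \<subseteq> G1 \<and> (\<forall>a\<in>X. \<forall>b\<in>X. a \<noteq> b \<longrightarrow> a - b \<notin> K))"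
  have "Q {}" by (simp add: Q_def)
  moreover have bound: "card X \<le> N ^ r" if "Q X" for X
    by (rule rank_bounds_index[OF r K N, of X "\<lambda>g. g"]) (use that G1 in \<open>auto simp: Q_def zsmul_of_nat\<close>)
  ultimately obtain X where X: "Q X" "\<And>Y. Q Y \<Longrightarrow> card Y \<le> card X"
    using ex_has_greatest_nat[of Q "{}" card "Suc (N ^ r)"]
    by (metis le_imp_less_Suc)
  have "\<exists>f\<in>X. g - f \<in> K" if g: "g \<in> G1" for g
  proof (rule ccontr)
    assume no: "\<not> ?thesis"
    then have "g \<notin> X" using subgroup_0[OF K] by force
    have "f - g \<notin> K" if "f \<in> X" for f using no that subgroup_uminus[OF K, of "f - g"] by auto
    then have "Q (insert g X)" using X(1) no g by (auto simp: Q_def)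
    from X(2)[OF this] show False using X(1) \<open>g \<notin> X\<close> by (simp add: Q_def)
  qed
  then show ?thesis using X(1) by (intro exI[of _ X]) (auto simp: Q_def)
qed

section \<open>Torsion under the Chernikov condition\<close>

lemma nsmul_eq_0_mult: "nsmul m g = 0 \<Longrightarrow> m dvd n \<Longrightarrow> nsmul n g = 0"
  by (metis dvdE mult.commute nsmul_0_right nsmul_mult)

lemma quasicyclic_primary:
  fixes q :: "'g::ab_group_add"
  assumes "quasicyclic p Q" "q \<in> Q"
  shows "\<exists>s. nsmul (p ^ s) q = 0"
proof -
  obtain x where x: "x 0 = 0" "\<And>n. nsmul p (x (Suc n)) = x n" "Q = gen_subgroup (range x)"
    using assms(1) by (auto simp: quasicyclic_def)
  let ?H = "{q :: 'g. \<exists>s. nsmul (p ^ s) q = 0}"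
  have "is_subgroup ?H" unfolding is_subgroup_def
  proof (intro conjI ballI)
    show "0 \<in> ?H" by simp
    fix a b assume "a \<in> ?H" "b \<in> ?H"
    then obtain s t where st: "nsmul (p ^ s) a = 0" "nsmul (p ^ t) b = 0" by blast
    have "nsmul (p ^ (s + t)) a = 0" "nsmul (p ^ (s + t)) b = 0"
      by (rule nsmul_eq_0_mult[OF st(1)], simp add: power_add) (rule nsmul_eq_0_mult[OF st(2)], simp add: power_add)
    then have "nsmul (p ^ (s + t)) (a - b) = 0" using nsmul_add_right[of _ a "- b"] nsmul_minus[of _ b] by simp
    then show "a - b \<in> ?H" by blast
  qed
  moreover have "range x \<subseteq> ?H"
  proof
    fix y assume "y \<in> range x"
    then obtain n where n: "y = x n" by blast
    have "nsmul (p ^ n) (x n) = 0"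
      by (induction n) (auto simp: x mult.commute[of p] nsmul_mult)
    then show "y \<in> ?H" using n by blast
  qed
  ultimately show ?thesis using gen_subgroup_least x(3) assms(2) by blast
qed

text \<open>The factorial of the index carries \<open>T\<close> into the product of quasicyclic
  groups, where powers of the primes involved kill every element. So one \<open>Q\<close> serves all
  of \<open>T\<close>, while the exponent \<open>s\<close> depends on \<open>t\<close>.\<close>

lemma chernikov_primary:
  assumes "chernikov (T :: 'g::ab_group_add set)"
  shows "\<exists>Q\<ge>1. \<forall>t\<in>T. \<exists>s. nsmul (Q ^ s) t = 0"
proof -
  obtain N where T: "is_subgroup T" and N: "is_subgroup N" "N \<subseteq> T" "finite ((\<lambda>t. (\<lambda>n. t + n) ` N) ` T)"
    "direct_prod_quasicyclic N" using assms by (auto simp: chernikov_def)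
  obtain m :: nat and Qs p where mp0: "\<forall>i<m. quasicyclic (p i) (Qs i)" "N = {(\<Sum>i<m. q i) | q. \<forall>i<m. q i \<in> Qs i}"
    using N(4) unfolding direct_prod_quasicyclic_def by (elim exE conjE) (rule that, assumption, assumption)
  then have "quasicyclic (p i) (Qs i)" if "i < m" for i using that by blast
  note mp = this mp0(2)
  define C where "C = (\<lambda>t. (\<lambda>n. t + n) ` N) ` T"
  define c where "c = card C"
  define R where "R = (\<Prod>i<m. p i)"
  define Q where "Q = fact c * R"
  have pr: "prime (p i)" if "i < m" for i using mp(1)[OF that] by (simp add: quasicyclic_def)
  have "R \<ge> 1" unfolding R_def by (intro prod_ge_1) (use pr prime_ge_1_nat in auto)
  then have "Q \<ge> 1" by (simp add: Q_def)
  moreover have "\<exists>s. nsmul (Q ^ s) t = 0" if t: "t \<in> T" for t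
  proof -
    \<comment> \<open>Pigeonhole: of the \<open>c + 1\<close> multiples of \<open>t\<close> from 0
      to \<open>c\<close>, two lie in the same of the \<open>c\<close> cosets.\<close>
    define k where "k = (\<lambda>j. (\<lambda>n. nsmul j t + n) ` N)"
    have "k ` {..c} \<subseteq> C" using subgroup_nsmul[OF T t] by (auto simp: k_def C_def)
    then have "card (k ` {..c}) \<le> c" unfolding c_def using N(3) by (intro card_mono) (auto simp: C_def)
    then have "\<not> inj_on k {..c}" using card_image[of k "{..c}"] by auto
    then obtain i j where ij: "i < j" "j \<le> c" "k i = k j" unfolding inj_on_def
      by (metis atMost_iff linorder_neqE_nat)
    have "nsmul j t \<in> k j" unfolding k_def using subgroup_0[OF N(1)] by (intro image_eqI[of _ _ 0]) auto
    then obtain n where n: "n \<in> N" "nsmul j t = nsmul i t + n" using ij(3) by (auto simp: k_def)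
    then have "nsmul (j - i) t = n" using ij(1) by (simp add: nsmul_diff)
    moreover have "j - i dvd fact c" using ij by (intro dvd_fact) auto
    then obtain l where "fact c = l * (j - i)" by (metis dvdE mult.commute)
    ultimately have "nsmul (fact c) t \<in> N" using n subgroup_nsmul[OF N(1)] by (simp add: nsmul_mult)
    then obtain q where q: "nsmul (fact c) t = (\<Sum>i<m. q i)" "\<And>i. i < m \<Longrightarrow> q i \<in> Qs i" using mp(2) by blast
    have "\<forall>i. i < m \<longrightarrow> (\<exists>s. nsmul (p i ^ s) (q i) = 0)" using quasicyclic_primary mp(1) q(2) by blast
    then obtain s where s: "\<And>i. i < m \<Longrightarrow> nsmul (p i ^ s i) (q i) = 0" by metis
    define S where "S = (\<Sum>i<m. s i)"
    have "nsmul (R ^ S) (q i) = 0" if i: "i < m" for i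
    proof (rule nsmul_eq_0_mult[OF s[OF i]])
      have "p i dvd R" unfolding R_def using i by (intro dvd_prodI) auto
      then have "p i ^ s i dvd R ^ s i" by (rule dvd_power_same)
      moreover have "s i \<le> S" unfolding S_def using i by (intro member_le_sum) auto
      then have "R ^ s i dvd R ^ S" by (rule le_imp_power_dvd)
      ultimately show "p i ^ s i dvd R ^ S" by (rule dvd_trans)
    qed
    moreover have "nsmul (R ^ S) (\<Sum>i<m. q i) = (\<Sum>i<m. nsmul (R ^ S) (q i))"
      using zsmul_sum_right[of "int (R ^ S)" q "{..<m}"] unfolding zsmul_of_nat .
    ultimately have "nsmul (R ^ S * fact c) t = 0" by (simp add: nsmul_mult q(1))
    moreover have "R ^ S * fact c dvd Q ^ Suc S" by (simp add: Q_def power_mult_distrib mult.commute mult_dvd_mono)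
    ultimately show ?thesis using nsmul_eq_0_mult by blast
  qed
  ultimately show ?thesis by blast
qed

section \<open>Countability and the embedding into the complex numbers\<close>

primrec field_stage :: "'k::field set \<Rightarrow> nat \<Rightarrow> 'k set" where
  "field_stage F 0 = F \<union> {0, 1}"
| "field_stage F (Suc n) = field_stage F n \<union> (\<lambda>(x, y). x - y) ` (field_stage F n \<times> field_stage F n) \<union>
     (\<lambda>(x, y). x * y) ` (field_stage F n \<times> field_stage F n) \<union> inverse ` field_stage F n"

text \<open>The generated field is covered by countably many rounds of field operations, each of
  which keeps the stage countable.\<close>

lemma countable_fld:
  assumes "countable (F :: 'k::field set)" shows "countable (gen_field F)"
proof -
  have c: "countable (field_stage F n)" for n
    by (induction n) (use assms in \<open>auto intro!: countable_image countable_SIGMA\<close>)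
  have mono: "field_stage F m \<subseteq> field_stage F n" if "m \<le> n" for m n
    using that by (induction n) (auto simp: le_Suc_eq)
  have "is_subfield (\<Union>n. field_stage F n)" unfolding is_subfield_def
  proof (intro conjI ballI)
    show "0 \<in> (\<Union>n. field_stage F n)" "1 \<in> (\<Union>n. field_stage F n)" by (auto intro!: exI[of _ 0])
    fix x y assume "x \<in> (\<Union>n. field_stage F n)" "y \<in> (\<Union>n. field_stage F n)"
    then obtain m n where "x \<in> field_stage F m" "y \<in> field_stage F n" by blast
    then have xy: "x \<in> field_stage F (max m n)" "y \<in> field_stage F (max m n)" 
      using mono[of m "max m n"] mono[of n "max m n"] by auto
    then have "x - y \<in> field_stage F (Suc (max m n))" "x * y \<in> field_stage F (Suc (max m n))"
      by (auto simp: image_iff)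
    then show "x - y \<in> (\<Union>n. field_stage F n)" "x * y \<in> (\<Union>n. field_stage F n)" by blast+
  next
    fix x assume "x \<in> (\<Union>n. field_stage F n)"
    then obtain n where "x \<in> field_stage F n" by blast
    then have "inverse x \<in> field_stage F (Suc n)" by auto
    then show "inverse x \<in> (\<Union>n. field_stage F n)" by blast
  qed
  moreover have "F \<subseteq> (\<Union>n. field_stage F n)" by (auto intro!: exI[of _ 0])
  ultimately have "gen_field F \<subseteq> (\<Union>n. field_stage F n)" by (rule gen_field_least)
  then show ?thesis using c by (auto intro: countable_subset)
qed

lemma countable_poly_mapping:
  assumes "countable (UNIV :: 'g set)" "countable (UNIV :: 'k::zero set)"
  shows "countable (UNIV :: ('g \<Rightarrow>\<^sub>0 'k) set)"
proof -
  define gr where "gr = (\<lambda>f :: 'g \<Rightarrow>\<^sub>0 'k. (\<lambda>g. (g, Poly_Mapping.lookup f g)) ` Poly_Mapping.keys f)"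
  have "inj gr"
  proof (rule injI, rule poly_mapping_eqI)
    fix f h :: "'g \<Rightarrow>\<^sub>0 'k" and g assume eq: "gr f = gr h"
    have *: "(g, c) \<in> gr u \<longleftrightarrow> c = Poly_Mapping.lookup u g \<and> c \<noteq> 0" for c u
      by (auto simp: gr_def in_keys_iff)
    have "(g, c) \<in> gr f \<longleftrightarrow> (g, c) \<in> gr h" for c using eq by simp
    then show "Poly_Mapping.lookup f g = Poly_Mapping.lookup h g" unfolding * by metis
  qed
  moreover have "countable (range gr)"
  proof (rule countable_subset)
    show "range gr \<subseteq> {A. finite A \<and> A \<subseteq> UNIV \<times> UNIV}" by (auto simp: gr_def)
    show "countable {A :: ('g \<times> 'k) set. finite A \<and> A \<subseteq> UNIV \<times> UNIV}"
      using assms by (intro countable_Collect_finite_subset countable_SIGMA)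
  qed
  ultimately show ?thesis using countable_image_inj_on by blast
qed

text \<open>By \<open>char0\<close>, the obvious map on the integers already has the kernel
  prescribed by \<open>P\<close>, so \<open>hom_extension\<close> can start there. A homomorphism
  with kernel exactly \<open>P\<close> is an embedding of the quotient by \<open>P\<close>.\<close>

theorem embedding_into_complex:
  fixes P :: "'a::{comm_ring_1, ring_char_0} set"
  assumes P: "prime_ideal P" and c: "countable (UNIV :: 'a set)"
    and char0: "\<And>n. of_int n \<in> P \<Longrightarrow> n = 0"
  shows "\<exists>\<Phi> :: 'a \<Rightarrow> complex. hom_on UNIV \<Phi> \<and> (\<forall>a. \<Phi> a = 0 \<longleftrightarrow> a \<in> P)"
proof -
  define \<phi> :: "'a \<Rightarrow> complex" where "\<phi> = (\<lambda>a. of_int (inv of_int a))"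
  have \<phi>: "\<phi> (of_int n) = of_int n" for n
    by (simp add: \<phi>_def inv_f_f inj_on_def)
  have S: "is_subring (range (of_int :: int \<Rightarrow> 'a))" unfolding is_subring_def
    by (metis (no_types, lifting) of_int_1 of_int_diff of_int_mult rangeE rangeI)
  have hom: "hom_on (range of_int) \<phi>" unfolding hom_on_def
    using \<phi>[of 1] by (auto simp flip: of_int_diff of_int_mult simp: \<phi>)
  have ker: "\<phi> s = 0 \<longleftrightarrow> s \<in> P" if "s \<in> range of_int" for s
    using that char0 \<phi> P by (auto simp: prime_ideal_def is_ideal_def)
  have "is_subring (UNIV :: 'a set)" by (simp add: is_subring_def)
  from hom_extension[OF S hom P ker this] c show ?thesis by auto
qed

section \<open>The controller\<close>

text \<open>\<open>\<psi>\<close> stands for a homomorphism from \<open>kG\<close> to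
  \<open>\<complex>\<close> with kernel \<open>P\<close>, restricted to group elements; injectivity
  is the faithfulness of \<open>P\<close>. It translates the additive group into a multiplicative
  one.\<close>

locale faithful_character =
  fixes \<psi> :: "'g::ab_group_add \<Rightarrow> complex" and r :: nat
  assumes chi_add: "\<psi> (g + h) = \<psi> g * \<psi> h" and chi_nonzero: "\<psi> g \<noteq> 0" and chi_inj: "inj \<psi>"
    and rank: "group_rank_le r TYPE('g)"
begin

lemma chi_0: "\<psi> 0 = 1"
  using chi_add[of 0 0] chi_nonzero[of 0] by simp

lemma chi_minus: "\<psi> (- g) = inverse (\<psi> g)"
  using chi_add[of g "- g"] chi_0 by (metis inverse_unique right_minus)

lemma chi_diff: "\<psi> (g - h) = \<psi> g / \<psi> h"
  using chi_add[of g "- h"] by (simp add: chi_minus divide_inverse)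

lemma chi_nsmul: "\<psi> (nsmul n g) = \<psi> g ^ n"
  by (induction n) (auto simp: chi_0 chi_add)

lemma chi_zsmul: "\<psi> (zsmul k g) = \<psi> g powi k"
  by (simp add: zsmul_def chi_nsmul chi_minus power_int_def power_inverse)

lemma chi_sum: "\<psi> (sum f I) = (\<Prod>i\<in>I. \<psi> (f i))"
  by (induction I rule: infinite_finite_induct) (auto simp: chi_0 chi_add)

lemma mul_group_chi: "is_subgroup H \<Longrightarrow> mul_group (\<psi> ` H)"
  unfolding mul_group_def
proof (intro conjI ballI)
  assume H: "is_subgroup H"
  show "1 \<in> \<psi> ` H" using subgroup_0[OF H] chi_0 by (metis imageI)
  show "0 \<notin> \<psi> ` H" using chi_nonzero by (metis imageE)
  fix x y assume "x \<in> \<psi> ` H" "y \<in> \<psi> ` H"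
  then obtain g h where "g \<in> H" "h \<in> H" "x = \<psi> g" "y = \<psi> h" by blast
  then show "x / y \<in> \<psi> ` H" using subgroup_diff[OF H] by (metis chi_diff imageI)
qed

lemma is_subgroup_UNIV: "is_subgroup (UNIV :: 'g set)"
  by (simp add: is_subgroup_def)

text \<open>A relation between powers of the \<open>x i\<close> is also a relation between the
  \<open>x i\<close>. This bounds the rank of groups of radicals that are not contained in the image
  of \<open>\<psi>\<close>.\<close>

lemma rank_radical_closure:
  assumes M: "\<And>x. x \<in> M \<Longrightarrow> x \<noteq> 0 \<and> (\<exists>n\<ge>1. x ^ n \<in> range \<psi>)"
  shows "rank_le r M"
  unfolding rank_le_def
proof (intro allI impI)
  fix x :: "nat \<Rightarrow> complex" assume x: "\<forall>i\<le>r. x i \<in> M"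
  have "\<forall>i. i \<le> r \<longrightarrow> (\<exists>n g. n \<ge> (1::nat) \<and> x i ^ n = \<psi> g)" using x M by blast
  then obtain n y where ny: "\<And>i. i \<le> r \<Longrightarrow> n i \<ge> (1::nat)" "\<And>i. i \<le> r \<Longrightarrow> x i ^ n i = \<psi> (y i)" by metis
  obtain e where e: "\<exists>i\<le>r. e i \<noteq> 0" "(\<Sum>i\<le>r. zsmul (e i) (y i)) = 0" using rank_dependent[OF rank] by blast
  have "(\<Prod>i\<le>r. x i powi (int (n i) * e i)) = (\<Prod>i\<le>r. \<psi> (zsmul (e i) (y i)))"
    using ny by (intro prod.cong) (auto simp: power_int_mult chi_zsmul)
  also have "\<dots> = 1" using e(2) by (simp add: chi_sum[symmetric] chi_0)
  finally have "(\<Prod>i\<le>r. x i powi (int (n i) * e i)) = 1" .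
  moreover obtain i where "i \<le> r" "e i \<noteq> 0" using e by blast
  then have "\<exists>i\<le>r. int (n i) * e i \<noteq> 0" using ny(1)[of i] by (intro exI[of _ i]) auto
  ultimately show "\<exists>e. (\<exists>i\<le>r. e i \<noteq> 0) \<and> (\<Prod>i\<le>r. x i powi e i) = 1"
    by (intro exI[of _ "\<lambda>i. int (n i) * e i"]) simp
qed

lemma fg_subgroup_in_fg_field:
  assumes H: "is_subgroup H" and F: "finite F" "\<psi> ` H \<subseteq> gen_field F"
  shows "fg_subgroup H"
proof -
  have "rank_le r (\<psi> ` H)"
  proof (rule rank_radical_closure)
    fix x assume "x \<in> \<psi> ` H"
    then show "x \<noteq> 0 \<and> (\<exists>n\<ge>1. x ^ n \<in> range \<psi>)" using chi_nonzero by (auto intro!: exI[of _ 1])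
  qed
  then have "fg_mul_group (\<psi> ` H)" using fg_mul_group_in_fg_field[OF F(1) mul_group_chi[OF H] F(2)] by blast
  then obtain X where X: "finite X" "X \<subseteq> \<psi> ` H" "\<And>N. mul_group N \<Longrightarrow> X \<subseteq> N \<Longrightarrow> \<psi> ` H \<subseteq> N"
    unfolding fg_mul_group_def by metis
  obtain Y where Y: "finite Y" "Y \<subseteq> H" "X = \<psi> ` Y" using finite_subset_image[OF X(1,2)] by blast
  have "H = gen_subgroup Y"
  proof
    show "gen_subgroup Y \<subseteq> H" using gen_subgroup_least[OF H Y(2)] .
    have "\<psi> ` H \<subseteq> \<psi> ` gen_subgroup Y"
      by (rule X(3)[OF mul_group_chi[OF subgroup_gen]]) (use Y gen_subgroup_superset in auto)
    then show "H \<subseteq> gen_subgroup Y" using chi_inj by (simp add: inj_image_subset_iff)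
  qed
  then show ?thesis using Y(1) by (auto simp: fg_subgroup_def)
qed

lemma root_of_unity_torsion: "\<psi> g \<in> roots_of_unity \<Longrightarrow> g \<in> torsion_subgroup"
proof -
  assume "\<psi> g \<in> roots_of_unity"
  then obtain n where n: "n \<ge> 1" "\<psi> g ^ n = 1" by (auto simp: roots_of_unity_def)
  then have "\<psi> (nsmul n g) = \<psi> 0" by (simp add: chi_nsmul chi_0)
  then have "nsmul n g = 0" using chi_inj by (meson injD)
  then show ?thesis using n(1) by (auto simp: torsion_subgroup_def Suc_le_eq)
qed

lemma torsion_root_of_unity: "g \<in> torsion_subgroup \<Longrightarrow> \<psi> g \<in> roots_of_unity"
  unfolding torsion_subgroup_def roots_of_unity_def
  by (auto simp: Suc_le_eq) (metis chi_0 chi_nsmul)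

text \<open>The radicals inside the field form a group of finite rank, hence a finitely generated
  one, and the product of the exponents of its generators serves all elements.
  \<open>schinzel\<close> produces such radicals, each with an exponent of its own.\<close>

lemma radical_closure_exponent:
  assumes F: "finite F"
  shows "\<exists>N\<ge>1. \<forall>l\<in>gen_field F. l \<noteq> 0 \<longrightarrow> (\<exists>n\<ge>1. l ^ n \<in> range \<psi>) \<longrightarrow> l ^ N \<in> range \<psi>"
proof -
  define M where "M = {l\<in>gen_field F. l \<noteq> 0 \<and> (\<exists>n\<ge>1. l ^ n \<in> range \<psi>)}"
  have RG: "mul_group (range \<psi>)" by (rule mul_group_chi[OF is_subgroup_UNIV])
  have M: "mul_group M" unfolding mul_group_def
  proof (intro conjI ballI)
    show "1 \<in> M" unfolding M_def using mul_group_1[OF RG] by (auto intro!: subring_1 subfield_subring subfield_fld exI[of _ 1])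
    show "0 \<notin> M" by (simp add: M_def)
    fix x y assume "x \<in> M" "y \<in> M"
    then obtain m n where mn: "m \<ge> 1" "n \<ge> 1" "x ^ m \<in> range \<psi>" "y ^ n \<in> range \<psi>" and
      xy: "x \<in> gen_field F" "y \<in> gen_field F" "x \<noteq> 0" "y \<noteq> 0" by (auto simp: M_def)
    have "(x / y) ^ (m * n) = (x ^ m) ^ n / (y ^ n) ^ m"
      unfolding power_divide power_mult[symmetric] by (simp add: mult.commute)
    also have "\<dots> \<in> range \<psi>" 
      by (rule mul_group_divide[OF RG mul_group_power[OF RG mn(3)] mul_group_power[OF RG mn(4)]])
    finally have "(x / y) ^ (m * n) \<in> range \<psi>" .
    moreover have "m * n \<ge> 1" using mn by simp
    moreover have "x / y \<in> gen_field F" "x / y \<noteq> 0" using xy subfield_divide[OF subfield_fld] by auto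
    ultimately show "x / y \<in> M" unfolding M_def by (intro CollectI conjI exI[of _ "m * n"])
  qed
  have "rank_le r M" by (rule rank_radical_closure) (auto simp: M_def)
  then have "fg_mul_group M" using fg_mul_group_in_fg_field[OF F M] by (auto simp: M_def)
  then obtain X where X: "finite X" "X \<subseteq> M" "\<And>N. mul_group N \<Longrightarrow> X \<subseteq> N \<Longrightarrow> M \<subseteq> N"
    unfolding fg_mul_group_def by metis
  have "\<forall>x\<in>X. \<exists>n\<ge>1. x ^ n \<in> range \<psi>" using X(2) by (auto simp: M_def)
  then obtain n where n: "\<And>x. x \<in> X \<Longrightarrow> n x \<ge> (1::nat)" "\<And>x. x \<in> X \<Longrightarrow> x ^ n x \<in> range \<psi>" by metis
  define N where "N = (\<Prod>x\<in>X. n x)"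
  have "N \<ge> 1" unfolding N_def using n(1) by (intro prod_ge_1) auto
  define R where "R = {l. l \<noteq> 0 \<and> l ^ N \<in> range \<psi>}"
  have "mul_group R" unfolding mul_group_def
    using mul_group_1[OF RG] mul_group_divide[OF RG] by (auto simp: R_def power_divide simp del: rangeI)
  moreover have "X \<subseteq> R"
  proof
    fix x assume x: "x \<in> X"
    have "N = n x * (\<Prod>x\<in>X-{x}. n x)" unfolding N_def using X(1) x by (simp add: prod.remove)
    then have "x ^ N = (x ^ n x) ^ (\<Prod>x\<in>X-{x}. n x)" by (simp add: power_mult)
    then have "x ^ N \<in> range \<psi>" using mul_group_power[OF RG n(2)[OF x]] by simp
    then show "x \<in> R" using x X(2) by (auto simp: R_def M_def)
  qed
  ultimately have "M \<subseteq> R" by (rule X(3))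
  then show ?thesis using \<open>N \<ge> 1\<close> by (intro exI[of _ N]) (auto simp: M_def R_def)
qed

text \<open>By Schinzel's theorem \<open>\<psi> g ^ w\<close> is a root of unity times some
  \<open>l\<close> in the field; \<open>l\<close> need not be a value of \<open>\<psi>\<close>, but
  \<open>l ^ N\<close> is. So \<open>N * w\<close> carries the cyclotomic part into torsion plus the
  part in the field, and finite rank leaves finitely many cosets, represented by
  \<open>X\<close>.\<close>

lemma cyclotomic_part:
  assumes F: "finite F" and rad: "\<And>g. \<exists>n\<ge>1. \<psi> g ^ n \<in> gen_field F"
  shows "\<exists>X. finite X \<and> (\<forall>f\<in>X. \<psi> f \<in> gen_field (gen_field F \<union> roots_of_unity)) \<and>
    (\<forall>g. \<psi> g \<in> gen_field (gen_field F \<union> roots_of_unity) \<longrightarrow> (\<exists>f\<in>X. \<exists>t\<in>torsion_subgroup. \<psi> (g - f - t) \<in> gen_field F))"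
proof -
  define L where "L = gen_field F"
  have L: "is_subfield L" by (simp add: L_def subfield_fld)
  obtain w where w: "w \<ge> 1" "\<And>z. z \<in> L \<Longrightarrow> z \<in> roots_of_unity \<Longrightarrow> z ^ w = 1"
    using roots_of_unity_exponent[OF F] unfolding L_def roots_of_unity_def by blast
  obtain N where N: "N \<ge> 1" "\<And>l. l \<in> L \<Longrightarrow> l \<noteq> 0 \<Longrightarrow> \<exists>n\<ge>1. l ^ n \<in> range \<psi> \<Longrightarrow> l ^ N \<in> range \<psi>"
    using radical_closure_exponent[OF F] unfolding L_def by blast
  define K where "K = {g. \<exists>t\<in>torsion_subgroup. \<psi> (g - t) \<in> L}"
  define G1 where "G1 = {g. \<psi> g \<in> gen_field (L \<union> roots_of_unity)}"
  have K: "is_subgroup K" unfolding is_subgroup_def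
  proof (intro conjI ballI)
    have "\<psi> 0 \<in> roots_of_unity" using mul_group_1[OF mul_group_roots_of_unity] by (simp add: chi_0)
    then have "(0 :: 'g) \<in> torsion_subgroup" by (rule root_of_unity_torsion)
    moreover have "\<psi> (0 - 0) \<in> L" using L by (simp add: chi_0 subfield_subring subring_1)
    ultimately show "0 \<in> K" unfolding K_def by blast
    fix x y assume "x \<in> K" "y \<in> K"
    then obtain s t where st: "s \<in> torsion_subgroup" "t \<in> torsion_subgroup" "\<psi> (x - s) \<in> L" "\<psi> (y - t) \<in> L"
      by (auto simp: K_def)
    have "s - t \<in> torsion_subgroup" using torsion_root_of_unity st(1,2) root_of_unity_torsion
      mul_group_divide[OF mul_group_roots_of_unity] by (metis chi_diff)
    moreover have "x - y - (s - t) = (x - s) - (y - t)" by (simp add: algebra_simps)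
    then have "\<psi> (x - y - (s - t)) \<in> L" using subfield_divide[OF L st(3,4)] by (simp only: chi_diff)
    ultimately show "x - y \<in> K" unfolding K_def by blast
  qed
  have "nsmul (N * w) g \<in> K" if g: "g \<in> G1" for g
  proof -
    obtain n where n: "n \<ge> 1" "\<psi> g ^ n \<in> L" using rad by (auto simp: L_def)
    obtain z l where zl: "z \<in> roots_of_unity" "l \<in> L" "\<psi> g ^ w = z * l"
      using schinzel[OF L w chi_nonzero n] g by (auto simp: G1_def)
    have l0: "l \<noteq> 0" using zl(3) chi_nonzero[of g] by auto
    obtain m where m: "m \<ge> 1" "z ^ m = 1" using zl(1) by (auto simp: roots_of_unity_def)
    have "l ^ m = (\<psi> g ^ w) ^ m" using m by (simp add: zl(3) power_mult_distrib)
    also have "\<dots> = \<psi> (nsmul (m * w) g)" by (simp add: chi_nsmul power_mult[symmetric] mult.commute)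
    finally have "\<exists>n\<ge>1. l ^ n \<in> range \<psi>" using m by auto
    from N(2)[OF zl(2) l0 this] obtain h where h: "l ^ N = \<psi> h" by auto
    have "\<psi> (nsmul (N * w) g) = (\<psi> g ^ w) ^ N" by (simp add: chi_nsmul power_mult[symmetric] mult.commute)
    also have "\<dots> = z ^ N * \<psi> h" by (simp add: zl(3) power_mult_distrib h)
    finally have e: "\<psi> (nsmul (N * w) g - h) = z ^ N" using chi_nonzero[of h] by (simp add: chi_diff)
    then have "nsmul (N * w) g - h \<in> torsion_subgroup"
      using root_of_unity_torsion mul_group_power[OF mul_group_roots_of_unity zl(1)] by metis
    moreover have "\<psi> (nsmul (N * w) g - (nsmul (N * w) g - h)) \<in> L"
      using h subring_power[OF subfield_subring[OF L] zl(2), of N] by simp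
    ultimately show ?thesis unfolding K_def by blast
  qed
  moreover have "N * w \<ge> 1" using N(1) w(1) by simp
  ultimately obtain X where X: "finite X" "X \<subseteq> G1" "\<And>g. g \<in> G1 \<Longrightarrow> \<exists>f\<in>X. g - f \<in> K"
    using rank_finite_index[OF rank K, of "N * w" G1] by metis
  show ?thesis
  proof (intro exI[of _ X] conjI allI impI ballI)
    show "finite X" by fact
    show "\<psi> f \<in> gen_field (gen_field F \<union> roots_of_unity)" if "f \<in> X" for f using that X(2) by (auto simp: G1_def L_def)
    show "\<exists>f\<in>X. \<exists>t\<in>torsion_subgroup. \<psi> (g - f - t) \<in> gen_field F" if "\<psi> g \<in> gen_field (gen_field F \<union> roots_of_unity)" for g
      using X(3)[of g] that by (auto simp: G1_def K_def L_def)
  qed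
qed

text \<open>\<open>independent_cosets\<close> is used twice: over \<open>K\<close>, which contains
  all roots of unity, and then over \<open>L1\<close> inside a single coset modulo \<open>K\<close>.
  \<open>L1\<close> contains the values of the finitely many representatives \<open>Y\<close>, so
  modulo \<open>L1\<close> this coset consists of torsion values up to translation.\<close>

lemma coset_sums_vanish:
  assumes F: "finite F" and rad: "\<And>g. \<exists>n\<ge>1. \<psi> g ^ n \<in> gen_field F"
    and Q: "Q \<ge> 1" "zeta (Q ^ 2) \<in> gen_field F" "\<And>t :: 'g. t \<in> torsion_subgroup \<Longrightarrow> \<exists>s. nsmul (Q ^ s) t = 0"
  shows "\<exists>F1. finite F1 \<and> (\<forall>X c g0. finite X \<longrightarrow> (\<forall>g\<in>X. c g \<in> gen_field F) \<longrightarrow> (\<Sum>g\<in>X. c g * \<psi> g) = 0 \<longrightarrow>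
    g0 \<in> X \<longrightarrow> (\<Sum>g\<in>{g\<in>X. \<psi> (g - g0) \<in> gen_field F1}. c g * \<psi> g) = 0)"
proof -
  define L where "L = gen_field F"
  define K where "K = gen_field (L \<union> roots_of_unity)"
  obtain Y where Y: "finite Y" "\<And>f. f \<in> Y \<Longrightarrow> \<psi> f \<in> K"
    "\<And>g. \<psi> g \<in> K \<Longrightarrow> \<exists>f\<in>Y. \<exists>t\<in>torsion_subgroup. \<psi> (g - f - t) \<in> L"
    using cyclotomic_part[OF F rad] unfolding K_def L_def by blast
  define F1 where "F1 = F \<union> \<psi> ` Y"
  define L1 where "L1 = gen_field F1"
  have L1: "is_subfield L1" and K: "is_subfield K" by (simp_all add: L1_def K_def subfield_fld)
  note S1 = subfield_subring[OF L1]
  have LL1: "L \<subseteq> L1" unfolding L_def L1_def F1_def by (rule gen_field_mono) auto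
  have LK: "L \<subseteq> K" "roots_of_unity \<subseteq> K" using gen_field_superset[of "L \<union> roots_of_unity"] by (auto simp: K_def)
  have YL1: "\<psi> f \<in> L1" if "f \<in> Y" for f using gen_field_superset[of F1] that by (auto simp: F1_def L1_def)
  have L1K: "L1 \<subseteq> K" unfolding L1_def
    by (rule gen_field_least[OF K]) (use LK Y(2) gen_field_superset[of F] in \<open>auto simp: F1_def L_def\<close>)
  have RG: "mul_group (range \<psi>)" by (rule mul_group_chi[OF is_subgroup_UNIV])
  \<comment> \<open>Torsion values times non-zero elements of \<open>L1\<close>:
    \<open>cyclotomic_step\<close> applies to the torsion factors, and an embedding fixes the
    others.\<close>
  define \<Gamma> where "\<Gamma> = {z * l | z l. (\<exists>t\<in>torsion_subgroup. z = \<psi> t) \<and> l \<in> L1 \<and> l \<noteq> 0}"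
  have \<Gamma>I: "z * l \<in> \<Gamma>" if "z = \<psi> t" "t \<in> torsion_subgroup" "l \<in> L1" "l \<noteq> 0" for z l t
    using that unfolding \<Gamma>_def by blast
  have t0: "0 \<in> (torsion_subgroup :: 'g set)" by (auto simp: torsion_subgroup_def)
  have td: "s - t \<in> torsion_subgroup" if "s \<in> torsion_subgroup" "t \<in> torsion_subgroup" for s t :: 'g
    using torsion_root_of_unity that root_of_unity_torsion mul_group_divide[OF mul_group_roots_of_unity] by (metis chi_diff)
  have \<Gamma>: "mul_group \<Gamma>" unfolding mul_group_def
  proof (intro conjI ballI)
    show "1 \<in> \<Gamma>" using \<Gamma>I[OF _ t0 subring_1[OF S1], of 1] by (simp add: chi_0)
    show "0 \<notin> \<Gamma>" using chi_nonzero by (auto simp: \<Gamma>_def)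
    fix x y assume "x \<in> \<Gamma>" "y \<in> \<Gamma>"
    then obtain s l t m where *: "x = \<psi> s * l" "y = \<psi> t * m" "s \<in> torsion_subgroup" "t \<in> torsion_subgroup"
      "l \<in> L1" "l \<noteq> 0" "m \<in> L1" "m \<noteq> 0" unfolding \<Gamma>_def by blast
    have "x / y = \<psi> (s - t) * (l / m)" by (simp add: * chi_diff)
    then show "x / y \<in> \<Gamma>" using \<Gamma>I[OF refl td[OF *(3,4)] subfield_divide[OF L1 *(5,7)]] * by simp
  qed
  have L1alg: "algebraic_over L1 x" if "x \<in> L1" for x using that by (rule algebraic_over_self[OF L1])
  have talg: "algebraic_over L1 (\<psi> t)" if "t \<in> torsion_subgroup" for t
    using torsion_root_of_unity[OF that] by (rule roots_of_unity_alg[OF L1])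
  have A1: "is_subring {z. algebraic_over L1 z}" by (rule embedding_subring[OF L1])
  have \<Gamma>A: "\<Gamma> \<subseteq> {z. algebraic_over L1 z}"
    unfolding \<Gamma>_def using talg L1alg subring_mult[OF A1] by auto
  have step1: "\<exists>\<sigma>. hom_on {z. algebraic_over L1 z} \<sigma> \<and> (\<forall>x\<in>L1. \<sigma> x = x) \<and> (\<forall>m\<in>J. \<exists>\<omega>\<in>L1. \<sigma> m = \<omega> * m) \<and> (\<exists>m\<in>J. \<sigma> m \<noteq> m)"
    if J: "finite J" "J \<subseteq> \<Gamma>" "\<not> J \<subseteq> L1" for J
  proof -
    have "\<forall>m\<in>J. \<exists>t l. m = \<psi> t * l \<and> t \<in> torsion_subgroup \<and> l \<in> L1 \<and> l \<noteq> 0" using J(2) unfolding \<Gamma>_def by blast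
    then obtain t l where tl: "\<And>m. m \<in> J \<Longrightarrow> m = \<psi> (t m) * l m \<and> t m \<in> torsion_subgroup \<and> l m \<in> L1 \<and> l m \<noteq> 0" by metis
    define Z where "Z = (\<lambda>m. \<psi> (t m)) ` J"
    have "\<not> Z \<subseteq> L1"
    proof
      assume "Z \<subseteq> L1"
      then have "m \<in> L1" if "m \<in> J" for m using tl[OF that] subring_mult[OF S1, of "\<psi> (t m)" "l m"] that by (auto simp: Z_def)
      then show False using J(3) by blast
    qed
    moreover have "\<exists>s. z ^ (Q ^ s) = 1" if z: "z \<in> Z" for z
    proof -
      obtain m where m: "m \<in> J" "z = \<psi> (t m)" using z by (auto simp: Z_def)
      then obtain s where "nsmul (Q ^ s) (t m) = 0" using Q(3) tl by blast
      then show ?thesis using m chi_nsmul chi_0 by metis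
    qed
    moreover have "finite Z" using J(1) by (simp add: Z_def)
    moreover have "zeta (Q ^ 2) \<in> L1" using Q(2) LL1 by (auto simp: L_def)
    ultimately obtain \<sigma> where \<sigma>: "hom_on {z. algebraic_over L1 z} \<sigma>" "\<forall>x\<in>L1. \<sigma> x = x" "\<forall>m\<in>Z. \<exists>\<omega>\<in>L1. \<sigma> m = \<omega> * m" "\<exists>m\<in>Z. \<sigma> m \<noteq> m"
      using cyclotomic_step[OF L1 _ Q(1), of Z] by blast
    have \<sigma>m: "\<sigma> m = \<sigma> (\<psi> (t m)) * l m" if "m \<in> J" for m
      using tl[OF that] hom_mult[OF A1 \<sigma>(1), of "\<psi> (t m)" "l m"] talg L1alg \<sigma>(2) by simp
    have "\<exists>\<omega>\<in>L1. \<sigma> m = \<omega> * m" if m: "m \<in> J" for m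
    proof -
      obtain \<omega> where "\<omega> \<in> L1" "\<sigma> (\<psi> (t m)) = \<omega> * \<psi> (t m)" using \<sigma>(3) m by (auto simp: Z_def)
      then have "\<sigma> m = \<omega> * (\<psi> (t m) * l m)" using \<sigma>m[OF m] by simp
      then show ?thesis using tl[OF m] \<open>\<omega> \<in> L1\<close> by metis
    qed
    moreover have "\<exists>m\<in>J. \<sigma> m \<noteq> m"
    proof -
      obtain m where m: "m \<in> J" "\<sigma> (\<psi> (t m)) \<noteq> \<psi> (t m)" using \<sigma>(4) by (auto simp: Z_def)
      then have "\<sigma> m \<noteq> m" using \<sigma>m[OF m(1)] tl[OF m(1)] by (metis mult_right_cancel)
      then show ?thesis using m by blast
    qed
    ultimately show ?thesis using \<sigma> by blast
  qed
  have radK: "\<exists>n\<ge>1. g ^ n \<in> K" if "g \<in> range \<psi>" for g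
    using that rad LK(1) unfolding L_def by blast
  have chiA: "range \<psi> \<subseteq> {z. algebraic_over K z}" using radK radical_alg[OF K] by blast
  have main: "(\<Sum>g\<in>{g\<in>X. \<psi> (g - g0) \<in> L1}. c g * \<psi> g) = 0"
    if X: "finite X" and c: "\<forall>g\<in>X. c g \<in> L" and sum0: "(\<Sum>g\<in>X. c g * \<psi> g) = 0" and g0: "g0 \<in> X" for X c g0
  proof -
    define I where "I = {g\<in>X. \<psi> g / \<psi> g0 \<in> K}"
    have "(\<Sum>g\<in>{g\<in>X. \<psi> g / \<psi> g0 \<in> K}. c g * \<psi> g) = 0"
    proof (rule independent_cosets[OF K RG embedding_subring[OF K] _ chiA _ X _ _ sum0 g0])
      show "K \<subseteq> {z. algebraic_over K z}" using algebraic_over_self[OF K] by blast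
      show "\<exists>\<sigma>. hom_on {z. algebraic_over K z} \<sigma> \<and> (\<forall>x\<in>K. \<sigma> x = x) \<and> (\<forall>m\<in>J. \<exists>\<omega>\<in>K. \<sigma> m = \<omega> * m) \<and> (\<exists>m\<in>J. \<sigma> m \<noteq> m)"
        if "finite J" "J \<subseteq> range \<psi>" "1 \<in> J" "\<not> J \<subseteq> K" for J
        using kummer_step[OF K LK(2) radK that(2,4)] .
      show "\<psi> i \<in> range \<psi>" for i by blast
      show "c i \<in> K" if "i \<in> X" for i using c that LK(1) by blast
    qed
    then have sumI: "(\<Sum>g\<in>I. c g * (\<psi> g / \<psi> g0)) = 0" by (simp add: I_def sum_divide_distrib[symmetric])
    have g0I: "g0 \<in> I" using g0 chi_nonzero subring_1[OF subfield_subring[OF K]] by (simp add: I_def)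
    \<comment> \<open>Division by \<open>\<psi> g0\<close> moves the coset into \<open>K\<close>,
      and its elements into \<open>\<Gamma>\<close>. The divisor
      \<open>\<psi> g0 / \<psi> g0\<close> is the shape in which \<open>independent_cosets\<close>
      speaks of the coset of \<open>g0\<close>.\<close>
    have "(\<Sum>g\<in>{g\<in>I. (\<psi> g / \<psi> g0) / (\<psi> g0 / \<psi> g0) \<in> L1}. c g * (\<psi> g / \<psi> g0)) = 0"
    proof (rule independent_cosets[OF L1 \<Gamma> A1 _ \<Gamma>A _ _ _ _ sumI g0I])
      show "L1 \<subseteq> {z. algebraic_over L1 z}" using L1alg by blast
      show "finite I" using X by (simp add: I_def)
      show "c i \<in> L1" if "i \<in> I" for i using c that LL1 by (auto simp: I_def)
      show "\<psi> i / \<psi> g0 \<in> \<Gamma>" if "i \<in> I" for i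
      proof -
        have "\<psi> (i - g0) \<in> K" using that by (simp add: I_def chi_diff)
        then obtain f t where ft: "f \<in> Y" "t \<in> torsion_subgroup" "\<psi> (i - g0 - f - t) \<in> L" using Y(3) by blast
        have "\<psi> i / \<psi> g0 = \<psi> t * (\<psi> f * \<psi> (i - g0 - f - t))"
          using chi_nonzero by (simp add: chi_diff)
        moreover have "\<psi> f * \<psi> (i - g0 - f - t) \<in> L1" using YL1[OF ft(1)] ft(3) LL1 by (intro subring_mult[OF S1]) auto
        ultimately show ?thesis using \<Gamma>I[OF refl ft(2)] chi_nonzero by simp
      qed
      show "\<exists>\<sigma>. hom_on {z. algebraic_over L1 z} \<sigma> \<and> (\<forall>x\<in>L1. \<sigma> x = x) \<and> (\<forall>m\<in>J. \<exists>\<omega>\<in>L1. \<sigma> m = \<omega> * m) \<and> (\<exists>m\<in>J. \<sigma> m \<noteq> m)"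
        if "finite J" "J \<subseteq> \<Gamma>" "1 \<in> J" "\<not> J \<subseteq> L1" for J
        using step1 that by blast
    qed
    moreover have "{g\<in>I. (\<psi> g / \<psi> g0) / (\<psi> g0 / \<psi> g0) \<in> L1} = {g\<in>X. \<psi> (g - g0) \<in> L1}"
      using L1K chi_nonzero by (auto simp: I_def chi_diff)
    ultimately have "(\<Sum>g\<in>{g\<in>X. \<psi> (g - g0) \<in> L1}. c g * \<psi> g) / \<psi> g0 = 0"
      by (simp add: sum_divide_distrib)
    then show ?thesis using chi_nonzero by simp
  qed
  have "finite F1" using F Y(1) by (simp add: F1_def)
  then show ?thesis using main unfolding L_def L1_def by blast
qed

end

section \<open>Control by cosets and the controller\<close>

lemma ext_idealI:
  assumes "finite J" "\<And>j. j \<in> J \<Longrightarrow> a j \<in> S"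
  shows "(\<Sum>j\<in>J. a j * b j) \<in> ext_ideal S"
proof -
  obtain f where f: "bij_betw f {0..<card J} J" using ex_bij_betw_nat_finite[OF assms(1)] by blast
  have "(\<Sum>j\<in>J. a j * b j) = (\<Sum>i\<in>{0..<card J}. a (f i) * b (f i))"
    using sum.reindex_bij_betw[OF f, of "\<lambda>j. a j * b j"] by simp
  moreover have "(\<lambda>i. a (f i)) ` {0..<card J} \<subseteq> S" using f assms(2) by (auto simp: bij_betw_def)
  ultimately show ?thesis unfolding ext_ideal_def
    by (intro CollectI exI[of _ "{0..<card J}"] exI[of _ "\<lambda>i. a (f i)"] exI[of _ "\<lambda>i. b (f i)"]) auto
qed

lemma ext_ideal_subset: "is_ideal P \<Longrightarrow> S \<subseteq> P \<Longrightarrow> ext_ideal S \<subseteq> P"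
  unfolding ext_ideal_def by (auto intro!: ideal_sum ideal_mult2)

lemma poly_mapping_sum_singles:
  "a = (\<Sum>g\<in>Poly_Mapping.keys a. Poly_Mapping.single g (Poly_Mapping.lookup a g))"
  by (rule poly_mapping_eqI) (auto simp: lookup_sum lookup_single when_def sum.delta in_keys_iff)

text \<open>Group elements are units of the group algebra: translation moves the part of
  \<open>a\<close> on one coset into the subalgebra of \<open>H\<close> without leaving
  \<open>P\<close>, and translating back writes \<open>a\<close> as a combination of elements of
  \<open>P\<close> in this subalgebra.\<close>

lemma controls_by_cosets:
  fixes P :: "('g::ab_group_add \<Rightarrow>\<^sub>0 'k::comm_ring_1) set"
  assumes P: "is_ideal P" and H: "is_subgroup H"
    and cosets: "\<And>a g0. a \<in> P \<Longrightarrow> g0 \<in> Poly_Mapping.keys a \<Longrightarrow>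
      (\<Sum>g\<in>{g\<in>Poly_Mapping.keys a. g - g0 \<in> H}. Poly_Mapping.single g (Poly_Mapping.lookup a g)) \<in> P"
  shows "controls H P"
  unfolding controls_def
proof
  show "ext_ideal (P \<inter> subalg H) \<subseteq> P" by (rule ext_ideal_subset[OF P]) auto
  show "P \<subseteq> ext_ideal (P \<inter> subalg H)"
  proof
    fix a assume a: "a \<in> P"
    define X where "X = Poly_Mapping.keys a"
    define s where "s = (\<lambda>g. Poly_Mapping.single g (Poly_Mapping.lookup a g))"
    define rep where "rep = (\<lambda>g. SOME x. x \<in> X \<and> g - x \<in> H)"
    have rep: "rep g \<in> X" "g - rep g \<in> H" if "g \<in> X" for g
    proof -
      have "rep g \<in> X \<and> g - rep g \<in> H" unfolding rep_def
        by (rule someI[of _ g]) (use that subgroup_0[OF H] in auto)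
      then show "rep g \<in> X" "g - rep g \<in> H" by auto
    qed
    have rep_eq: "rep g = rep h \<longleftrightarrow> g - h \<in> H" if gh: "g \<in> X" "h \<in> X" for g h
    proof
      assume "rep g = rep h"
      then have "g - h = (g - rep g) - (h - rep h)" by simp
      then show "g - h \<in> H" using rep(2)[OF gh(1)] rep(2)[OF gh(2)] subgroup_diff[OF H] by metis
    next
      assume d: "g - h \<in> H"
      have "g - x \<in> H \<longleftrightarrow> h - x \<in> H" for x
        using subgroup_diff[OF H, of "g - x" "g - h"] subgroup_add[OF H d, of "h - x"] d by auto
      then show "rep g = rep h" unfolding rep_def by simp
    qed
    define J where "J = rep ` X"
    define b where "b = (\<lambda>m. \<Sum>g\<in>{g\<in>X. rep g = m}. s g)"
    have bP: "b m \<in> P" if m: "m \<in> J" for m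
    proof -
      obtain h where h: "h \<in> X" "m = rep h" using m by (auto simp: J_def)
      have "{g\<in>X. rep g = m} = {g\<in>X. g - h \<in> H}" using rep_eq h by auto
      then show ?thesis using cosets[OF a, of h] h by (simp add: b_def s_def X_def)
    qed
    have bH: "Poly_Mapping.single (- m) 1 * b m \<in> P \<inter> subalg H" if m: "m \<in> J" for m
    proof
      show "Poly_Mapping.single (- m) 1 * b m \<in> P" by (rule ideal_mult[OF P bP[OF m]])
      have "Poly_Mapping.single (- m) 1 * b m = (\<Sum>g\<in>{g\<in>X. rep g = m}. Poly_Mapping.single (g - m) (Poly_Mapping.lookup a g))"
        by (simp add: b_def s_def sum_distrib_left mult_single)
      also have "Poly_Mapping.keys \<dots> \<subseteq> (\<Union>g\<in>{g\<in>X. rep g = m}. Poly_Mapping.keys (Poly_Mapping.single (g - m) (Poly_Mapping.lookup a g)))"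
        by (rule keys_sum)
      also have "\<dots> \<subseteq> H" using rep(2) by auto
      finally show "Poly_Mapping.single (- m) 1 * b m \<in> subalg H" by (simp add: subalg_def)
    qed
    have "a = (\<Sum>g\<in>X. s g)" unfolding X_def s_def by (rule poly_mapping_sum_singles)
    also have "\<dots> = (\<Sum>m\<in>J. b m)" unfolding J_def b_def by (rule sum.image_gen) (simp add: X_def)
    also have "\<dots> = (\<Sum>m\<in>J. (Poly_Mapping.single (- m) 1 * b m) * Poly_Mapping.single m 1)"
    proof (intro sum.cong refl)
      fix m
      have "(Poly_Mapping.single (- m) 1 * b m) * Poly_Mapping.single m 1 =
          (Poly_Mapping.single (- m) 1 * Poly_Mapping.single m 1) * b m" by (simp add: mult_ac)
      also have "Poly_Mapping.single (- m) 1 * Poly_Mapping.single m (1::'k) = 1" by (simp add: mult_single)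
      finally show "b m = (Poly_Mapping.single (- m) 1 * b m) * Poly_Mapping.single m 1" by simp
    qed
    also have "\<dots> \<in> ext_ideal (P \<inter> subalg H)"
      by (rule ext_idealI) (use bH in \<open>auto simp: J_def X_def\<close>)
    finally show "a \<in> ext_ideal (P \<inter> subalg H)" .
  qed
qed

lemma is_subgroup_controller: "is_subgroup (controller P)"
  by (auto simp: controller_def is_subgroup_def)

theorem theorem3p1:
  fixes P :: "('g::ab_group_add \<Rightarrow>\<^sub>0 'k::field_char_0) set"
  assumes "fg_field TYPE('k)"
    and "finite_rank_group TYPE('g)"
    and "chernikov (torsion_subgroup :: 'g set)"
    and "prime_ideal P"
    and "faithful P"
  shows "fg_subgroup (controller P)"
proof -
  have I: "is_ideal P" using assms(4) by (simp add: prime_ideal_def)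
  obtain F where F: "finite F" "gen_field F = (UNIV :: 'k set)"
    using assms(1) unfolding fg_field_def gen_field_def by blast
  obtain r where r: "group_rank_le r TYPE('g)" using finite_rank_group_rank_le[OF assms(2)] by blast
  have "countable (UNIV :: 'k set)" using countable_fld[of F] F by (simp add: countable_finite)
  then have ctble: "countable (UNIV :: ('g \<Rightarrow>\<^sub>0 'k) set)" by (rule countable_poly_mapping[OF rank_countable[OF r]])
  \<comment> \<open>A non-zero integer is invertible in \<open>k\<close>, so a proper ideal of
    \<open>kG\<close> cannot contain it.\<close>
  have "n = 0" if n: "of_int n \<in> P" for n
  proof (rule ccontr)
    assume "n \<noteq> 0"
    have "Poly_Mapping.single 0 (inverse (of_int n)) * of_int n \<in> P" by (rule ideal_mult[OF I n])
    moreover have "Poly_Mapping.single 0 (inverse (of_int n)) * of_int n = (1 :: 'g \<Rightarrow>\<^sub>0 'k)"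
      using \<open>n \<noteq> 0\<close> by (simp add: mult_single flip: single_of_int)
    ultimately have "x \<in> P" for x using ideal_mult[OF I, of 1 x] by simp
    then show False using assms(4) by (auto simp: prime_ideal_def)
  qed
  then obtain \<Phi> :: "('g \<Rightarrow>\<^sub>0 'k) \<Rightarrow> complex" where \<Phi>: "hom_on UNIV \<Phi>" "\<And>a. \<Phi> a = 0 \<longleftrightarrow> a \<in> P"
    using embedding_into_complex[OF assms(4) ctble] by blast
  have U: "is_subring (UNIV :: ('g \<Rightarrow>\<^sub>0 'k) set)" by (simp add: is_subring_def)
  note \<Phi>_mult = hom_mult[OF U \<Phi>(1) UNIV_I UNIV_I] and \<Phi>_diff = hom_diff[OF U \<Phi>(1) UNIV_I UNIV_I]
    and \<Phi>_1 = hom_1[OF U \<Phi>(1)] and \<Phi>_sum = hom_sum[OF U \<Phi>(1) UNIV_I]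
  define \<iota> where "\<iota> = (\<lambda>c. \<Phi> (Poly_Mapping.single 0 c))"
  define \<psi> where "\<psi> = (\<lambda>g. \<Phi> (Poly_Mapping.single g 1))"
  have \<Phi>_single: "\<Phi> (Poly_Mapping.single g c) = \<iota> c * \<psi> g" for g c
    unfolding \<iota>_def \<psi>_def \<Phi>_mult[symmetric] by (simp add: mult_single)
  have \<psi>_add: "\<psi> (g + h) = \<psi> g * \<psi> h" for g h
    unfolding \<psi>_def \<Phi>_mult[symmetric] by (simp add: mult_single)
  have "\<psi> g * \<psi> (- g) = 1" for g unfolding \<psi>_add[symmetric] by (simp add: \<psi>_def \<Phi>_1)
  then have \<psi>_nz: "\<psi> g \<noteq> 0" for g by (metis mult_zero_left zero_neq_one)
  have "inj \<psi>"
  proof (rule injI)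
    fix g h assume "\<psi> g = \<psi> h"
    then have "\<psi> (g - h) = 1" using \<psi>_add[of "g - h" h] \<psi>_nz[of h] by simp
    then have "Poly_Mapping.single (g - h) 1 - 1 \<in> P" unfolding \<Phi>(2)[symmetric] \<Phi>_diff by (simp add: \<psi>_def \<Phi>_1)
    then have "Poly_Mapping.single (g - h) 1 \<in> {1 + x | x. x \<in> P}"
      by (intro CollectI exI[of _ "Poly_Mapping.single (g - h) 1 - 1"]) simp
    then have "g - h = 0" using assms(5) unfolding faithful_def by blast
    then show "g = h" by simp
  qed
  then interpret faithful_character \<psi> r by unfold_locales (use \<psi>_add \<psi>_nz r in auto)
  obtain s x where sx: "\<And>g::'g. \<exists>n e. n \<ge> 1 \<and> nsmul n g = (\<Sum>i<(s::nat). zsmul (e i) (x i))"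
    using rank_maximal_independent[OF r] by blast
  obtain Q where Q: "Q \<ge> 1" "\<And>t :: 'g. t \<in> torsion_subgroup \<Longrightarrow> \<exists>s. nsmul (Q ^ s) t = 0"
    using chernikov_primary[OF assms(3)] by blast
  \<comment> \<open>Each ingredient answers one requirement of \<open>coset_sums_vanish\<close>: all
    scalars \<open>\<iota> c\<close> lie in the field, every \<open>\<psi> g\<close> has a power in
    it, and \<open>zeta (Q ^ 2)\<close> is there for the torsion part.\<close>
  define F0 where "F0 = \<iota> ` F \<union> \<psi> ` x ` {..<s} \<union> {zeta (Q ^ 2)}"
  have F0: "finite F0" using F by (simp add: F0_def)
  note L0 = subfield_fld[of F0]
  have F0sub: "F0 \<subseteq> gen_field F0" by (rule gen_field_superset)
  have \<iota>_mem: "\<iota> c \<in> gen_field F0" for c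
  proof -
    have hom: "\<iota> 1 = 1" "\<iota> (a - b) = \<iota> a - \<iota> b" "\<iota> (a * b) = \<iota> a * \<iota> b" for a b
      unfolding \<iota>_def \<Phi>_diff[symmetric] \<Phi>_mult[symmetric] using \<Phi>_1 by (simp_all add: single_diff mult_single)
    have z: "\<iota> 0 = 0" using hom(2)[of 0 0] by simp
    have inv: "\<iota> (inverse a) = inverse (\<iota> a)" for a
    proof (cases "a = 0")
      case False
      then have "\<iota> a * \<iota> (inverse a) = 1" by (simp flip: hom)
      then show ?thesis by (metis inverse_unique)
    qed (simp add: z)
    \<comment> \<open>\<open>\<iota>\<close> is a field homomorphism, so this preimage is a field;
      it contains the generators of \<open>k\<close>, hence all of \<open>k\<close>.\<close>
    have "is_subfield {c. \<iota> c \<in> gen_field F0}" using L0 by (simp add: is_subfield_def hom z inv)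
    moreover have "F \<subseteq> {c. \<iota> c \<in> gen_field F0}" using F0sub by (auto simp: F0_def)
    ultimately have "gen_field F \<subseteq> {c. \<iota> c \<in> gen_field F0}" by (rule gen_field_least)
    then show ?thesis using F by auto
  qed
  have rad: "\<exists>n\<ge>1. \<psi> g ^ n \<in> gen_field F0" for g
  proof -
    obtain n e where ne: "n \<ge> 1" "nsmul n g = (\<Sum>i<s. zsmul (e i) (x i))" using sx by blast
    have "\<psi> g ^ n = (\<Prod>i<s. \<psi> (x i) powi e i)" by (simp add: chi_nsmul[symmetric] ne(2) chi_sum chi_zsmul)
    also have "\<dots> \<in> gen_field F0" using F0sub
      by (intro subring_prod subfield_subring L0 subfield_powi) (auto simp: F0_def)
    finally show ?thesis using ne(1) by blast
  qed
  obtain F1 where F1: "finite F1" "\<And>X c g0. finite X \<Longrightarrow> \<forall>g\<in>X. c g \<in> gen_field F0 \<Longrightarrow> (\<Sum>g\<in>X. c g * \<psi> g) = 0 \<Longrightarrow>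
    g0 \<in> X \<Longrightarrow> (\<Sum>g\<in>{g\<in>X. \<psi> (g - g0) \<in> gen_field F1}. c g * \<psi> g) = 0"
    using coset_sums_vanish[OF F0 rad Q(1) _ Q(2)] F0sub by (auto simp: F0_def)
  define H where "H = {g. \<psi> g \<in> gen_field F1}"
  have H: "is_subgroup H" unfolding is_subgroup_def H_def
    using subfield_divide[OF subfield_fld] subring_1[OF subfield_subring[OF subfield_fld]] by (auto simp: chi_0 chi_diff)
  have "controls H P"
  proof (rule controls_by_cosets[OF I H])
    fix a g0 assume a: "a \<in> P" "g0 \<in> Poly_Mapping.keys a"
    have "\<Phi> a = (\<Sum>g\<in>Poly_Mapping.keys a. \<iota> (Poly_Mapping.lookup a g) * \<psi> g)"
      by (subst poly_mapping_sum_singles) (simp add: \<Phi>_sum \<Phi>_single)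
    moreover have "\<Phi> a = 0" using \<Phi>(2) a(1) by blast
    ultimately have "(\<Sum>g\<in>Poly_Mapping.keys a. \<iota> (Poly_Mapping.lookup a g) * \<psi> g) = 0" by (simp only:)
    then have "(\<Sum>g\<in>{g\<in>Poly_Mapping.keys a. g - g0 \<in> H}. \<iota> (Poly_Mapping.lookup a g) * \<psi> g) = 0"
      unfolding H_def mem_Collect_eq by (intro F1(2)) (use \<iota>_mem a in auto)
    then show "(\<Sum>g\<in>{g\<in>Poly_Mapping.keys a. g - g0 \<in> H}. Poly_Mapping.single g (Poly_Mapping.lookup a g)) \<in> P"
      unfolding \<Phi>(2)[symmetric] \<Phi>_sum \<Phi>_single .
  qed
  then have "controller P \<subseteq> H" using H by (auto simp: controller_def)
  then have "\<psi> ` controller P \<subseteq> gen_field F1" by (auto simp: H_def)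
  then show ?thesis by (rule fg_subgroup_in_fg_field[OF is_subgroup_controller F1(1)])
qed

end
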